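(* Let $E$ be a Polish space (with isolated point $\iota$ adjoined), let $(\mathcal P,\mathcal T,G)$ be a Markov control problem with $G$ $(\mathcal P,\mathcal T)$-approximately disintegrable, and let $v:E\to[-\infty,\infty]$, $v(x)=\inf_{\mu\in\mathcal P^x}\mathbb E^{\mu}[G]$, be its value function. Then: \begin{enumerate} \item The function $v$ is lower semi-analytic and, hence, universally measurable. \item For each $\varepsilon>0$ there exists a universally measurable selector $\hat\nu^{\varepsilon}\in\mathcal S(\mathcal P)$ such that $\hat\nu^{\varepsilon}_x$ is $\varepsilon$-optimal for each $x\in E$. \item The dynamic programming principle holds at all $\tau\in\mathcal T$; more precisely, following the convention that $\mathbb E^{\mu}[Y]=\infty$ as soon as $\mathbb E^{\mu}[Y^+]=\infty$, we have $$v(x)=\inf_{\mu\in\mathcal P^x}\mathbb E^{\mu}\Big[v(X_\tau)\mathbf 1_{\{\tau<\infty\}}+G\,\mathbf 1_{\{\tau=\infty\}}\Big]\quad\text{for all }x\in E\text{ and }\tau\in\mathcal T.$$ \end{enumerate}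
   Context: Paths. $E$ is a Polish space, and an isolated point $\iota$ is always assumed to be adjoined to $E$. $D_E$ is the set of right-continuous paths with left limits (RCLL) from $[0,\infty)$ to $E$, with the Skorokhod topology (a Polish space); its Borel $\sigma$-algebra $\mathcal B(D_E)$ is generated by the coordinate maps $X_t(\omega)=\omega(t)$. $\mathfrak P$ is the set of Borel probability measures on $D_E$ with the topology of weak convergence (Polish). $\omega_\iota$ is the constant path with value $\iota$. A random time is a Borel map $\tau:D_E\to[0,\infty]$; $X_\tau(\omega)=X_{\tau(\omega)}(\omega)$ if $\tau(\omega)<\infty$ and $X_\tau(\omega)=\iota$ otherwise. Measurability. A subset of a Polish space is analytic if it is the projection of a Borel subset of the product of that space with $\mathbb R$. It is universally measurable if it belongs to the completion of the Borel $\sigma$-algebra under every Borel probability measure; a map is universally measurable if preimages of Borel sets are. The function $v$ is lower semi-analytic if $\{x\in E: v(x)<a\}$ is analytic for every $a\in\mathbb R$. Kernels and random variables. A (universally measurable) kernel is a map $\nu:E\times\mathcal B(D_E)\to[0,1]$ with $\nu_x:=\nu(x,\cdot)\in\mathfrak P$ for all $x\in E$ and $x\mapsto\nu(x,A)$ universally measurable for all $A\in\mathcal B(D_E)$; it is always assumed that $\nu_\iota$ is the Dirac mass at $\omega_\iota$. A random variable is a universally measurable map $G:D_E\to[-\infty,\infty]$, with the convention $G(\omega_\iota)=0$ unless otherwise specified. For a family $\mathcal P=(\mathcal P^x)_{x\in E}$ of subsets of $\mathfrak P$, $\mathcal L^{0-1}(\mathcal P)$ is the set of random variables $G$ with $\mathbb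 E^\mu[G^-]<\infty$ for all $\mu\in\bigcup_x\mathcal P^x$; for these, $\mathbb E^\mu[G]:=\mathbb E^\mu[G^+]-\mathbb E^\mu[G^-]\in(-\infty,\infty]$. Concatenation. For a random time $\tau$ and $\omega,\omega'\in D_E$, the path $\omega*_\tau\omega'\in D_E$ is given by $X_t(\omega*_\tau\omega')=X_t(\omega)$ for $t<\tau(\omega)$ and $X_t(\omega*_\tau\omega')=X_\tau(\omega)+X_{t-\tau(\omega)}(\omega')-X_0(\omega')$ for $t\ge\tau(\omega)$. For $\mu\in\mathfrak P$ and a kernel $\nu$, $\mu*_\tau\nu\in\mathfrak P$ is given by $(\mu*_\tau\nu)[A]=\iint\mathbf 1_A(\omega*_\tau\omega')\,\nu_{X_\tau(\omega)}(d\omega')\,\mu(d\omega)$, $A\in\mathcal B(D_E)$. Controlled Markov families. Let $\mathcal P=(\mathcal P^x)_{x\in E}$ be a family of nonempty subsets of $\mathfrak P$. A $\mathcal P$-selector is a kernel $\nu$ with $\nu_x\in\mathcal P^x$ for all $x\in E$; $\mathcal S(\mathcal P)$ is the set of all $\mathcal P$-selectors. A pair $(\mathcal P,\mathcal T)$, with $\mathcal T$ a set of random times, is a controlled Markov family if (i) the graph $\Gamma_{\mathcal P}=\{(x,\mu):\mu\in\mathcal P^x\}$ is an analytic subset of $E\times\mathfrak P$, and (ii) $\mu*_\tau\nu\in\mathcal P^x$ for all $x\in E$, $\mu\in\mathcal P^x$, $\tau\in\mathcal T$ and $\nu\in\mathcal S(\mathcal P)$. A Markov control problem is a triplet $(\mathcal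 P,\mathcal T,G)$ with $(\mathcal P,\mathcal T)$ a controlled Markov family and $G\in\mathcal L^{0-1}(\mathcal P)$ a random variable. For $\varepsilon>0$, $\mu\in\mathcal P^x$ is $\varepsilon$-optimal if $\mathbb E^\mu[G]<v(x)+\varepsilon$, with the convention $-\infty+\varepsilon=-1/\varepsilon$. Tail property and disintegrability. A Borel-measurable $G\in\mathcal L^{0-1}(\mathcal P)$ is a $(\mathcal P,\mathcal T)$-tail random variable if for all $(x,\mu)\in\Gamma_{\mathcal P}$, $\nu\in\mathcal S(\mathcal P)$, $\tau\in\mathcal T$: $\mathbb E^{\mu*_\tau\nu}[G]=\mathbb E^\mu[g(X_\tau)\mathbf 1_{\{\tau<\infty\}}+G\mathbf 1_{\{\tau=\infty\}}]$, where $g(x)=\mathbb E^{\nu_x}[G]$. $G$ is $(\mathcal P,\mathcal T)$-approximately disintegrable if it is a $(\mathcal P,\mathcal T)$-tail random variable and for all $(x,\mu)\in\Gamma_{\mathcal P}$, $\tau\in\mathcal T$, $\varepsilon>0$ there is $\nu\in\mathcal S(\mathcal P)$ with $\mathbb E^{\mu*_\tau\nu}[G]\le\mathbb E^\mu[G]+\varepsilon$.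
   Formalization: Where v(x)=∞ every μ in P^x counts as ε-optimal, since E^μ[G]<∞+ε can never hold (e.g. T empty, G=∞ except G(ω_ι)=0); at the adjoined point, P^ι is taken to be the singleton of the Dirac mass at ω_ι, matching the convention on ν_ι. *)

theory Defs
  imports "HOL-Probability.Probability"
begin

section \<open>Analytic and universally measurable sets\<close>

definition borel_sets :: "'a topology \<Rightarrow> 'a set set" where
  "borel_sets T = sigma_sets (topspace T) {U. openin T U}"

definition analytic_in :: "'a topology \<Rightarrow> 'a set \<Rightarrow> bool" where
  "analytic_in T A \<longleftrightarrow> (\<exists>B \<in> borel_sets (prod_topology T euclideanreal). A = fst ` B)"

definition universal_sets :: "'a measure \<Rightarrow> 'a set set" where
  "universal_sets M =
     {A. A \<subseteq> space M \<and> (\<forall>\<mu> \<in> space (prob_algebra M). A \<in> sets (completion \<mu>))}"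

definition universally_measurable :: "'a measure \<Rightarrow> ('a \<Rightarrow> 'b::topological_space) \<Rightarrow> bool" where
  "universally_measurable M f \<longleftrightarrow> (\<forall>B \<in> sets borel. f -` B \<inter> space M \<in> universal_sets M)"

definition lower_semianalytic :: "('e::polish_space \<Rightarrow> ereal) \<Rightarrow> bool" where
  "lower_semianalytic v \<longleftrightarrow> (\<forall>a::real. analytic_in euclidean {x. v x < ereal a})"


section \<open>RCLL paths\<close>

text \<open>The type \<open>'e\<close> is the state space with the isolated point \<open>\<iota>\<close> already adjoined.
  Paths are functions on \<open>[0,\<infinity>)\<close>, normalised to \<open>undefined\<close> at negative arguments.\<close>

type_synonym 'e path = "real \<Rightarrow> 'e"

definition paths :: "'e::polish_space path set" where
  "paths = {\<omega> \<in> extensional {0..}.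
     (\<forall>t\<ge>0. (\<omega> \<longlongrightarrow> \<omega> t) (at_right t)) \<and>
     (\<forall>t>0. \<exists>l. (\<omega> \<longlongrightarrow> l) (at_left t))}"

definition const_path :: "'e \<Rightarrow> 'e path" where
  "const_path x = (\<lambda>t\<in>{0..}. x)"

text \<open>The \<open>\<sigma>\<close>-algebra generated by the coordinate maps, which is the Borel \<open>\<sigma>\<close>-algebra of the
  Skorokhod topology.\<close>

definition path_space :: "'e::polish_space path measure" where
  "path_space = restrict_space (\<Pi>\<^sub>M t\<in>{0..}. borel) paths"

text \<open>Skorokhod's \<open>J\<^sub>1\<close> topology. A sequence \<open>y\<^sub>n\<close> converges to \<open>x\<close> iff it is eventually in
  \<open>skorokhod_nbhd x T e\<close> for all \<open>T, e > 0\<close> (Ethier and Kurtz, Markov Processes, Proposition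
  3.5.3 (c)). As the Skorokhod topology is metrizable, its open sets are therefore those that
  contain such a set around each of their points. The sets themselves need not be open.\<close>

definition time_changes :: "(real \<Rightarrow> real) set" where
  "time_changes = {l. strict_mono_on {0..} l \<and> l ` {0..} = {0..}}"

definition skorokhod_nbhd :: "'e::polish_space path \<Rightarrow> real \<Rightarrow> real \<Rightarrow> 'e path set" where
  "skorokhod_nbhd x T e = {y \<in> paths. \<exists>l \<in> time_changes. \<forall>t\<in>{0..T}.
      \<bar>l t - t\<bar> < e \<and> dist (y t) (x (l t)) < e}"

definition skorokhod_open :: "'e::polish_space path set \<Rightarrow> bool" where
  "skorokhod_open U \<longleftrightarrow>
     U \<subseteq> paths \<and> (\<forall>x\<in>U. \<exists>T>0. \<exists>e>0. skorokhod_nbhd x T e \<subseteq> U)"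

definition skorokhod_topology :: "'e::polish_space path topology" where
  "skorokhod_topology = topology skorokhod_open"

lemma skorokhod_nbhd_mono:
  "T \<le> T' \<Longrightarrow> e' \<le> e \<Longrightarrow> skorokhod_nbhd x T' e' \<subseteq> skorokhod_nbhd x T e"
  unfolding skorokhod_nbhd_def by (auto; meson atLeastAtMost_iff order.trans order.strict_trans2)

lemma istopology_skorokhod_open: "istopology skorokhod_open"
  unfolding istopology_def
proof (intro conjI allI impI)
  fix S U :: "'e::polish_space path set"
  assume S: "skorokhod_open S" and U: "skorokhod_open U"
  show "skorokhod_open (S \<inter> U)"
    unfolding skorokhod_open_def
  proof (intro conjI ballI)
    show "S \<inter> U \<subseteq> paths" using S by (auto simp: skorokhod_open_def)
    fix x assume x: "x \<in> S \<inter> U"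
    obtain T1 e1 where 1: "T1 > 0" "e1 > 0" "skorokhod_nbhd x T1 e1 \<subseteq> S"
      using S x unfolding skorokhod_open_def by blast
    obtain T2 e2 where 2: "T2 > 0" "e2 > 0" "skorokhod_nbhd x T2 e2 \<subseteq> U"
      using U x unfolding skorokhod_open_def by blast
    have "skorokhod_nbhd x (max T1 T2) (min e1 e2) \<subseteq> S \<inter> U"
      using skorokhod_nbhd_mono[of T1 "max T1 T2" "min e1 e2" e1 x]
        skorokhod_nbhd_mono[of T2 "max T1 T2" "min e1 e2" e2 x] 1 2 by auto
    then show "\<exists>T>0. \<exists>e>0. skorokhod_nbhd x T e \<subseteq> S \<inter> U"
      using 1 2 by (intro exI[of _ "max T1 T2"] exI[of _ "min e1 e2"] conjI) auto
  qed
next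
  fix K :: "'e::polish_space path set set"
  assume K: "\<forall>S\<in>K. skorokhod_open S"
  show "skorokhod_open (\<Union>K)"
    unfolding skorokhod_open_def
  proof (intro conjI ballI)
    show "\<Union>K \<subseteq> paths" using K by (auto simp: skorokhod_open_def)
    fix x assume "x \<in> \<Union>K"
    then obtain S where S: "S \<in> K" "x \<in> S" by blast
    then obtain T e where "T > 0" "e > 0" "skorokhod_nbhd x T e \<subseteq> S"
      using K unfolding skorokhod_open_def by meson
    then show "\<exists>T>0. \<exists>e>0. skorokhod_nbhd x T e \<subseteq> \<Union>K"
      using S by (intro exI[of _ T] exI[of _ e] conjI) auto
  qed
qed

lemma openin_skorokhod: "openin skorokhod_topology U \<longleftrightarrow> skorokhod_open U"
  by (simp add: skorokhod_topology_def topology_inverse'[OF istopology_skorokhod_open])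

lemma topspace_skorokhod: "topspace skorokhod_topology = (paths :: 'e::polish_space path set)"
proof -
  have "skorokhod_open (paths :: 'e path set)"
    by (auto simp: skorokhod_open_def skorokhod_nbhd_def intro!: exI[of _ "1::real"])
  then show ?thesis
    unfolding topspace_def openin_skorokhod by (auto simp: skorokhod_open_def[of "_ :: 'e path set"]
        intro!: exI[of _ paths])
qed

lemma space_path_space: "space path_space = paths"
  by (auto simp: path_space_def space_restrict_space space_PiM PiE_def paths_def)


section \<open>Probability measures on the path space\<close>

abbreviation path_laws :: "'e::polish_space path measure set" where
  "path_laws \<equiv> space (prob_algebra path_space)"

definition weak_topology :: "'e::polish_space path measure topology" where
  "weak_topology = topology_generated_by
     {{\<mu> \<in> path_laws. (\<integral>\<omega>. f \<omega> \<partial>\<mu>) \<in> U} | f U.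
        continuous_map skorokhod_topology euclideanreal f \<and> bounded (f ` paths) \<and> open U}"

lemma topspace_weak_topology:
  "topspace weak_topology = (path_laws :: 'e::polish_space path measure set)"
proof -
  have "\<exists>f U. (path_laws :: 'e path measure set) = {\<mu> \<in> path_laws. (\<integral>\<omega>. f \<omega> \<partial>\<mu>) \<in> U} \<and>
      continuous_map skorokhod_topology euclideanreal f \<and>
      bounded (f ` (paths :: 'e path set)) \<and> open U"
    by (rule exI[of _ "\<lambda>_. 0"], rule exI[of _ UNIV]) (auto intro!: finite_imp_bounded
        finite_subset[of _ "{0::real}"])
  then show ?thesis
    unfolding weak_topology_def topology_generated_by_topspace by blast
qed

text \<open>Expectation of a random variable that is measurable for the completion of \<open>\<mu>\<close>, with the
  convention that it is \<open>\<infinity>\<close> as soon as the positive part has infinite expectation.\<close>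

definition expect :: "'a measure \<Rightarrow> ('a \<Rightarrow> ereal) \<Rightarrow> ereal" where
  "expect \<mu> Y =
     (let p = (\<integral>\<^sup>+\<omega>. e2ennreal (max 0 (Y \<omega>)) \<partial>completion \<mu>);
          n = (\<integral>\<^sup>+\<omega>. e2ennreal (max 0 (- Y \<omega>)) \<partial>completion \<mu>)
      in if p = \<infinity> then \<infinity> else enn2ereal p - enn2ereal n)"


section \<open>Random times, concatenation and kernels\<close>

definition random_time :: "('e::polish_space path \<Rightarrow> ennreal) \<Rightarrow> bool" where
  "random_time \<tau> \<longleftrightarrow> \<tau> \<in> borel_measurable path_space"

definition state_at :: "'e \<Rightarrow> ('e path \<Rightarrow> ennreal) \<Rightarrow> 'e path \<Rightarrow> 'e" where
  "state_at \<iota> \<tau> \<omega> = (if \<tau> \<omega> < \<infinity> then \<omega> (enn2real (\<tau> \<omega>)) else \<iota>)"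

text \<open>Only the operations \<open>+\<close> and \<open>-\<close> on the state space enter here. No algebraic law is imposed
  on them; their continuity is what makes the concatenation of two paths a path.\<close>

definition concat_path ::
  "'e::{polish_space,plus,minus} \<Rightarrow> ('e path \<Rightarrow> ennreal) \<Rightarrow> 'e path \<Rightarrow> 'e path \<Rightarrow> 'e path" where
  "concat_path \<iota> \<tau> \<omega> \<omega>' = (\<lambda>t\<in>{0..}.
     if ennreal t < \<tau> \<omega> then \<omega> t
     else state_at \<iota> \<tau> \<omega> + \<omega>' (t - enn2real (\<tau> \<omega>)) - \<omega>' 0)"

lemma const_path_in_paths: "const_path x \<in> paths"
proof -
  have "(const_path x \<longlongrightarrow> x) (at_right t)" if "t \<ge> 0" for t
    by (rule tendsto_eventually)
      (use that in \<open>auto simp: const_path_def eventually_at_filter\<close>)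
  moreover have "(const_path x \<longlongrightarrow> x) (at_left t)" if "t > 0" for t
    by (rule tendsto_eventually, rule eventually_mono[OF eventually_at_left_real[OF that]])
      (auto simp: const_path_def)
  ultimately show ?thesis
    unfolding paths_def by (auto simp: const_path_def)
qed

lemma concat_path_in_paths:
  fixes \<iota> :: "'e::{polish_space,plus,minus}"
  assumes plus: "continuous_on UNIV (\<lambda>(x::'e, y). x + y)"
    and minus: "continuous_on UNIV (\<lambda>(x::'e, y). x - y)"
    and \<omega>: "\<omega> \<in> paths" and \<omega>': "\<omega>' \<in> paths"
  shows "concat_path \<iota> \<tau> \<omega> \<omega>' \<in> paths"
proof -
  define c where "c = state_at \<iota> \<tau> \<omega>"
  define s where "s = enn2real (\<tau> \<omega>)"
  define h where "h = concat_path \<iota> \<tau> \<omega> \<omega>'"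
  have s0: "s \<ge> 0" by (simp add: s_def)
  have lim: "((\<lambda>u. c + f u - \<omega>' 0) \<longlongrightarrow> c + l - \<omega>' 0) F" if "(f \<longlongrightarrow> l) F" for f l and F :: "real filter"
  proof -
    have "((\<lambda>u. c + f u) \<longlongrightarrow> c + l) F"
      using continuous_on_tendsto_compose[OF plus tendsto_Pair[OF tendsto_const that]] by simp
    from continuous_on_tendsto_compose[OF minus tendsto_Pair[OF this tendsto_const]]
    show ?thesis by simp
  qed
  have ext: "h \<in> extensional {0..}" by (simp add: h_def concat_path_def)
  show ?thesis
  proof (cases "\<tau> \<omega> = \<infinity>")
    case True
    then have "h = \<omega>"
      using \<omega> by (auto simp: h_def concat_path_def paths_def extensional_def fun_eq_iff
          ennreal_less_top)
    then show ?thesis using \<omega> h_def by simp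
  next
    case False
    have lt: "ennreal t < \<tau> \<omega> \<longleftrightarrow> t < s" if "t \<ge> 0" for t
      using that False unfolding s_def
      by (cases "\<tau> \<omega>") (auto simp: ennreal_less_iff)
    have h1: "h t = \<omega> t" if "0 \<le> t" "t < s" for t
      using that lt[of t] by (simp add: h_def concat_path_def)
    have h2: "h t = c + \<omega>' (t - s) - \<omega>' 0" if "s \<le> t" for t
      using that lt[of t] order.trans[OF s0 that] by (simp add: h_def concat_path_def c_def s_def)
    have "(h \<longlongrightarrow> h t) (at_right t)" if t: "t \<ge> 0" for t
    proof (cases "t < s")
      case True
      have "\<forall>\<^sub>F u in at_right t. h u = \<omega> u"
        by (rule eventually_mono[OF eventually_at_right_real[OF True]]) (use t h1 in auto)
      moreover have "(\<omega> \<longlongrightarrow> h t) (at_right t)"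
        using \<omega> t True h1 by (simp add: paths_def)
      ultimately show ?thesis by (simp add: tendsto_cong)
    next
      case False
      have "\<forall>\<^sub>F u in at_right t. h u = c + \<omega>' (u - s) - \<omega>' 0"
        by (rule eventually_mono[OF eventually_at_right_real[of t "t + 1"]]) (use False h2 in auto)
      moreover have "((\<lambda>u. \<omega>' (u - s)) \<longlongrightarrow> \<omega>' (t - s)) (at_right t)"
      proof -
        have "(\<omega>' \<longlongrightarrow> \<omega>' (t - s)) (at_right (t - s))"
          using \<omega>' False by (simp add: paths_def)
        then show ?thesis
          by (rule filterlim_compose)
            (auto simp: filterlim_at eventually_at_filter intro!: tendsto_eq_intros)
      qed
      from lim[OF this] have "((\<lambda>u. c + \<omega>' (u - s) - \<omega>' 0) \<longlongrightarrow> h t) (at_right t)"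
        using h2[of t] False by simp
      ultimately show ?thesis by (simp add: tendsto_cong)
    qed
    moreover have "\<exists>l. (h \<longlongrightarrow> l) (at_left t)" if t: "t > 0" for t
    proof (cases "t \<le> s")
      case True
      have "\<forall>\<^sub>F u in at_left t. h u = \<omega> u"
        by (rule eventually_mono[OF eventually_at_left_real[OF t]]) (use True h1 in auto)
      moreover obtain l where "(\<omega> \<longlongrightarrow> l) (at_left t)"
        using \<omega> t by (auto simp: paths_def)
      ultimately show ?thesis by (auto simp: tendsto_cong)
    next
      case False
      have "\<forall>\<^sub>F u in at_left t. h u = c + \<omega>' (u - s) - \<omega>' 0"
        by (rule eventually_mono[OF eventually_at_left_real[of s t]]) (use False h2 in auto)
      moreover have "t - s > 0" using False by simp
      then obtain l where l: "(\<omega>' \<longlongrightarrow> l) (at_left (t - s))"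
        using \<omega>' unfolding paths_def by blast
      have "((\<lambda>u. \<omega>' (u - s)) \<longlongrightarrow> l) (at_left t)"
        by (rule filterlim_compose[OF l])
          (auto simp: filterlim_at eventually_at_filter intro!: tendsto_eq_intros)
      from lim[OF this] have "((\<lambda>u. c + \<omega>' (u - s) - \<omega>' 0) \<longlongrightarrow> c + l - \<omega>' 0) (at_left t)" .
      ultimately show ?thesis by (auto simp: tendsto_cong)
    qed
    ultimately show ?thesis
      using ext unfolding h_def[symmetric] paths_def by auto
  qed
qed

definition kernel :: "'e::polish_space \<Rightarrow> ('e \<Rightarrow> 'e path measure) \<Rightarrow> bool" where
  "kernel \<iota> \<nu> \<longleftrightarrow>
     (\<forall>x. \<nu> x \<in> path_laws) \<and>
     (\<forall>A \<in> sets path_space. universally_measurable borel (\<lambda>x. measure (\<nu> x) A)) \<and>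
     \<nu> \<iota> = return path_space (const_path \<iota>)"

definition concat_law ::
  "'e::{polish_space,plus,minus} \<Rightarrow> ('e path \<Rightarrow> ennreal) \<Rightarrow> 'e path measure
     \<Rightarrow> ('e \<Rightarrow> 'e path measure) \<Rightarrow> 'e path measure" where
  "concat_law \<iota> \<tau> \<mu> \<nu> = measure_of (space path_space) (sets path_space)
     (\<lambda>A. \<integral>\<^sup>+\<omega>. (\<integral>\<^sup>+\<omega>'. indicator A (concat_path \<iota> \<tau> \<omega> \<omega>') \<partial>\<nu> (state_at \<iota> \<tau> \<omega>)) \<partial>completion \<mu>)"


section \<open>Controlled Markov families\<close>

definition random_variable :: "'e::polish_space \<Rightarrow> ('e path \<Rightarrow> ereal) \<Rightarrow> bool" where
  "random_variable \<iota> G \<longleftrightarrow> universally_measurable path_space G \<and> G (const_path \<iota>) = 0"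

definition L01 :: "'e::polish_space \<Rightarrow> ('e \<Rightarrow> 'e path measure set) \<Rightarrow> ('e path \<Rightarrow> ereal) set" where
  "L01 \<iota> P = {G. random_variable \<iota> G \<and>
     (\<forall>\<mu> \<in> (\<Union>x. P x). (\<integral>\<^sup>+\<omega>. e2ennreal (max 0 (- G \<omega>)) \<partial>completion \<mu>) < \<infinity>)}"

definition selectors ::
  "'e::polish_space \<Rightarrow> ('e \<Rightarrow> 'e path measure set) \<Rightarrow> ('e \<Rightarrow> 'e path measure) set" where
  "selectors \<iota> P = {\<nu>. kernel \<iota> \<nu> \<and> (\<forall>x. \<nu> x \<in> P x)}"

definition graph :: "('e \<Rightarrow> 'e path measure set) \<Rightarrow> ('e \<times> 'e path measure) set" where
  "graph P = {(x, \<mu>). \<mu> \<in> P x}"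

definition controlled_markov_family ::
  "'e::{polish_space,plus,minus} \<Rightarrow> ('e \<Rightarrow> 'e path measure set)
     \<Rightarrow> ('e path \<Rightarrow> ennreal) set \<Rightarrow> bool" where
  "controlled_markov_family \<iota> P \<T> \<longleftrightarrow>
     (\<forall>x. P x \<noteq> {} \<and> P x \<subseteq> path_laws) \<and>
     (\<forall>\<tau>\<in>\<T>. random_time \<tau>) \<and>
     analytic_in (prod_topology euclidean weak_topology) (graph P) \<and>
     (\<forall>x. \<forall>\<mu>\<in>P x. \<forall>\<tau>\<in>\<T>. \<forall>\<nu>\<in>selectors \<iota> P. concat_law \<iota> \<tau> \<mu> \<nu> \<in> P x)"

definition markov_control_problem ::
  "'e::{polish_space,plus,minus} \<Rightarrow> ('e \<Rightarrow> 'e path measure set)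
     \<Rightarrow> ('e path \<Rightarrow> ennreal) set \<Rightarrow> ('e path \<Rightarrow> ereal) \<Rightarrow> bool" where
  "markov_control_problem \<iota> P \<T> G \<longleftrightarrow> controlled_markov_family \<iota> P \<T> \<and> G \<in> L01 \<iota> P"

definition val_fun ::
  "('e \<Rightarrow> 'e path measure set) \<Rightarrow> ('e path \<Rightarrow> ereal) \<Rightarrow> 'e \<Rightarrow> ereal" where
  "val_fun P G x = (INF \<mu> \<in> P x. expect \<mu> G)"

text \<open>The convention \<open>-\<infinity> + \<epsilon> = -1/\<epsilon>\<close> is used. If the value at \<open>x\<close> is \<open>\<infinity>\<close>, then every element of
  \<open>P x\<close> attains the infimum and is regarded as \<open>\<epsilon>\<close>-optimal, although the strict inequality
  \<open>\<infinity> < \<infinity> + \<epsilon>\<close> fails.\<close>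

definition eps_optimal ::
  "('e \<Rightarrow> 'e path measure set) \<Rightarrow> ('e path \<Rightarrow> ereal) \<Rightarrow> real \<Rightarrow> 'e \<Rightarrow> 'e path measure \<Rightarrow> bool" where
  "eps_optimal P G \<epsilon> x \<mu> \<longleftrightarrow> \<mu> \<in> P x \<and>
     (val_fun P G x = \<infinity> \<or>
      expect \<mu> G < (if val_fun P G x = -\<infinity> then ereal (- 1 / \<epsilon>) else val_fun P G x + ereal \<epsilon>))"

definition tail_random_variable ::
  "'e::{polish_space,plus,minus} \<Rightarrow> ('e \<Rightarrow> 'e path measure set)
     \<Rightarrow> ('e path \<Rightarrow> ennreal) set \<Rightarrow> ('e path \<Rightarrow> ereal) \<Rightarrow> bool" where
  "tail_random_variable \<iota> P \<T> G \<longleftrightarrow>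
     G \<in> borel_measurable path_space \<and> G \<in> L01 \<iota> P \<and>
     (\<forall>(x, \<mu>) \<in> graph P. \<forall>\<nu>\<in>selectors \<iota> P. \<forall>\<tau>\<in>\<T>.
        expect (concat_law \<iota> \<tau> \<mu> \<nu>) G =
        expect \<mu> (\<lambda>\<omega>. if \<tau> \<omega> < \<infinity> then expect (\<nu> (state_at \<iota> \<tau> \<omega>)) G else G \<omega>))"

definition approximately_disintegrable ::
  "'e::{polish_space,plus,minus} \<Rightarrow> ('e \<Rightarrow> 'e path measure set)
     \<Rightarrow> ('e path \<Rightarrow> ennreal) set \<Rightarrow> ('e path \<Rightarrow> ereal) \<Rightarrow> bool" where
  "approximately_disintegrable \<iota> P \<T> G \<longleftrightarrow>
     tail_random_variable \<iota> P \<T> G \<and>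
     (\<forall>(x, \<mu>) \<in> graph P. \<forall>\<tau>\<in>\<T>. \<forall>\<epsilon>>0. \<exists>\<nu>\<in>selectors \<iota> P.
        expect (concat_law \<iota> \<tau> \<mu> \<nu>) G \<le> expect \<mu> G + ereal \<epsilon>)"

end

theory Submission
  imports Defs
begin

text \<open>Everything rests on measurable selection. The set of pairs \<open>(x, \<mu>)\<close> with \<open>\<mu> \<in> P x\<close> and
\<open>expect \<mu> G < a\<close> is a projection of a measurable set, so its projection \<open>{x. v x < a}\<close> is analytic,
and the set admits a universally measurable selector \<open>s\<^sub>a\<close> (lemmas \<open>jankov_von_neumann\<close> and
\<open>analytic_law_selection\<close>). For the \<open>\<epsilon>\<close>-optimal selector, countably many rational levels \<open>a\<close> suffice:
at \<open>x\<close> use \<open>s\<^sub>a\<close> for the first level \<open>a\<close> above \<open>v x\<close> that is at most \<open>v x + \<epsilon>\<close>, or at most \<open>-1/\<epsilon>\<close> in case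
\<open>v x = -\<infinity>\<close>.

For the dynamic programming principle, let \<open>\<mu> \<in> P x\<close>. Approximate disintegrability provides a
selector \<open>\<nu>\<close> for which the concatenation of \<open>\<mu>\<close> and \<open>\<nu>\<close> costs at most \<open>expect \<mu> G + \<epsilon>\<close>; by the tail
property this cost is the expectation of a random variable that dominates the one built from \<open>v\<close>.
Conversely, concatenate \<open>\<mu>\<close> with \<open>\<epsilon>\<close>-optimal selectors. The results are again in \<open>P x\<close>, so they cost
at least \<open>v x\<close>, and the tail property expresses their costs by values that exceed \<open>v\<close> by at most
\<open>\<epsilon>\<close>, or are at most \<open>-1/\<epsilon>\<close> where \<open>v\<close> is \<open>-\<infinity>\<close>. As \<open>\<epsilon>\<close> tends to \<open>0\<close>, monotone convergence of the negative parts gives the inequality, also when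
\<open>-\<infinity>\<close> is attained (lemma \<open>le_expect_of_relaxed\<close>).

The selection theorem is proved for an arbitrary measurable space \<open>M\<close> in place of \<open>E\<close>. A measurable
subset of the product of \<open>M\<close> and Baire space is the image of the set of infinite branches of a
measurable family of trees; the leftmost branch is a selector, and it is universally measurable since
the projection of such a family is (a theorem of Lusin and Souslin, proved by approximation with
finitely branching subtrees).

Two facts make this applicable to the laws on the path space. First, the weakly open sets have a
countable network of measurable sets, so that the Borel sets of the product topology belong to the
product \<open>\<sigma>\<close>-algebra (lemma \<open>borel_law_product_measurable\<close>). Second, Baire space parametrizes the laws
measurably (lemma \<open>law_real_parametrization\<close>): the path space is a measurable retract of the real
line, and a law on the real line is the law of its quantile function under the uniform distribution.
Both facts come from one description of RCLL paths. On the cells of a sufficiently fine grid, such a path is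
constant up to an error \<open>1/n\<close>, except for at most one jump in each cell. The paths with a given pattern of this
kind form a measurable set, because rational times decide the pattern; two paths with the same
pattern are close in the Skorokhod topology, because a time change moves the jumps of one to those of the
other; and a function on the rationals with such patterns for all \<open>n\<close> has one-sided limits
everywhere.\<close>

section \<open>Souslin sets are universally measurable\<close>

text \<open>A measurable hull \<open>B\<close> of \<open>S\<close> has the same outer measure as \<open>S\<close>. Countably many inner
approximations exhaust this measure, so \<open>S\<close> differs from their union by a subset of a null set.\<close>

lemma inner_approx_imp_completion:
  assumes M: "finite_measure M" and S: "S \<subseteq> space M"
    and inner: "\<And>a. a < outer_measure_of M S \<Longrightarrow> \<exists>K\<in>sets M. K \<subseteq> S \<and> a \<le> emeasure M K"
  shows "S \<in> sets (completion M)"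
proof -
  interpret finite_measure M by fact
  obtain B where B: "B \<in> sets M" "S \<subseteq> B" "outer_measure_of M S = emeasure M B"
    using outer_measure_of_attain[OF S] by blast
  show ?thesis
  proof (cases "emeasure M B = 0")
    case True
    then show ?thesis
      using B by (intro sets_completionI_sub[of B]) auto
  next
    case False
    obtain a :: "nat \<Rightarrow> ennreal" where a: "\<And>n. a n < emeasure M B" "a \<longlonglongrightarrow> emeasure M B"
      using approx_from_below_dense_linorder[of 0 "emeasure M B"] False by (auto simp: zero_less_iff_neq_zero)
    have "\<forall>n. \<exists>K\<in>sets M. K \<subseteq> S \<and> a n \<le> emeasure M K"
      using inner a(1) B(3) by auto
    then obtain K where K: "\<And>n. K n \<in> sets M" "\<And>n. K n \<subseteq> S" "\<And>n. a n \<le> emeasure M (K n)"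
      by metis
    define L where "L = (\<Union>n. K n)"
    have L: "L \<in> sets M" "L \<subseteq> S" using K by (auto simp: L_def)
    have "a n \<le> emeasure M L" for n
    proof -
      have "emeasure M (K n) \<le> emeasure M L"
        using L(1) by (intro emeasure_mono) (auto simp: L_def)
      then show ?thesis using K(3)[of n] by (rule order_trans[rotated])
    qed
    then have "emeasure M B \<le> emeasure M L"
      using a(2) by (intro LIMSEQ_le_const2) auto
    moreover have "emeasure M L \<le> emeasure M B"
      using L B by (intro emeasure_mono) auto
    ultimately have "emeasure M (B - L) = 0"
      using L B by (subst emeasure_Diff) (auto simp: order_antisym)
    then have N: "B - L \<in> null_sets M" using B L by auto
    show ?thesis
      by (rule sets_completionI[of S L "S - L" "B - L"]) (use L B N in auto)
  qed
qed

text \<open>A measurable family of clopen subsets of Baire space, indexed by the points \<open>x\<close>: whether \<open>w\<close>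
belongs to the set at \<open>x\<close> is decided by finitely many coordinates of \<open>w\<close>, their number not depending on \<open>x\<close>.\<close>

definition finite_level :: "'a measure \<Rightarrow> ('a \<Rightarrow> (nat \<Rightarrow> nat) \<Rightarrow> bool) \<Rightarrow> bool" where
  "finite_level M F \<longleftrightarrow>
     (\<exists>n. \<forall>w w'. (\<forall>k<n. w k = w' k) \<longrightarrow> (\<forall>x. F x w = F x w')) \<and>
     (\<forall>w. {x \<in> space M. F x w} \<in> sets M)"

text \<open>The infinite branches of a measurable family of trees. The projections \<open>{x. \<exists>w. F x w}\<close> are
the sets that the Souslin operation produces from \<open>M\<close>.\<close>

definition tree_closed :: "'a measure \<Rightarrow> ('a \<Rightarrow> (nat \<Rightarrow> nat) \<Rightarrow> bool) \<Rightarrow> bool" where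
  "tree_closed M F \<longleftrightarrow>
     (\<exists>H. (\<forall>i::nat. finite_level M (H i)) \<and> (\<forall>x w. F x w \<longleftrightarrow> (\<forall>i. H i x w)))"

lemma stabilizes:
  assumes step: "\<And>n. u (Suc n) = (u n)(n := c n)"
  shows "j < m \<Longrightarrow> u m j = u (Suc j) j"
proof (induction m)
  case (Suc m)
  then show ?case by (cases "j = m") (auto simp: step[of m])
qed simp

text \<open>Koenig's lemma for a finitely branching tree. A finite sequence is kept as long as it extends to
solutions of all finite subsystems; among the finitely many candidates for the next entry one must
again have this property.\<close>

lemma koenig_bounded:
  fixes k :: "nat \<Rightarrow> nat" and P :: "nat \<Rightarrow> (nat \<Rightarrow> nat) \<Rightarrow> bool"
  assumes lev: "\<And>i. \<exists>n. \<forall>w w'. (\<forall>j<n. w j = w' j) \<longrightarrow> P i w = P i w'"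
    and fin: "\<And>N. \<exists>w. (\<forall>j. w j \<le> k j) \<and> (\<forall>i\<le>N. P i w)"
  shows "\<exists>w. \<forall>i. P i w"
proof -
  define Q where "Q n u \<longleftrightarrow> (\<forall>N. \<exists>w. (\<forall>j. w j \<le> k j) \<and> (\<forall>j<n. w j = u j) \<and> (\<forall>i\<le>N. P i w))"
    for n and u :: "nat \<Rightarrow> nat"
  have step: "\<exists>c. Q (Suc n) (u(n := c))" if Qn: "Q n u" for n u
  proof (rule ccontr)
    assume "\<nexists>c. Q (Suc n) (u(n := c))"
    then have "\<forall>c. \<exists>N. \<not> (\<exists>w. (\<forall>j. w j \<le> k j) \<and> (\<forall>j<Suc n. w j = (u(n := c)) j) \<and> (\<forall>i\<le>N. P i w))"
      unfolding Q_def by (simp only: not_ex not_all simp_thms)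
    from choice[OF this] obtain N where
      N: "\<forall>c. \<not> (\<exists>w. (\<forall>j. w j \<le> k j) \<and> (\<forall>j<Suc n. w j = (u(n := c)) j) \<and> (\<forall>i\<le>N c. P i w))"
      ..
    define N' where "N' = Max (N ` {..k n})"
    obtain w where w: "\<forall>j. w j \<le> k j" "\<forall>j<n. w j = u j" "\<forall>i\<le>N'. P i w"
      using Qn[unfolded Q_def, THEN spec, of N'] by metis
    have le: "N (w n) \<le> N'" unfolding N'_def using w(1) by (intro Max_ge) auto
    have "\<forall>j<Suc n. w j = (u(n := w n)) j" using w(2) by (simp add: less_Suc_eq)
    moreover have "\<forall>i\<le>N (w n). P i w"
    proof (intro allI impI)
      fix i assume "i \<le> N (w n)"
      then have "i \<le> N'" using le by (rule order_trans)
      then show "P i w" by (rule w(3)[rule_format])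
    qed
    ultimately show False using N[THEN spec, of "w n"] w(1) by metis
  qed
  define u where "u = rec_nat (\<lambda>_. 0) (\<lambda>n u. u(n := (SOME c. Q (Suc n) (u(n := c)))))"
  have u_Suc: "u (Suc n) = (u n)(n := (SOME c. Q (Suc n) ((u n)(n := c))))" for n
    by (simp add: u_def)
  have Qu: "Q n (u n)" for n
  proof (induction n)
    case 0
    then show ?case using fin by (simp add: Q_def)
  next
    case (Suc n)
    show ?case unfolding u_Suc by (rule someI_ex[OF step[OF Suc]])
  qed
  note stable = stabilizes[of u, OF u_Suc]
  define w where "w j = u (Suc j) j" for j
  have "P i w" for i
  proof -
    obtain n where n: "\<And>w w'. (\<forall>j<n. w j = w' j) \<Longrightarrow> P i w = P i w'"
      using lev[of i] by blast
    obtain w' where w': "\<forall>j<n. w' j = u n j" "P i w'"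
      using Qu[of n, unfolded Q_def, THEN spec, of i] by (metis order_refl)
    have "\<forall>j<n. w' j = w j" using w'(1) stable[of _ n] by (simp add: w_def)
    with n w'(2) show ?thesis by blast
  qed
  then show ?thesis by blast
qed

text \<open>Let \<open>a\<close> be less than the outer measure of the projection. Outer measure is continuous along increasing
sequences of arbitrary sets, so bounds \<open>k 0, k 1, \<dots>\<close> on the entries of the branches can be chosen one
after the other while the outer measure of what remains stays above \<open>a\<close>. With all entries bounded
the tree is finitely branching, and by Koenig's lemma the projection contains a countable
intersection of measurable sets of measure at least \<open>a\<close>.\<close>

lemma tree_projection_completion:
  assumes M: "finite_measure M" and F: "tree_closed M F"
  shows "{x \<in> space M. \<exists>w. F x w} \<in> sets (completion M)"
proof (rule inner_approx_imp_completion[OF M])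
  interpret finite_measure M by fact
  obtain H where H: "\<And>i. finite_level M (H i)" and FH: "\<And>x w. F x w \<longleftrightarrow> (\<forall>i::nat. H i x w)"
    using F unfolding tree_closed_def by blast
  obtain lev where lev: "\<And>i w w' x. (\<forall>j<lev i. w j = w' j) \<Longrightarrow> H i x w = H i x w'"
    using H unfolding finite_level_def by metis
  have meas: "{x \<in> space M. H i x w} \<in> sets M" for i w
    using H unfolding finite_level_def by blast
  define S where "S n k = {x \<in> space M. \<exists>w. (\<forall>j<n. w j \<le> k j) \<and> F x w}" for n and k :: "nat \<Rightarrow> nat"
  show "{x \<in> space M. \<exists>w. F x w} \<subseteq> space M" by auto
  fix a assume a: "a < outer_measure_of M {x \<in> space M. \<exists>w. F x w}"
  have step: "\<exists>c. a < outer_measure_of M (S (Suc n) (k(n := c)))" if "a < outer_measure_of M (S n k)" for n k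
  proof -
    have "(SUP c. outer_measure_of M (S (Suc n) (k(n := c)))) = outer_measure_of M (\<Union>c. S (Suc n) (k(n := c)))"
    proof (rule SUP_outer_measure_of_incseq)
      show "S (Suc n) (k(n := c)) \<subseteq> space M" for c by (auto simp: S_def)
      show "incseq (\<lambda>c. S (Suc n) (k(n := c)))"
      proof (rule monoI, rule subsetI)
        fix c d x assume "c \<le> (d::nat)" "x \<in> S (Suc n) (k(n := c))"
        then obtain w where "x \<in> space M" "\<forall>j<Suc n. w j \<le> (k(n := c)) j" "F x w" by (auto simp: S_def)
        moreover from this(2) \<open>c \<le> d\<close> have "\<forall>j<Suc n. w j \<le> (k(n := d)) j"
          by (metis fun_upd_apply order_trans)
        ultimately show "x \<in> S (Suc n) (k(n := d))" unfolding S_def by blast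
      qed
    qed
    also have "(\<Union>c. S (Suc n) (k(n := c))) = S n k"
    proof safe
      fix x assume "x \<in> S n k"
      then obtain w where "x \<in> space M" "\<forall>j<n. w j \<le> k j" "F x w" by (auto simp: S_def)
      then show "x \<in> (\<Union>c. S (Suc n) (k(n := c)))"
        by (auto simp: S_def less_Suc_eq intro!: exI[of _ "w n"] exI[of _ w])
    next
      fix x c assume "x \<in> S (Suc n) (k(n := c))"
      then obtain w where "x \<in> space M" "\<forall>j<Suc n. w j \<le> (k(n := c)) j" "F x w" by (auto simp: S_def)
      moreover from this(2) have "\<forall>j<n. w j \<le> k j" by (metis fun_upd_other less_Suc_eq nat_neq_iff)
      ultimately show "x \<in> S n k" unfolding S_def by blast
    qed
    finally show ?thesis using that by (metis (no_types, lifting) less_SUP_iff)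
  qed
  \<comment> \<open>The bounds chosen so far; entries from \<open>n\<close> on are irrelevant at stage \<open>n\<close>.\<close>
  define kk where "kk = rec_nat (\<lambda>_. 0) (\<lambda>n u. u(n := (SOME c. a < outer_measure_of M (S (Suc n) (u(n := c))))))"
  have kk_Suc: "kk (Suc n) = (kk n)(n := (SOME c. a < outer_measure_of M (S (Suc n) ((kk n)(n := c)))))" for n
    by (simp add: kk_def)
  have akk: "a < outer_measure_of M (S n (kk n))" for n
  proof (induction n)
    case 0
    then show ?case using a by (simp add: S_def)
  next
    case (Suc n)
    show ?case unfolding kk_Suc by (rule someI_ex[OF step[OF Suc]])
  qed
  note stable = stabilizes[of kk, OF kk_Suc]
  define k where "k j = kk (Suc j) j" for j
  have Sk: "S n (kk n) = S n k" for n
    using stable[of _ n] by (simp add: S_def k_def)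
  define K where "K N = {x \<in> space M. \<exists>w. (\<forall>j. w j \<le> k j) \<and> (\<forall>i\<le>N. H i x w)}" for N
  define lv where "lv N = Max (lev ` {..N})" for N
  have lv: "lev i \<le> lv N" if "i \<le> N" for i N unfolding lv_def using that by (intro Max_ge) auto
  have K_meas: "K N \<in> sets M" for N
  proof -
    \<comment> \<open>All branches below the bounds, truncated beyond the deepest level that \<open>K N\<close> consults.\<close>
    define W where "W = {w. (\<forall>j<lv N. w j \<le> k j) \<and> (\<forall>j\<ge>lv N. w j = 0)}"
    have "finite W"
    proof -
      have "W \<subseteq> (\<lambda>u j. if j < lv N then u j else 0) ` (Pi\<^sub>E {..<lv N} (\<lambda>j. {..k j}))"
      proof
        fix w assume "w \<in> W"
        then have "w = (\<lambda>j. if j < lv N then restrict w {..<lv N} j else 0)"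
          "restrict w {..<lv N} \<in> Pi\<^sub>E {..<lv N} (\<lambda>j. {..k j})"
          by (simp_all add: W_def fun_eq_iff)
        then show "w \<in> (\<lambda>u j. if j < lv N then u j else 0) ` (Pi\<^sub>E {..<lv N} (\<lambda>j. {..k j}))"
          by (rule image_eqI)
      qed
      then show ?thesis by (rule finite_subset) (intro finite_imageI finite_PiE; simp)
    qed
    have "K N = (\<Union>w\<in>W. \<Inter>i\<in>{..N}. {x \<in> space M. H i x w})"
    proof safe
      fix x assume "x \<in> K N"
      then obtain w where w: "x \<in> space M" "\<forall>j. w j \<le> k j" "\<forall>i\<le>N. H i x w" by (auto simp: K_def)
      define w' where "w' j = (if j < lv N then w j else 0)" for j
      have "H i x w'" if "i \<le> N" for i
        using w(3) that lev[of i w w' x] lv[OF that] by (auto simp: w'_def)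
      moreover have "w' \<in> W" using w by (auto simp: W_def w'_def)
      ultimately show "x \<in> (\<Union>w\<in>W. \<Inter>i\<in>{..N}. {x \<in> space M. H i x w})" using w by auto
    next
      fix x w assume "w \<in> W" "x \<in> (\<Inter>i\<in>{..N}. {x \<in> space M. H i x w})"
      then show "x \<in> K N"
        unfolding K_def W_def by (auto intro!: exI[of _ w]) (metis le0 not_le_imp_less)
    qed
    also have "\<dots> \<in> sets M"
      using \<open>finite W\<close> meas by (intro sets.finite_UN sets.finite_INT) auto
    finally show ?thesis .
  qed
  have aK: "a \<le> emeasure M (K N)" for N
  proof -
    have "S (lv N) k \<subseteq> K N"
    proof
      fix x assume "x \<in> S (lv N) k"
      then obtain w where w: "x \<in> space M" "\<forall>j<lv N. w j \<le> k j" "\<And>i. H i x w"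
        by (auto simp: S_def FH)
      define w' where "w' j = (if j < lv N then w j else 0)" for j
      have "H i x w'" if "i \<le> N" for i
        using w(3)[of i] lev[of i w w' x] lv[OF that] by (auto simp: w'_def)
      then show "x \<in> K N" using w by (auto simp: K_def w'_def intro!: exI[of _ w'])
    qed
    then have "outer_measure_of M (S (lv N) k) \<le> emeasure M (K N)"
      using outer_measure_of_mono[of _ "K N" M] K_meas by (metis outer_measure_of_eq)
    then show ?thesis using akk[of "lv N"] Sk by (metis less_imp_le order_trans)
  qed
  have "(\<lambda>N. emeasure M (K N)) \<longlonglongrightarrow> emeasure M (\<Inter>N. K N)"
    using K_meas by (intro Lim_emeasure_decseq) (auto simp: decseq_def K_def intro: order_trans)
  then have "a \<le> emeasure M (\<Inter>N. K N)"
    using aK by (intro LIMSEQ_le_const) auto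
  moreover have "(\<Inter>N. K N) \<subseteq> {x \<in> space M. \<exists>w. F x w}"
  proof
    fix x assume x: "x \<in> (\<Inter>N. K N)"
    have "\<exists>w. \<forall>i. H i x w"
    proof (rule koenig_bounded[of _ k])
      show "\<exists>n. \<forall>w w'. (\<forall>j<n. w j = w' j) \<longrightarrow> H i x w = H i x w'" for i
        using lev[of i] by (intro exI[of _ "lev i"]) auto
      show "\<exists>w. (\<forall>j. w j \<le> k j) \<and> (\<forall>i\<le>N. H i x w)" for N
        using x unfolding K_def by blast
    qed
    then show "x \<in> {x \<in> space M. \<exists>w. F x w}" using x by (auto simp: FH K_def)
  qed
  ultimately show "\<exists>K\<in>sets M. K \<subseteq> {x \<in> space M. \<exists>w. F x w} \<and> a \<le> emeasure M K"
    using K_meas by (intro bexI[of _ "\<Inter>N. K N"]) auto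
qed

section \<open>Measurable selection by the leftmost branch\<close>

text \<open>Universal measurability is measurability for this \<open>\<sigma>\<close>-algebra, which makes the standard
closure properties of measurable functions available for it.\<close>

definition univ_space :: "'a measure \<Rightarrow> 'a measure" where
  "univ_space M = sigma (space M) (universal_sets M)"

lemma prob_algebraD:
  assumes "\<mu> \<in> space (prob_algebra M)"
  shows "sets \<mu> = sets M" "space \<mu> = space M" "prob_space \<mu>" "finite_measure \<mu>"
  using assms sets_eq_imp_space_eq[of \<mu> M]
  by (auto simp: space_prob_algebra prob_space.finite_measure)

lemma sigma_algebra_universal_sets: "sigma_algebra (space M) (universal_sets M)"
  unfolding sigma_algebra_iff2
proof (intro conjI ballI allI impI)
  show "universal_sets M \<subseteq> Pow (space M)" "{} \<in> universal_sets M"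
    by (auto simp: universal_sets_def)
next
  fix A assume A: "A \<in> universal_sets M"
  have "space M - A \<in> sets (completion \<mu>)" if mu: "\<mu> \<in> space (prob_algebra M)" for \<mu>
  proof -
    have "space (completion \<mu>) - A \<in> sets (completion \<mu>)"
      using A mu by (intro sets.compl_sets) (auto simp: universal_sets_def)
    then show ?thesis using prob_algebraD(2)[OF mu] by simp
  qed
  then show "space M - A \<in> universal_sets M" by (auto simp: universal_sets_def)
next
  fix A :: "nat \<Rightarrow> 'a set" assume "range A \<subseteq> universal_sets M"
  then show "(\<Union>i. A i) \<in> universal_sets M"
    by (auto simp: universal_sets_def subset_eq intro!: sets.countable_UN)
qed

lemma space_univ_space [simp]: "space (univ_space M) = space M"
  by (simp add: univ_space_def universal_sets_def space_measure_of_conv)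

lemma sets_univ_space: "sets (univ_space M) = universal_sets M"
proof -
  interpret sigma_algebra "space M" "universal_sets M" by (rule sigma_algebra_universal_sets)
  show ?thesis
    unfolding univ_space_def using space_closed by (simp add: sets_measure_of sigma_sets_eq)
qed

lemma universally_measurable_iff:
  "universally_measurable M f \<longleftrightarrow> f \<in> borel_measurable (univ_space M)"
  by (auto simp: universally_measurable_def measurable_def sets_univ_space)

definition baire :: "(nat \<Rightarrow> nat) measure" where
  "baire = (\<Pi>\<^sub>M i\<in>UNIV. count_space UNIV)"

lemma space_baire [simp]: "space baire = UNIV"
  by (simp add: baire_def space_PiM)

lemma measurable_baire_coord [measurable]: "(\<lambda>w. w n) \<in> measurable baire (count_space UNIV)"
  unfolding baire_def by (rule measurable_component_singleton) simp

lemma measurable_into_baire: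
  assumes "\<And>n. (\<lambda>x. f x n) \<in> measurable M (count_space UNIV)"
  shows "f \<in> measurable M baire"
  unfolding baire_def using assms by (intro measurable_PiM_single') auto

lemma finite_levelI:
  assumes "\<And>w w' x. (\<And>k. k < n \<Longrightarrow> w k = w' k) \<Longrightarrow> F x w = F x w'"
    and "\<And>w. {x \<in> space M. F x w} \<in> sets M"
  shows "finite_level M F"
  unfolding finite_level_def
proof (intro conjI allI)
  show "\<exists>n. \<forall>w w'. (\<forall>k<n. w k = w' k) \<longrightarrow> (\<forall>x. F x w = F x w')"
    by (intro exI[of _ n] allI impI assms(1)) simp
qed (rule assms(2))

lemma tree_closed_finite_level: "finite_level M F \<Longrightarrow> tree_closed M F"
  unfolding tree_closed_def by (rule exI[of _ "\<lambda>_. F"]) simp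

lemma tree_closed_INT:
  assumes "\<And>i::nat. tree_closed M (F i)"
  shows "tree_closed M (\<lambda>x w. \<forall>i. F i x w)"
proof -
  have "\<forall>i. \<exists>H. (\<forall>j::nat. finite_level M (H j)) \<and> (\<forall>x w. F i x w \<longleftrightarrow> (\<forall>j. H j x w))"
    using assms unfolding tree_closed_def by simp
  from choice[OF this] obtain H where
    H: "\<forall>i. (\<forall>j::nat. finite_level M (H i j)) \<and> (\<forall>x w. F i x w \<longleftrightarrow> (\<forall>j. H i j x w))" ..
  show ?thesis
    unfolding tree_closed_def
  proof (intro exI[of _ "\<lambda>k. H (fst (prod_decode k)) (snd (prod_decode k))"] conjI allI)
    show "finite_level M (H (fst (prod_decode i)) (snd (prod_decode i)))" for i
      using H by simp
    show "(\<forall>i. F i x w) = (\<forall>i. H (fst (prod_decode i)) (snd (prod_decode i)) x w)" for x w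
      using H by (metis fst_conv prod_encode_inverse snd_conv)
  qed
qed

text \<open>A continuous change of the branch, under a premise that finitely many entries decide. The premise lets
a single family of trees choose among countably many others by its first entry.\<close>

lemma tree_closed_subst_guard:
  assumes F: "tree_closed M F"
    and cont: "\<And>n. \<exists>m. \<forall>w w'. (\<forall>k<m. w k = w' k) \<longrightarrow> (\<forall>k<n. \<phi> w k = \<phi> w' k)"
    and p: "\<And>w w'. (\<And>k. k < l \<Longrightarrow> w k = w' k) \<Longrightarrow> p w = p w'"
  shows "tree_closed M (\<lambda>x w. p w \<longrightarrow> F x (\<phi> w))"
proof -
  obtain H where H: "\<And>i. finite_level M (H i)" and FH: "\<And>x w. F x w \<longleftrightarrow> (\<forall>i::nat. H i x w)"
    using F unfolding tree_closed_def by metis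
  have "finite_level M (\<lambda>x w. p w \<longrightarrow> H i x (\<phi> w))" for i
  proof -
    obtain n where n: "\<And>w w' x. (\<forall>k<n. w k = w' k) \<Longrightarrow> H i x w = H i x w'"
      using H[of i] unfolding finite_level_def by metis
    obtain m where m: "\<And>w w'. (\<forall>k<m. w k = w' k) \<Longrightarrow> (\<forall>k<n. \<phi> w k = \<phi> w' k)"
      using cont[of n] by metis
    show ?thesis
    proof (rule finite_levelI[of "max l m"])
      fix w w' :: "nat \<Rightarrow> nat" and x assume e: "\<And>k. k < max l m \<Longrightarrow> w k = w' k"
      have "p w = p w'" by (rule p) (use e in simp)
      moreover have "H i x (\<phi> w) = H i x (\<phi> w')" by (rule n, rule m) (use e in simp)
      ultimately show "(p w \<longrightarrow> H i x (\<phi> w)) = (p w' \<longrightarrow> H i x (\<phi> w'))" by simp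
    next
      show "{x \<in> space M. p w \<longrightarrow> H i x (\<phi> w)} \<in> sets M" for w
        using H[of i] unfolding finite_level_def by (cases "p w") auto
    qed
  qed
  then show ?thesis
    unfolding tree_closed_def by (intro exI[of _ "\<lambda>i x w. p w \<longrightarrow> H i x (\<phi> w)"]) (simp add: FH)
qed

lemma tree_closed_subst:
  assumes "tree_closed M F"
    and "\<And>n. \<exists>m. \<forall>w w'. (\<forall>k<m. w k = w' k) \<longrightarrow> (\<forall>k<n. \<phi> w k = \<phi> w' k)"
  shows "tree_closed M (\<lambda>x w. F x (\<phi> w))"
  using tree_closed_subst_guard[OF assms, of 0 "\<lambda>_. True"] by simp

abbreviation fpart :: "(nat \<Rightarrow> nat) \<Rightarrow> nat \<Rightarrow> nat" where
  "fpart w n \<equiv> fst (prod_decode (w n))"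

abbreviation spart :: "(nat \<Rightarrow> nat) \<Rightarrow> nat \<Rightarrow> nat" where
  "spart w n \<equiv> snd (prod_decode (w n))"

text \<open>The set \<open>B\<close> is a projection of a closed family in which the branch carries two sequences: the entry
\<open>w n\<close> encodes the \<open>n\<close>-th entry of the point \<open>y\<close> together with the \<open>n\<close>-th entry of a witness.\<close>

definition tree_rep :: "'a measure \<Rightarrow> ('a \<times> (nat \<Rightarrow> nat)) set \<Rightarrow> bool" where
  "tree_rep M B \<longleftrightarrow>
     (\<exists>F. tree_closed M F \<and> (\<forall>x\<in>space M. \<forall>y. (x, y) \<in> B \<longleftrightarrow> (\<exists>w. F x w \<and> y = fpart w)))"

lemma tree_rep_choice:
  fixes B :: "nat \<Rightarrow> ('a \<times> (nat \<Rightarrow> nat)) set"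
  assumes "\<And>i. tree_rep M (B i)"
  shows "\<exists>F. \<forall>i. tree_closed M (F i) \<and>
    (\<forall>x\<in>space M. \<forall>y. (x, y) \<in> B i \<longleftrightarrow> (\<exists>w. F i x w \<and> y = fpart w))"
  by (rule choice) (use assms in \<open>simp add: tree_rep_def\<close>)

text \<open>The witness for the union announces the index of a set in its first entry and continues with a
witness for that set.\<close>

lemma tree_rep_UN:
  fixes B :: "nat \<Rightarrow> ('a \<times> (nat \<Rightarrow> nat)) set"
  assumes "\<And>i. tree_rep M (B i)"
  shows "tree_rep M (\<Union>i. B i)"
proof -
  from tree_rep_choice[of M B, OF assms] obtain F where
    F': "\<forall>i. tree_closed M (F i) \<and>
      (\<forall>x\<in>space M. \<forall>y. (x, y) \<in> B i \<longleftrightarrow> (\<exists>w. F i x w \<and> y = fpart w))" ..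
  have F: "\<And>i. tree_closed M (F i)" using F' by simp
  have BF: "\<And>i x y. x \<in> space M \<Longrightarrow> (x, y) \<in> B i \<longleftrightarrow> (\<exists>w. F i x w \<and> y = fpart w)"
    using F' by simp
  define \<sigma> where "\<sigma> w n = prod_encode (fpart w n, spart w (Suc n))" for w n
  define K where "K = (\<lambda>x w. \<forall>i. spart w 0 = i \<longrightarrow> F i x (\<sigma> w))"
  have "tree_closed M K"
    unfolding K_def
  proof (rule tree_closed_INT, rule tree_closed_subst_guard[OF F, where l = 1])
    show "\<exists>m. \<forall>w w'. (\<forall>k<m. w k = w' k) \<longrightarrow> (\<forall>k<n. \<sigma> w k = \<sigma> w' k)" for n
      by (rule exI[of _ "Suc n"]) (simp add: \<sigma>_def)
  qed simp
  moreover have "(x, y) \<in> (\<Union>i. B i) \<longleftrightarrow> (\<exists>w. K x w \<and> y = fpart w)" if x: "x \<in> space M" for x y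
  proof
    assume "(x, y) \<in> (\<Union>i. B i)"
    then obtain i w' where w': "F i x w'" "y = fpart w'" using BF[OF x] by auto
    define w where "w n = prod_encode (y n, case n of 0 \<Rightarrow> i | Suc m \<Rightarrow> spart w' m)" for n
    have "\<sigma> w = w'" by (simp add: \<sigma>_def w_def fun_eq_iff w'(2))
    then have "K x w" "y = fpart w" using w' by (simp_all add: K_def w_def)
    then show "\<exists>w. K x w \<and> y = fpart w" by (intro exI[of _ w] conjI)
  next
    assume "\<exists>w. K x w \<and> y = fpart w"
    then obtain w where w: "K x w" "y = fpart w" by metis
    then have "F (spart w 0) x (\<sigma> w)" "y = fpart (\<sigma> w)" by (simp_all add: K_def \<sigma>_def)
    then have "(x, y) \<in> B (spart w 0)" using BF[OF x] by metis
    then show "(x, y) \<in> (\<Union>i. B i)" by blast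
  qed
  ultimately show ?thesis unfolding tree_rep_def by (intro exI[of _ K] conjI ballI allI)
qed

text \<open>The witness for the intersection interleaves witnesses for all sets by means of the pairing function. The
point \<open>y\<close> is shared, so no condition of compatibility between the witnesses arises.\<close>

lemma tree_rep_INT:
  fixes B :: "nat \<Rightarrow> ('a \<times> (nat \<Rightarrow> nat)) set"
  assumes "\<And>i. tree_rep M (B i)"
  shows "tree_rep M (\<Inter>i. B i)"
proof -
  from tree_rep_choice[of M B, OF assms] obtain F where
    F': "\<forall>i. tree_closed M (F i) \<and>
      (\<forall>x\<in>space M. \<forall>y. (x, y) \<in> B i \<longleftrightarrow> (\<exists>w. F i x w \<and> y = fpart w))" ..
  have F: "\<And>i. tree_closed M (F i)" using F' by simp
  have BF: "\<And>i x y. x \<in> space M \<Longrightarrow> (x, y) \<in> B i \<longleftrightarrow> (\<exists>w. F i x w \<and> y = fpart w)"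
    using F' by simp
  define \<rho> where "\<rho> i w n = prod_encode (fpart w n, spart w (prod_encode (i, n)))" for i w n
  define K where "K = (\<lambda>x w. \<forall>i. F i x (\<rho> i w))"
  have "tree_closed M K"
    unfolding K_def
  proof (rule tree_closed_INT, rule tree_closed_subst[OF F])
    fix i n :: nat
    define m where "m = n + (\<Sum>k<n. Suc (prod_encode (i, k)))"
    have "prod_encode (i, k) < m" if "k < n" for k
    proof -
      have "Suc (prod_encode (i, k)) \<le> (\<Sum>k<n. Suc (prod_encode (i, k)))"
        using that by (intro member_le_sum) auto
      then show ?thesis by (simp add: m_def)
    qed
    then show "\<exists>m. \<forall>w w'. (\<forall>k<m. w k = w' k) \<longrightarrow> (\<forall>k<n. \<rho> i w k = \<rho> i w' k)"
      by (intro exI[of _ m]) (auto simp: \<rho>_def m_def)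
  qed
  moreover have "(x, y) \<in> (\<Inter>i. B i) \<longleftrightarrow> (\<exists>w. K x w \<and> y = fpart w)" if x: "x \<in> space M" for x y
  proof
    assume "(x, y) \<in> (\<Inter>i. B i)"
    then have "\<forall>i. \<exists>w. F i x w \<and> y = fpart w" using BF[OF x] by simp
    from choice[OF this] obtain w' where "\<forall>i. F i x (w' i) \<and> y = fpart (w' i)" ..
    then have w': "\<And>i. F i x (w' i)" "\<And>i. y = fpart (w' i)" by simp_all
    define w where "w j = prod_encode (y j, spart (w' (fst (prod_decode j))) (snd (prod_decode j)))" for j
    have "fst (prod_decode (w' i n)) = y n" for i n using w'(2)[of i] by simp
    then have "\<rho> i w = w' i" for i by (auto simp: \<rho>_def w_def fun_eq_iff) (metis prod.collapse prod_decode_inverse)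
    then have "K x w" "y = fpart w" using w' by (simp_all add: K_def w_def)
    then show "\<exists>w. K x w \<and> y = fpart w" by (intro exI[of _ w] conjI)
  next
    assume "\<exists>w. K x w \<and> y = fpart w"
    then obtain w where w: "K x w" "y = fpart w" by metis
    then have "F i x (\<rho> i w)" "y = fpart (\<rho> i w)" for i by (simp_all add: K_def \<rho>_def)
    then have "(x, y) \<in> B i" for i using BF[OF x] by metis
    then show "(x, y) \<in> (\<Inter>i. B i)" by simp
  qed
  ultimately show ?thesis unfolding tree_rep_def by (intro exI[of _ K] conjI ballI allI)
qed

lemma tree_rep_coord_pred: "tree_rep M {(x, y). p (y n)}"
  unfolding tree_rep_def
proof (intro exI[of _ "\<lambda>x w. p (fpart w n)"] conjI ballI allI)
  show "tree_closed M (\<lambda>x w. p (fpart w n))"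
    by (intro tree_closed_finite_level finite_levelI[of "Suc n"]) auto
  show "((x, y) \<in> {(x, y). p (y n)}) = (\<exists>w. p (fpart w n) \<and> y = fpart w)" for x y
    by (auto intro!: exI[of _ "\<lambda>n. prod_encode (y n, 0)"])
qed

lemma tree_rep_base:
  assumes "a \<in> sets M"
  shows "tree_rep M {(x, y). x \<in> a}"
  unfolding tree_rep_def
proof (intro exI[of _ "\<lambda>x w. x \<in> a"] conjI ballI allI)
  have "{x \<in> space M. x \<in> a} = a" using sets.sets_into_space[OF assms] by auto
  then show "tree_closed M (\<lambda>x w. x \<in> a)"
    using assms by (intro tree_closed_finite_level finite_levelI[of 0]) auto
  show "((x, y) \<in> {(x, y). x \<in> a}) = (\<exists>w. x \<in> a \<and> y = fpart w)" for x and y :: "nat \<Rightarrow> nat"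
    by (auto intro!: exI[of _ "\<lambda>n. prod_encode (y n, 0)"])
qed

lemma tree_rep_cong:
  assumes "tree_rep M A" "\<And>x y. x \<in> space M \<Longrightarrow> (x, y) \<in> A \<longleftrightarrow> (x, y) \<in> B"
  shows "tree_rep M B"
  using assms unfolding tree_rep_def by (metis (no_types, lifting))

text \<open>The sets that are representable together with their complement form a \<open>\<sigma>\<close>-algebra, since
representability is stable under countable unions and intersections. Both projections are
measurable for it.\<close>

lemma tree_rep_measurable:
  assumes B: "B \<in> sets (M \<Otimes>\<^sub>M baire)"
  shows "tree_rep M B"
proof -
  define \<Omega> where "\<Omega> = space M \<times> (UNIV :: (nat \<Rightarrow> nat) set)"
  define \<D> where "\<D> = {B. B \<subseteq> \<Omega> \<and> tree_rep M B \<and> tree_rep M (\<Omega> - B)}"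
  have sa: "sigma_algebra \<Omega> \<D>"
    unfolding sigma_algebra_iff2
  proof (intro conjI ballI allI impI)
    show "\<D> \<subseteq> Pow \<Omega>" by (auto simp: \<D>_def)
    have "tree_rep M {}" "tree_rep M \<Omega>"
      using tree_rep_cong[OF tree_rep_coord_pred[of M "\<lambda>_. False"], of "{}"]
        tree_rep_cong[OF tree_rep_coord_pred[of M "\<lambda>_. True"], of "\<Omega>"] by (auto simp: \<Omega>_def)
    then show "{} \<in> \<D>" by (simp add: \<D>_def)
    show "\<Omega> - s \<in> \<D>" if "s \<in> \<D>" for s
    proof -
      have "\<Omega> - (\<Omega> - s) = s" using that by (auto simp: \<D>_def)
      then show ?thesis using that by (auto simp: \<D>_def)
    qed
    fix A :: "nat \<Rightarrow> _" assume A: "range A \<subseteq> \<D>"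
    then have A1: "\<And>i. A i \<subseteq> \<Omega>" "\<And>i. tree_rep M (A i)" "\<And>i. tree_rep M (\<Omega> - A i)"
      by (auto simp: \<D>_def)
    have "\<Omega> - (\<Union>i. A i) = (\<Inter>i. \<Omega> - A i)" by auto
    then show "(\<Union>i. A i) \<in> \<D>"
      using A1 tree_rep_UN[of M A] tree_rep_INT[of M "\<lambda>i. \<Omega> - A i"] by (auto simp: \<D>_def)
  qed
  then interpret D: sigma_algebra \<Omega> \<D> .
  define Dm where "Dm = sigma \<Omega> \<D>"
  have sets_Dm: "sets Dm = \<D>" and space_Dm: "space Dm = \<Omega>"
    unfolding Dm_def using D.space_closed by (simp_all add: sets_measure_of D.sigma_sets_eq space_measure_of)
  have [measurable]: "fst \<in> measurable Dm M"
  proof (rule measurableI)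
    show "fst x \<in> space M" if "x \<in> space Dm" for x using that by (auto simp: space_Dm \<Omega>_def)
    fix a assume a: "a \<in> sets M"
    have "tree_rep M (fst -` a \<inter> \<Omega>)"
      by (rule tree_rep_cong[OF tree_rep_base[OF a]]) (auto simp: \<Omega>_def)
    moreover have "tree_rep M (\<Omega> - fst -` a \<inter> \<Omega>)"
      by (rule tree_rep_cong[OF tree_rep_base[of "space M - a"]]) (use a in \<open>auto simp: \<Omega>_def\<close>)
    ultimately show "fst -` a \<inter> space Dm \<in> sets Dm"
      by (auto simp: sets_Dm space_Dm \<D>_def)
  qed
  have [measurable]: "snd \<in> measurable Dm baire"
  proof (rule measurable_into_baire)
    fix n
    have "(\<lambda>x. snd x n) -` {k} \<inter> \<Omega> \<in> \<D>" for k
    proof -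
      have "tree_rep M ((\<lambda>x. snd x n) -` {k} \<inter> \<Omega>)"
        by (rule tree_rep_cong[OF tree_rep_coord_pred[of M "\<lambda>j. j = k" n]]) (auto simp: \<Omega>_def)
      moreover have "tree_rep M (\<Omega> - (\<lambda>x. snd x n) -` {k} \<inter> \<Omega>)"
        by (rule tree_rep_cong[OF tree_rep_coord_pred[of M "\<lambda>j. j \<noteq> k" n]]) (auto simp: \<Omega>_def)
      ultimately show ?thesis by (auto simp: \<D>_def)
    qed
    then show "(\<lambda>x. snd x n) \<in> measurable Dm (count_space UNIV)"
      by (subst measurable_count_space_eq2_countable) (auto simp: sets_Dm space_Dm)
  qed
  have "(\<lambda>p. (fst p, snd p)) \<in> measurable Dm (M \<Otimes>\<^sub>M baire)" by measurable
  from measurable_sets[OF this B] have "B \<inter> \<Omega> \<in> \<D>" by (simp add: sets_Dm space_Dm)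
  then have "tree_rep M (B \<inter> \<Omega>)" by (simp add: \<D>_def)
  then show ?thesis by (rule tree_rep_cong) (auto simp: \<Omega>_def)
qed

lemma tree_closed_cong_sets:
  assumes "sets M = sets N" "tree_closed M F"
  shows "tree_closed N F"
  using assms(2) sets_eq_imp_space_eq[OF assms(1)]
  unfolding tree_closed_def finite_level_def assms(1) by simp

lemma tree_projection_universal:
  assumes "tree_closed M F"
  shows "{x \<in> space M. \<exists>w. F x w} \<in> universal_sets M"
  unfolding universal_sets_def
proof (intro CollectI conjI ballI)
  fix \<mu> assume mu: "\<mu> \<in> space (prob_algebra M)"
  have "tree_closed \<mu> F"
    using tree_closed_cong_sets[OF prob_algebraD(1)[OF mu, symmetric] assms] .
  from tree_projection_completion[OF prob_algebraD(4)[OF mu] this]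
  show "{x \<in> space M. \<exists>w. F x w} \<in> sets (completion \<mu>)"
    using prob_algebraD(2)[OF mu] by simp
qed auto

lemma all_case_nat: "(\<forall>i. (case i of 0 \<Rightarrow> P | Suc _ \<Rightarrow> Q) x w) \<longleftrightarrow> P x w \<and> Q x w"
  by (metis nat.exhaust nat.simps(4) nat.simps(5))

text \<open>Choose the entries one after the other, each as small as possible subject to the condition that the
sequence so far extends to a branch. These conditions define projections of closed families, hence
universally measurable sets; the limit is a branch because the family is closed.\<close>

lemma leftmost_branch_selection:
  assumes F: "tree_closed M F"
  shows "\<exists>s\<in>measurable (univ_space M) baire. \<forall>x\<in>space M. (\<exists>w. F x w) \<longrightarrow> F x (s x)"
proof -
  obtain H where H: "\<And>i. finite_level M (H i)" and FH: "\<And>x w. F x w \<longleftrightarrow> (\<forall>i::nat. H i x w)"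
    using F unfolding tree_closed_def by metis
  define E where "E x u \<longleftrightarrow> (\<exists>w. F x w \<and> (\<forall>i<length u. w i = u ! i))" for x and u :: "nat list"
  have E_meas [measurable]: "Measurable.pred (univ_space M) (\<lambda>x. E x u)" for u
  proof -
    have "tree_closed M (\<lambda>x w. \<forall>i. (case i of 0 \<Rightarrow> F | Suc _ \<Rightarrow> (\<lambda>x w. \<forall>i<length u. w i = u ! i)) x w)"
    proof (rule tree_closed_INT)
      show "tree_closed M (case i of 0 \<Rightarrow> F | Suc _ \<Rightarrow> (\<lambda>x w. \<forall>i<length u. w i = u ! i))" for i :: nat
      proof (cases i)
        case (Suc j)
        have "tree_closed M (\<lambda>x w. \<forall>i<length u. w i = u ! i)"
          by (intro tree_closed_finite_level finite_levelI[of "length u"]) simp_all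
        then show ?thesis by (simp add: Suc)
      qed (simp add: F)
    qed
    from tree_projection_universal[OF this]
    have "{x \<in> space M. E x u} \<in> universal_sets M"
      unfolding E_def by (simp add: all_case_nat)
    then show ?thesis by (simp add: pred_def sets_univ_space)
  qed
  define pre where "pre x = rec_nat [] (\<lambda>_ u. u @ [LEAST k. E x (u @ [k])])" for x
  have pre_0: "pre x 0 = []" and pre_Suc: "pre x (Suc n) = pre x n @ [LEAST k. E x (pre x n @ [k])]" for x n
    by (simp_all add: pre_def)
  have len: "length (pre x n) = n" for x n
    by (induction n) (simp_all add: pre_0 pre_Suc)
  define s where "s x n = pre x (Suc n) ! n" for x n
  have nth_pre: "pre x m ! n = s x n" if "n < m" for x m n
    using that
  proof (induction m)
    case (Suc m)
    show ?case
    proof (cases "n = m")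
      case False
      then have "n < m" using Suc.prems by simp
      then show ?thesis using Suc.IH by (simp add: pre_Suc[of x m] nth_append len)
    qed (simp add: s_def)
  qed simp
  have pre_meas [measurable]: "(\<lambda>x. pre x n) \<in> measurable (univ_space M) (count_space UNIV)" for n
  proof (induction n)
    case 0
    then show ?case by (simp add: pre_0)
  next
    case (Suc n)
    have "(\<lambda>x. u @ [LEAST k. E x (u @ [k])]) \<in> measurable (univ_space M) (count_space UNIV)" for u
      by (rule measurable_compose[of "\<lambda>x. LEAST k. E x (u @ [k])" _ "count_space UNIV" "\<lambda>k. u @ [k]"])
        measurable
    from measurable_compose_countable[OF this Suc] show ?case by (simp add: pre_Suc)
  qed
  have "s \<in> measurable (univ_space M) baire"
  proof (rule measurable_into_baire)
    fix n
    show "(\<lambda>x. s x n) \<in> measurable (univ_space M) (count_space UNIV)"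
      unfolding s_def by (rule measurable_compose[OF pre_meas]) simp
  qed
  moreover have "F x (s x)" if ex: "\<exists>w. F x w" for x
  proof -
    have Epre: "E x (pre x n)" for n
    proof (induction n)
      case 0
      then show ?case using ex by (simp add: E_def pre_0)
    next
      case (Suc n)
      then obtain w where w: "F x w" "\<forall>i<n. w i = pre x n ! i" by (auto simp: E_def len)
      have "E x (pre x n @ [w n])"
        unfolding E_def using w by (intro exI[of _ w]) (auto simp: len nth_append less_Suc_eq)
      then show ?case unfolding pre_Suc by (rule LeastI)
    qed
    have "H i x (s x)" for i
    proof -
      obtain n where n: "\<And>w w' x. (\<forall>k<n. w k = w' k) \<Longrightarrow> H i x w = H i x w'"
        using H[of i] unfolding finite_level_def by metis
      obtain w where w: "F x w" "\<forall>j<n. w j = pre x n ! j"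
        using Epre[of n] by (auto simp: E_def len)
      have "\<forall>j<n. w j = s x j" using w(2) nth_pre[of _ n x] by simp
      from n[OF this, of x] show ?thesis using w(1) FH by simp
    qed
    then show ?thesis by (simp add: FH)
  qed
  ultimately show ?thesis by blast
qed

theorem jankov_von_neumann:
  assumes B: "B \<in> sets (M \<Otimes>\<^sub>M baire)"
  shows "{x \<in> space M. \<exists>y. (x, y) \<in> B} \<in> universal_sets M"
    and "\<exists>s\<in>measurable (univ_space M) baire. \<forall>x\<in>space M. (\<exists>y. (x, y) \<in> B) \<longrightarrow> (x, s x) \<in> B"
proof -
  obtain F where F: "tree_closed M F"
    and BF: "\<And>x y. x \<in> space M \<Longrightarrow> (x, y) \<in> B \<longleftrightarrow> (\<exists>w. F x w \<and> y = fpart w)"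
    using tree_rep_measurable[OF B] unfolding tree_rep_def by metis
  have "{x \<in> space M. \<exists>y. (x, y) \<in> B} = {x \<in> space M. \<exists>w. F x w}"
    using BF by auto
  then show "{x \<in> space M. \<exists>y. (x, y) \<in> B} \<in> universal_sets M"
    using tree_projection_universal[OF F] by simp
  obtain s where s [measurable]: "s \<in> measurable (univ_space M) baire"
    and sF: "\<And>x. x \<in> space M \<Longrightarrow> \<exists>w. F x w \<Longrightarrow> F x (s x)"
    using leftmost_branch_selection[OF F] by metis
  have "(\<lambda>x. fpart (s x)) \<in> measurable (univ_space M) baire"
    by (rule measurable_into_baire) measurable
  moreover have "(x, fpart (s x)) \<in> B" if "x \<in> space M" "\<exists>y. (x, y) \<in> B" for x
    using that BF sF by metis
  ultimately show "\<exists>s\<in>measurable (univ_space M) baire. \<forall>x\<in>space M. (\<exists>y. (x, y) \<in> B) \<longrightarrow> (x, s x) \<in> B"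
    by (intro bexI[of _ "\<lambda>x. fpart (s x)"]) auto
qed

section \<open>Polish spaces as retracts of Baire space\<close>

text \<open>Where the sequence does not converge, a default value is used, so that the functions have a limit
everywhere.\<close>

lemma borel_measurable_lim_complete:
  fixes f :: "nat \<Rightarrow> 'a \<Rightarrow> 'b::polish_space"
  assumes [measurable]: "\<And>i. f i \<in> borel_measurable M"
  shows "(\<lambda>x. if Cauchy (\<lambda>i. f i x) then lim (\<lambda>i. f i x) else a) \<in> borel_measurable M"
proof (rule borel_measurable_LIMSEQ_metric)
  show "(\<lambda>x. if Cauchy (\<lambda>i. f i x) then f i x else a) \<in> borel_measurable M" for i
    by measurable
  show "(\<lambda>i. if Cauchy (\<lambda>i. f i x) then f i x else a)
      \<longlonglongrightarrow> (if Cauchy (\<lambda>i. f i x) then lim (\<lambda>i. f i x) else a)" for x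
    by (cases "Cauchy (\<lambda>i. f i x)") (simp_all add: Cauchy_convergent_iff convergent_LIMSEQ_iff)
qed

lemma dense_sequence_exists:
  "\<exists>d :: nat \<Rightarrow> 'e::polish_space. \<forall>x e. 0 < e \<longrightarrow> (\<exists>n. dist x (d n) < e)"
proof -
  obtain D :: "'e set" where D: "countable D" "\<And>X. open X \<Longrightarrow> X \<noteq> {} \<Longrightarrow> \<exists>d\<in>D. d \<in> X"
    by (rule countable_dense_setE) blast
  have "D \<noteq> {}" using D(2)[of UNIV] by auto
  then have r: "range (from_nat_into D) = D" using D(1) by (rule range_from_nat_into)
  have "\<exists>n. dist x (from_nat_into D n) < e" if "0 < e" for x e
  proof -
    have "ball x e \<noteq> {}" using that by simp
    from D(2)[OF open_ball this] obtain d where "d \<in> D" "dist x d < e" by auto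
    then show ?thesis using r by (metis imageE)
  qed
  then show ?thesis by (intro exI[of _ "from_nat_into D"]) simp
qed

text \<open>A point is encoded by the indices of points of a dense sequence that approximate it at rate
\<open>2\<^sup>-\<^sup>k\<close>; a code is decoded by taking the limit.\<close>

lemma polish_baire_retract:
  "\<exists>r\<in>measurable borel baire. \<exists>g\<in>measurable baire borel. \<forall>x::'e::polish_space. g (r x) = x"
proof -
  obtain d :: "nat \<Rightarrow> 'e" where d: "\<forall>x e. 0 < e \<longrightarrow> (\<exists>n. dist x (d n) < e)"
    using dense_sequence_exists by metis
  define r where "r x k = (LEAST n. dist x (d n) < (1/2) ^ k)" for x and k :: nat
  define g where "g w = (if Cauchy (\<lambda>k. d (w k)) then lim (\<lambda>k. d (w k)) else d 0)" for w :: "nat \<Rightarrow> nat"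
  have "r \<in> measurable borel baire"
    by (rule measurable_into_baire) (unfold r_def, measurable)
  moreover have "g \<in> measurable baire borel"
    unfolding g_def
  proof (rule borel_measurable_lim_complete)
    show "(\<lambda>w. d (w i)) \<in> measurable baire borel" for i
      by (rule measurable_compose[OF measurable_baire_coord]) simp
  qed
  moreover have "g (r x) = x" for x
  proof -
    have le: "dist (d (r x k)) x < (1/2) ^ k" for k
    proof -
      have "\<exists>n. dist x (d n) < (1/2) ^ k" using d by simp
      then have "dist x (d (r x k)) < (1/2) ^ k" unfolding r_def by (rule LeastI_ex)
      then show ?thesis by (simp add: dist_commute)
    qed
    have "(\<lambda>k. dist (d (r x k)) x) \<longlonglongrightarrow> 0"
    proof (rule tendsto_sandwich[OF _ _ tendsto_const])
      show "(\<lambda>k. (1/2::real) ^ k) \<longlonglongrightarrow> 0" by (rule LIMSEQ_power_zero) simp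
    qed (use le in \<open>auto intro!: always_eventually less_imp_le\<close>)
    then have "(\<lambda>k. d (r x k)) \<longlonglongrightarrow> x" using tendsto_dist_iff by blast
    then show ?thesis
      unfolding g_def using LIMSEQ_imp_Cauchy limI by metis
  qed
  ultimately show ?thesis by metis
qed

text \<open>In base four with digits \<open>0\<close> and \<open>1\<close> only, the digits after the \<open>n\<close>-th contribute less than one
unit of the \<open>n\<close>-th place, so no ambiguity of expansions occurs.\<close>

lemma quaternary_digit:
  fixes b :: "nat \<Rightarrow> nat"
  assumes b: "\<And>j. b j \<le> 1"
  shows "\<lfloor>4 ^ Suc n * (\<Sum>j. real (b j) / 4 ^ Suc j)\<rfloor> mod 4 = int (b n)"
proof -
  have g: "(\<lambda>j. 1 / 4 ^ Suc j :: real) sums (1/3)"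
    using sums_mult[OF geometric_sums[of "1/4::real"], of "1/4"] by (simp add: power_one_over field_simps)
  have bnd: "real (c j) / 4 ^ Suc j \<le> 1 / 4 ^ Suc j" if "\<And>j. c j \<le> 1" for c :: "nat \<Rightarrow> nat" and j
    using that[of j] by (intro divide_right_mono) simp_all
  have sm: "summable (\<lambda>j. real (c j) / 4 ^ Suc j)" if "\<And>j. c j \<le> 1" for c :: "nat \<Rightarrow> nat"
  proof (rule summable_comparison_test[OF _ sums_summable[OF g]])
    show "\<exists>N. \<forall>j\<ge>N. norm (real (c j) / 4 ^ Suc j) \<le> 1 / 4 ^ Suc j"
      using bnd[where c = c, OF that] by (intro exI[of _ 0]) simp
  qed
  define t where "t = (\<Sum>j. real (b (j + Suc n)) / 4 ^ Suc j)"
  have smt: "summable (\<lambda>j. real (b (j + Suc n)) / 4 ^ Suc j)" by (rule sm) (rule b)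
  have t: "0 \<le> t" "t < 1"
  proof -
    show "0 \<le> t" unfolding t_def by (rule suminf_nonneg[OF smt]) simp
    have "t \<le> (\<Sum>j. 1 / 4 ^ Suc j :: real)"
      unfolding t_def by (rule suminf_le[OF _ smt sums_summable[OF g]]) (rule bnd, rule b)
    then show "t < 1" using sums_unique[OF g] by simp
  qed
  define Z where "Z = (\<Sum>j<n. int (b j) * 4 ^ (n - j))"
  have "4 dvd Z"
    unfolding Z_def
  proof (rule dvd_sum)
    fix j assume "j \<in> {..<n}"
    then have "(4::int) dvd 4 ^ (n - j)" by simp
    then show "4 dvd int (b j) * 4 ^ (n - j)" by (rule dvd_mult)
  qed
  have "(\<Sum>j. real (b j) / 4 ^ Suc j) =
      (\<Sum>j. real (b (j + Suc n)) / 4 ^ Suc (j + Suc n)) + (\<Sum>j<Suc n. real (b j) / 4 ^ Suc j)"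
    by (rule suminf_split_initial_segment[OF sm]) (rule b)
  also have "(\<Sum>j. real (b (j + Suc n)) / 4 ^ Suc (j + Suc n)) = t / 4 ^ Suc n"
    unfolding t_def suminf_divide[OF smt, symmetric] by (simp add: power_add mult_ac)
  finally have "4 ^ Suc n * (\<Sum>j. real (b j) / 4 ^ Suc j) =
      t + (\<Sum>j<Suc n. 4 ^ Suc n * (real (b j) / 4 ^ Suc j))"
    by (simp add: distrib_left sum_distrib_left)
  also have "(\<Sum>j<Suc n. 4 ^ Suc n * (real (b j) / 4 ^ Suc j)) = real_of_int (Z + int (b n))"
  proof -
    have "4 ^ Suc n * (real (b j) / 4 ^ Suc j) = real (b j) * 4 ^ (n - j)" if "j < Suc n" for j
    proof -
      have "(4::real) ^ n = 4 ^ (n - j) * 4 ^ j" using that by (simp flip: power_add)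
      then show ?thesis by simp
    qed
    then show ?thesis by (simp add: Z_def)
  qed
  finally have "\<lfloor>4 ^ Suc n * (\<Sum>j. real (b j) / 4 ^ Suc j)\<rfloor> = Z + int (b n)"
    using t by linarith
  then show ?thesis using \<open>4 dvd Z\<close> b[of n]
    by (metis (no_types, lifting) add.commute dvd_imp_mod_0 mod_add_right_eq add.right_neutral mod_pos_pos_trivial of_nat_0_le_iff of_nat_le_iff of_nat_1 order.strict_trans1 one_less_numeral_iff semiring_norm(76))
qed

text \<open>A sequence is encoded by the indicator function of its graph, written as a real number in base four.\<close>

lemma baire_real_retract:
  "\<exists>e\<in>measurable baire (borel :: real measure). \<exists>c\<in>measurable borel baire. \<forall>w. c (e w) = w"
proof -
  define b where "b w j = (if w (fst (prod_decode j)) = snd (prod_decode j) then 1 else 0 :: nat)" for w j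
  define e where "e w = (\<Sum>j. real (b w j) / 4 ^ Suc j)" for w
  \<comment> \<open>Decoding reads the digits at the positions of the pairs \<open>(n, k)\<close>.\<close>
  define c where "c y n = (LEAST k. \<lfloor>4 ^ Suc (prod_encode (n, k)) * y\<rfloor> mod 4 = 1)" for y :: real and n
  have "e \<in> borel_measurable baire"
    unfolding e_def b_def by measurable
  moreover have "c \<in> measurable borel baire"
  proof (rule measurable_into_baire)
    show "(\<lambda>y. c y n) \<in> measurable borel (count_space UNIV)" for n
      unfolding c_def by measurable
  qed
  moreover have "c (e w) = w" for w
  proof
    fix n
    have "\<lfloor>4 ^ Suc (prod_encode (n, k)) * e w\<rfloor> mod 4 = 1 \<longleftrightarrow> w n = k" for k
      unfolding e_def by (subst quaternary_digit) (auto simp: b_def)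
    then show "c (e w) n = w n" unfolding c_def by (intro Least_equality) (simp_all del: power_Suc)
  qed
  ultimately show ?thesis by metis
qed

section \<open>Paths observed on a grid\<close>

text \<open>Up to the error \<open>e\<close>, the path equals \<open>p\<close> on \<open>[c, t)\<close> and \<open>q\<close> on \<open>[t, d)\<close>. The switching time is in the
open interval even when there is no jump (then \<open>p = q\<close>), so that any two switching times
can be matched by a time change of the cell.\<close>

definition two_level :: "real \<Rightarrow> (real \<Rightarrow> 'e::metric_space) \<Rightarrow> real \<Rightarrow> real \<Rightarrow> 'e \<Rightarrow> 'e \<Rightarrow> real \<Rightarrow> bool" where
  "two_level e x c d p q t \<longleftrightarrow> c < t \<and> t < d \<and>
     (\<forall>s. c \<le> s \<and> s < t \<longrightarrow> dist (x s) p \<le> e) \<and> (\<forall>s. t \<le> s \<and> s < d \<longrightarrow> dist (x s) q \<le> e)"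

text \<open>The trace of \<open>two_level\<close> on rational times. At the switching time itself nothing is
required, as the value there is not visible from rational times on a function that is not known
to be right-continuous.\<close>

definition rat_two_level :: "real \<Rightarrow> (real \<Rightarrow> 'e::metric_space) \<Rightarrow> real \<Rightarrow> real \<Rightarrow> 'e \<Rightarrow> 'e \<Rightarrow> bool" where
  "rat_two_level e x c d p q \<longleftrightarrow> (\<exists>t. c < t \<and> t < d \<and>
     (\<forall>s\<in>\<rat>. c \<le> s \<and> s < t \<longrightarrow> dist (x s) p \<le> e) \<and> (\<forall>s\<in>\<rat>. t < s \<and> s < d \<longrightarrow> dist (x s) q \<le> e))"

text \<open>The switching time can be recovered as the infimum of the times at which the function is away from \<open>p\<close>.
This turns the quantifier over real switching times into quantifiers over rational
numbers, which preserve measurability.\<close>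

lemma rat_two_level_countable:
  "rat_two_level e x c d p q \<longleftrightarrow>
     (\<exists>a\<in>\<rat>. \<exists>b\<in>\<rat>. c < a \<and> a < b \<and> b < d \<and>
        (\<forall>s\<in>\<rat>. c \<le> s \<and> s \<le> a \<longrightarrow> dist (x s) p \<le> e) \<and>
        (\<forall>s\<in>\<rat>. c \<le> s \<and> b \<le> s \<and> s < d \<longrightarrow> dist (x s) q \<le> e) \<and>
        (\<forall>r\<in>\<rat>. \<forall>s\<in>\<rat>. c \<le> r \<and> r < s \<and> s < d \<longrightarrow> dist (x r) p \<le> e \<or> dist (x s) q \<le> e))"
    (is "_ \<longleftrightarrow> ?R")
proof
  assume "rat_two_level e x c d p q"
  then obtain t where t: "c < t" "t < d"
    and p: "\<And>s. s \<in> \<rat> \<Longrightarrow> c \<le> s \<Longrightarrow> s < t \<Longrightarrow> dist (x s) p \<le> e"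
    and q: "\<And>s. s \<in> \<rat> \<Longrightarrow> t < s \<Longrightarrow> s < d \<Longrightarrow> dist (x s) q \<le> e"
    unfolding rat_two_level_def by metis
  obtain a where a: "a \<in> \<rat>" "c < a" "a < t" using Rats_dense_in_real[OF t(1)] by auto
  obtain b where b: "b \<in> \<rat>" "t < b" "b < d" using Rats_dense_in_real[OF t(2)] by auto
  show ?R
  proof (rule bexI[OF _ a(1)], rule bexI[OF _ b(1)], intro conjI ballI impI)
    show "dist (x s) p \<le> e" if "s \<in> \<rat>" "c \<le> s \<and> s \<le> a" for s
      using that a by (intro p) auto
    show "dist (x s) q \<le> e" if "s \<in> \<rat>" "c \<le> s \<and> b \<le> s \<and> s < d" for s
      using that b by (intro q) auto
    show "dist (x r) p \<le> e \<or> dist (x s) q \<le> e" if "r \<in> \<rat>" "s \<in> \<rat>" "c \<le> r \<and> r < s \<and> s < d" for r s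
    proof (cases "r < t")
      case True
      then show ?thesis using that by (intro disjI1 p) auto
    next
      case False
      then show ?thesis using that by (intro disjI2 q) auto
    qed
  qed (use a b in auto)
next
  assume ?R
  then obtain a b where ab: "c < a" "a < b" "b < d"
    and p: "\<And>s. s \<in> \<rat> \<Longrightarrow> c \<le> s \<Longrightarrow> s \<le> a \<Longrightarrow> dist (x s) p \<le> e"
    and q: "\<And>s. s \<in> \<rat> \<Longrightarrow> c \<le> s \<Longrightarrow> b \<le> s \<Longrightarrow> s < d \<Longrightarrow> dist (x s) q \<le> e"
    and pq: "\<And>r s. r \<in> \<rat> \<Longrightarrow> s \<in> \<rat> \<Longrightarrow> c \<le> r \<Longrightarrow> r < s \<Longrightarrow> s < d \<Longrightarrow> dist (x r) p \<le> e \<or> dist (x s) q \<le> e"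
    by blast
  \<comment> \<open>Inserting \<open>b\<close> covers the case that the function stays near \<open>p\<close> throughout.\<close>
  define S where "S = insert b {r \<in> \<rat>. c \<le> r \<and> r < d \<and> \<not> dist (x r) p \<le> e}"
  define t where "t = Inf S"
  have lower: "a \<le> u" if "u \<in> S" for u
  proof (rule ccontr)
    assume "\<not> a \<le> u"
    then show False using that p[of u] ab by (auto simp: S_def)
  qed
  then have bdd: "bdd_below S" by (rule bdd_belowI)
  have t: "a \<le> t" "t \<le> b"
    unfolding t_def using lower bdd by (auto intro!: cInf_greatest cInf_lower simp: S_def)
  show "rat_two_level e x c d p q"
    unfolding rat_two_level_def
  proof (intro exI[of _ t] conjI ballI impI)
    show "dist (x s) p \<le> e" if "s \<in> \<rat>" "c \<le> s \<and> s < t" for s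
    proof (rule ccontr)
      assume "\<not> dist (x s) p \<le> e"
      then have "s \<in> S" using that t ab by (simp add: S_def)
      then have "t \<le> s" unfolding t_def using bdd by (rule cInf_lower)
      then show False using that by simp
    qed
    show "dist (x s) q \<le> e" if s: "s \<in> \<rat>" "t < s \<and> s < d" for s
    proof -
      have "S \<noteq> {}" by (simp add: S_def)
      moreover have "Inf S < s" using s by (simp add: t_def)
      ultimately obtain u where u: "u \<in> S" "u < s" by (rule cInf_lessD[THEN bexE])
      then show ?thesis
        using q[of s] pq[of u s] s ab by (auto simp: S_def)
    qed
  qed (use t ab in auto)
qed

lemma dist_le_limit:
  assumes "(f \<longlongrightarrow> l) F" "F \<noteq> bot" "\<forall>\<^sub>F s in F. dist (f s) p \<le> (e::real)"
  shows "dist l p \<le> e"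
  by (rule tendsto_upperbound[OF tendsto_dist[OF assms(1) tendsto_const] assms(3,2)])

lemma rat_right_nontrivial:
  "at t within {t<..} \<inter> \<rat> \<noteq> bot" for t :: real
proof -
  have "t islimpt {t<..} \<inter> \<rat>"
    unfolding islimpt_approachable
  proof (intro allI impI)
    fix e :: real assume "0 < e"
    then obtain r where "r \<in> \<rat>" "t < r" "r < t + e" using Rats_dense_in_real[of t "t + e"] by auto
    then show "\<exists>x'\<in>{t<..} \<inter> \<rat>. x' \<noteq> t \<and> dist x' t < e"
      by (intro bexI[of _ r]) (auto simp: dist_real_def)
  qed
  then show ?thesis by (simp add: trivial_limit_within)
qed

text \<open>Right-continuity transfers a closed condition from the rational times immediately after \<open>s\<close> to \<open>s\<close>.\<close>

lemma path_rat_bound: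
  assumes x: "x \<in> paths" and s: "0 \<le> s" "s < b"
    and le: "\<And>r. r \<in> \<rat> \<Longrightarrow> s < r \<Longrightarrow> r < b \<Longrightarrow> dist (x r) p \<le> e"
  shows "dist (x s) p \<le> e"
proof (rule dist_le_limit[OF _ rat_right_nontrivial])
  have "(x \<longlongrightarrow> x s) (at_right s)" using x s by (simp add: paths_def)
  then show "(x \<longlongrightarrow> x s) (at s within {s<..} \<inter> \<rat>)"
    by (rule tendsto_within_subset) simp
  show "\<forall>\<^sub>F r in at s within {s<..} \<inter> \<rat>. dist (x r) p \<le> e"
    unfolding eventually_at using s le
    by (intro exI[of _ "b - s"]) (auto simp: dist_real_def)
qed

lemma rat_two_level_imp_two_level:
  assumes x: "x \<in> paths" and c: "0 \<le> c" and r: "rat_two_level e x c d p q"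
  shows "\<exists>t. two_level e x c d p q t"
proof -
  obtain t where t: "c < t" "t < d"
    and p: "\<And>s. s \<in> \<rat> \<Longrightarrow> c \<le> s \<Longrightarrow> s < t \<Longrightarrow> dist (x s) p \<le> e"
    and q: "\<And>s. s \<in> \<rat> \<Longrightarrow> t < s \<Longrightarrow> s < d \<Longrightarrow> dist (x s) q \<le> e"
    using r unfolding rat_two_level_def by metis
  have "dist (x s) p \<le> e" if "c \<le> s" "s < t" for s
    by (rule path_rat_bound[OF x, of s t]) (use that c p in auto)
  moreover have "dist (x s) q \<le> e" if "t \<le> s" "s < d" for s
    by (rule path_rat_bound[OF x, of s d]) (use that c t q in auto)
  ultimately show ?thesis using t by (intro exI[of _ t]) (simp add: two_level_def)
qed

lemma two_level_imp_rat: "two_level e x c d p q t \<Longrightarrow> rat_two_level e x c d p q"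
  unfolding two_level_def rat_two_level_def by (intro exI[of _ t]) simp

lemma pred_ball_Rats:
  assumes "\<And>s::real. s \<in> \<rat> \<Longrightarrow> Measurable.pred M (P s)"
  shows "Measurable.pred M (\<lambda>a. \<forall>s\<in>\<rat>. P s a)"
proof -
  have "Measurable.pred M (\<lambda>a. \<forall>r::rat. P (of_rat r) a)"
    using assms by (intro pred_intros_countable) simp
  then show ?thesis by (simp add: Rats_def)
qed

lemma pred_bex_Rats:
  assumes "\<And>s::real. s \<in> \<rat> \<Longrightarrow> Measurable.pred M (P s)"
  shows "Measurable.pred M (\<lambda>a. \<exists>s\<in>\<rat>. P s a)"
proof -
  have "Measurable.pred M (\<lambda>a. \<exists>r::rat. P (of_rat r) a)"
    using assms by (intro pred_intros_countable) simp
  then show ?thesis by (simp add: Rats_def)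
qed

lemma rat_two_level_measurable:
  fixes X :: "'a \<Rightarrow> real \<Rightarrow> 'e::polish_space"
  assumes X: "\<And>s. s \<in> \<rat> \<Longrightarrow> 0 \<le> s \<Longrightarrow> (\<lambda>a. X a s) \<in> borel_measurable M" and c: "0 \<le> c"
  shows "Measurable.pred M (\<lambda>a. rat_two_level e (X a) c d p q)"
proof -
  have D: "Measurable.pred M (\<lambda>a. dist (X a s) z \<le> e)" if "s \<in> \<rat>" "0 \<le> s" for s z
    using X[OF that] by measurable
  have imp: "Measurable.pred M (\<lambda>a. b \<longrightarrow> Q a)" if "b \<Longrightarrow> Measurable.pred M Q" for b Q
    using that by (cases b) simp_all
  have conj: "Measurable.pred M (\<lambda>a. P a \<and> Q a)" if "Measurable.pred M P" "Measurable.pred M Q" for P Q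
    using that by measurable
  have disj: "Measurable.pred M (\<lambda>a. P a \<or> Q a)" if "Measurable.pred M P" "Measurable.pred M Q" for P Q
    using that by measurable
  have const: "Measurable.pred M (\<lambda>a. b)" for b by simp
  show ?thesis
    unfolding rat_two_level_countable
    by (intro pred_bex_Rats conj const[of "_ < _"] pred_ball_Rats imp disj D) (use c in auto)
qed

definition cell_lo :: "nat \<Rightarrow> nat \<Rightarrow> real" where
  "cell_lo m i = real i / real m"

text \<open>The time interval \<open>[0, n]\<close> is divided into \<open>n * m\<close> cells, and \<open>ws\<close> lists, as indices into \<open>dd\<close>, the two levels
in each cell. For a dense sequence \<open>dd\<close> there are only countably many such patterns.\<close>

definition grid_cond :: "(nat \<Rightarrow> 'e::metric_space) \<Rightarrow> nat \<Rightarrow> nat \<Rightarrow> (nat \<times> nat) list \<Rightarrow> (real \<Rightarrow> 'e) \<Rightarrow> bool" where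
  "grid_cond dd n m ws x \<longleftrightarrow> (\<forall>i<n * m.
     rat_two_level (1 / real n) x (cell_lo m i) (cell_lo m (Suc i)) (dd (fst (ws ! i))) (dd (snd (ws ! i))))"

lemma cell_lo_less: "0 < m \<Longrightarrow> cell_lo m i < cell_lo m (Suc i)"
  by (simp add: cell_lo_def divide_strict_right_mono)

lemma cell_lo_nonneg [simp]: "0 \<le> cell_lo m i"
  by (simp add: cell_lo_def)

lemma cell_lo_Suc: "0 < m \<Longrightarrow> cell_lo m (Suc i) = cell_lo m i + 1 / real m"
  by (simp add: cell_lo_def add_divide_distrib)

lemma cell_lo_mono: "i \<le> j \<Longrightarrow> cell_lo m i \<le> cell_lo m j"
  by (simp add: cell_lo_def divide_right_mono)

definition cell_idx :: "nat \<Rightarrow> real \<Rightarrow> nat" where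
  "cell_idx m s = nat \<lfloor>s * real m\<rfloor>"

lemma cell_idx_iff:
  assumes "0 < m" "0 \<le> s"
  shows "cell_idx m s = i \<longleftrightarrow> cell_lo m i \<le> s \<and> s < cell_lo m (Suc i)"
proof -
  have "0 \<le> s * real m" using assms by simp
  then have "cell_idx m s = i \<longleftrightarrow> \<lfloor>s * real m\<rfloor> = int i"
    unfolding cell_idx_def by (metis int_nat_eq nat_int zero_le_floor)
  also have "\<dots> \<longleftrightarrow> real i \<le> s * real m \<and> s * real m < real i + 1"
    by (simp add: floor_eq_iff)
  finally show ?thesis using assms by (simp add: cell_lo_def field_simps)
qed

text \<open>The left limit and the right-continuity at \<open>t\<close>, with the limits replaced by nearby points of the
dense sequence.\<close>

lemma path_local_levels:
  fixes x :: "'e::polish_space path"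
  assumes x: "x \<in> paths" and dd: "\<And>z r. 0 < r \<Longrightarrow> \<exists>n::nat. dist z (dd n) < r" and e: "0 < e" and t: "0 \<le> t"
  shows "\<exists>\<delta>>0. \<exists>p q. (\<forall>s. 0 \<le> s \<and> t - \<delta> < s \<and> s < t \<longrightarrow> dist (x s) (dd p) \<le> e) \<and>
    (\<forall>s. t \<le> s \<and> s < t + \<delta> \<longrightarrow> dist (x s) (dd q) \<le> e)"
proof -
  have e2: "0 < e / 2" using e by simp
  obtain q where q: "dist (x t) (dd q) < e / 2" using dd[OF e2] by metis
  have "(x \<longlongrightarrow> x t) (at_right t)" using x t by (simp add: paths_def)
  from tendstoD[OF this e2] obtain b where b: "t < b" "\<And>s. t < s \<Longrightarrow> s < b \<Longrightarrow> dist (x s) (x t) < e / 2"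
    unfolding eventually_at_right_field by metis
  have right: "dist (x s) (dd q) \<le> e" if "t \<le> s" "s < b" for s
  proof -
    have "dist (x s) (x t) < e / 2" using b that e by (cases "s = t") auto
    then show ?thesis using q dist_triangle[of "x s" "dd q" "x t"] by linarith
  qed
  have "\<exists>\<delta>>0. \<exists>p. \<forall>s. 0 \<le> s \<and> t - \<delta> < s \<and> s < t \<longrightarrow> dist (x s) (dd p) \<le> e"
  proof (cases "t = 0")
    case True
    then show ?thesis by (intro exI[of _ 1]) auto
  next
    case False
    then have "0 < t" using t by simp
    then obtain l where l: "(x \<longlongrightarrow> l) (at_left t)" using x unfolding paths_def by blast
    obtain p where p: "dist l (dd p) < e / 2" using dd[OF e2] by metis
    from tendstoD[OF l e2] obtain a where a: "a < t" "\<And>s. a < s \<Longrightarrow> s < t \<Longrightarrow> dist (x s) l < e / 2"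
      unfolding eventually_at_left_field by metis
    have "dist (x s) (dd p) \<le> e" if "a < s" "s < t" for s
      using a(2)[OF that] p dist_triangle[of "x s" "dd p" l] by linarith
    then show ?thesis using a(1) by (intro exI[of _ "t - a"] conjI exI[of _ p]) auto
  qed
  then obtain \<delta> p where \<delta>: "0 < \<delta>" "\<And>s. 0 \<le> s \<Longrightarrow> t - \<delta> < s \<Longrightarrow> s < t \<Longrightarrow> dist (x s) (dd p) \<le> e"
    by metis
  show ?thesis
    using \<delta> right b(1) by (intro exI[of _ "min \<delta> (b - t)"] conjI exI[of _ p] exI[of _ q]) auto
qed

text \<open>By compactness of \<open>[0, n]\<close>, a sufficiently short cell is contained in one of the neighbourhoods of
\<open>path_local_levels\<close>. If the centre of the neighbourhood is inside the cell, it is the switching time;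
otherwise a single level suffices.\<close>

lemma path_grid_cond:
  fixes x :: "'e::polish_space path"
  assumes x: "x \<in> paths" and dd: "\<And>z r. 0 < r \<Longrightarrow> \<exists>n::nat. dist z (dd n) < r" and n: "0 < n"
  shows "\<exists>m\<ge>n. \<exists>ws. grid_cond dd n m ws x"
proof -
  define e where "e = 1 / real n"
  have e: "0 < e" using n by (simp add: e_def)
  define levels where "levels t \<delta> p q \<longleftrightarrow>
    (\<forall>s. 0 \<le> s \<and> t - \<delta> < s \<and> s < t \<longrightarrow> dist (x s) (dd p) \<le> e) \<and>
    (\<forall>s. t \<le> s \<and> s < t + \<delta> \<longrightarrow> dist (x s) (dd q) \<le> e)" for t \<delta> p q
  have "\<forall>t\<in>{0..real n}. \<exists>\<delta>. \<delta> > 0 \<and> (\<exists>p q. levels t \<delta> p q)"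
    using path_local_levels[OF x dd e] by (simp add: levels_def)
  from bchoice[OF this] obtain \<delta> where
    \<delta>: "\<forall>t\<in>{0..real n}. \<delta> t > 0 \<and> (\<exists>p q. levels t (\<delta> t) p q)" ..
  have "\<exists>e0>0. \<forall>z\<in>{0..real n}. \<exists>G\<in>(\<lambda>t. ball t (\<delta> t)) ` {0..real n}. ball z e0 \<subseteq> G"
  proof (rule Heine_Borel_lemma[OF compact_Icc])
    show "{0..real n} \<subseteq> \<Union> ((\<lambda>t. ball t (\<delta> t)) ` {0..real n})"
    proof
      fix t assume "t \<in> {0..real n}"
      then show "t \<in> \<Union> ((\<lambda>t. ball t (\<delta> t)) ` {0..real n})"
        using \<delta> by (intro UN_I[of t]) auto
    qed
  qed auto
  then obtain e0 where e0: "e0 > 0" "\<forall>z\<in>{0..real n}. \<exists>t\<in>{0..real n}. ball z e0 \<subseteq> ball t (\<delta> t)"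
    by auto
  obtain m0 :: nat where m0: "1 / e0 < real m0" using reals_Archimedean2 by blast
  define m where "m = max m0 n"
  have m: "0 < m" "n \<le> m" "1 / real m < e0"
  proof -
    show "0 < m" "n \<le> m" using n by (auto simp: m_def)
    have "1 / e0 < real m" using m0 by (simp add: m_def)
    then show "1 / real m < e0" using e0(1) \<open>0 < m\<close> by (simp add: field_simps)
  qed
  have cell: "\<exists>p q t. two_level e x (cell_lo m i) (cell_lo m (Suc i)) (dd p) (dd q) t" if i: "i < n * m" for i
  proof -
    define c d where "c = cell_lo m i" and "d = cell_lo m (Suc i)"
    have cd: "c < d" "0 \<le> c" "d < c + e0"
      using cell_lo_less[OF m(1), of i] cell_lo_Suc[OF m(1), of i] m(3) by (simp_all add: c_def d_def)
    have "c \<le> real n"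
    proof -
      have "real i \<le> real n * real m" using i by (metis less_imp_le of_nat_le_iff of_nat_mult)
      then show ?thesis using m(1) by (simp add: c_def cell_lo_def field_simps)
    qed
    then obtain t where t: "t \<in> {0..real n}" "ball c e0 \<subseteq> ball t (\<delta> t)"
      using e0(2) cd(2) by (metis atLeastAtMost_iff)
    obtain p q where "levels t (\<delta> t) p q" using \<delta> t(1) by metis
    then have p: "\<And>s. 0 \<le> s \<Longrightarrow> t - \<delta> t < s \<Longrightarrow> s < t \<Longrightarrow> dist (x s) (dd p) \<le> e"
      and q: "\<And>s. t \<le> s \<Longrightarrow> s < t + \<delta> t \<Longrightarrow> dist (x s) (dd q) \<le> e"
      by (simp_all add: levels_def)
    have near: "t - \<delta> t < s \<and> s < t + \<delta> t" if "c \<le> s" "s < d" for s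
    proof -
      have "s \<in> ball c e0" using that cd by (simp add: dist_real_def)
      then have "s \<in> ball t (\<delta> t)" using t(2) by blast
      then show ?thesis by (auto simp: dist_real_def)
    qed
    have P: "dist (x s) (dd p) \<le> e" if "c \<le> s" "s < d" "s < t" for s
      using near[OF that(1,2)] cd that by (intro p) auto
    have Q: "dist (x s) (dd q) \<le> e" if "c \<le> s" "s < d" "t \<le> s" for s
      using near[OF that(1,2)] that by (intro q) auto
    consider "c < t" "t < d" | "t \<le> c" | "d \<le> t" by linarith
    then show ?thesis
    proof cases
      case 1
      then show ?thesis
        unfolding c_def[symmetric] d_def[symmetric] two_level_def
        using P Q by (intro exI[of _ p] exI[of _ q] exI[of _ t]) auto
    next
      case 2
      then show ?thesis
        unfolding c_def[symmetric] d_def[symmetric] two_level_def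
        using Q cd by (intro exI[of _ q] exI[of _ "(c + d) / 2"]) auto
    next
      case 3
      then show ?thesis
        unfolding c_def[symmetric] d_def[symmetric] two_level_def
        using P cd by (intro exI[of _ p] exI[of _ "(c + d) / 2"]) auto
    qed
  qed
  have "\<forall>i\<in>{..<n * m}. \<exists>w. rat_two_level e x (cell_lo m i) (cell_lo m (Suc i)) (dd (fst w)) (dd (snd w))"
  proof
    fix i assume "i \<in> {..<n * m}"
    then obtain p q t where "two_level e x (cell_lo m i) (cell_lo m (Suc i)) (dd p) (dd q) t"
      using cell by (metis lessThan_iff)
    then show "\<exists>w. rat_two_level e x (cell_lo m i) (cell_lo m (Suc i)) (dd (fst w)) (dd (snd w))"
      by (intro exI[of _ "(p, q)"]) (simp add: two_level_imp_rat)
  qed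
  from bchoice[OF this] obtain w where
    w: "\<forall>i\<in>{..<n * m}. rat_two_level e x (cell_lo m i) (cell_lo m (Suc i)) (dd (fst (w i))) (dd (snd (w i)))" ..
  have "grid_cond dd n m (map w [0..<n * m]) x"
    unfolding grid_cond_def e_def[symmetric]
  proof (intro allI impI)
    fix i assume "i < n * m"
    then show "rat_two_level e x (cell_lo m i) (cell_lo m (Suc i))
        (dd (fst (map w [0..<n * m] ! i))) (dd (snd (map w [0..<n * m] ! i)))"
      using w by simp
  qed
  then show ?thesis using m(2) by (intro exI[of _ m] conjI exI[of _ "map w [0..<n * m]"])
qed

section \<open>A measurable network for the Skorokhod topology\<close>

text \<open>The piecewise linear bijection of \<open>[c, d)\<close> that sends \<open>a\<close> to \<open>b\<close>.\<close>

definition cell_map :: "real \<Rightarrow> real \<Rightarrow> real \<Rightarrow> real \<Rightarrow> real \<Rightarrow> real" where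
  "cell_map c d a b s = (if s < a then c + (s - c) * ((b - c) / (a - c)) else b + (s - a) * ((d - b) / (d - a)))"

context
  fixes c d a b :: real
  assumes ab: "c < a" "a < d" "c < b" "b < d"
begin

lemma cell_map_less_iff:
  assumes "c \<le> s" "s < d"
  shows "cell_map c d a b s < b \<longleftrightarrow> s < a"
proof -
  have "(s - c) * ((b - c) / (a - c)) < b - c" if "s < a"
    using mult_strict_right_mono[of "s - c" "a - c" "(b - c) / (a - c)"] that ab by simp
  moreover have "0 \<le> (s - a) * ((d - b) / (d - a))" if "\<not> s < a"
    using that ab by simp
  ultimately show ?thesis by (auto simp: cell_map_def) 
qed

lemma cell_map_mono:
  assumes "c \<le> s" "s < s'" "s' < d"
  shows "cell_map c d a b s < cell_map c d a b s'"
proof -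
  consider "s' < a" | "s < a" "\<not> s' < a" | "\<not> s < a" by linarith
  then show ?thesis
  proof cases
    case 1
    have "(s - c) * ((b - c) / (a - c)) < (s' - c) * ((b - c) / (a - c))"
      using assms ab by (intro mult_strict_right_mono) simp_all
    then show ?thesis using 1 assms by (simp add: cell_map_def)
  next
    case 2
    then show ?thesis
      using cell_map_less_iff[of s] cell_map_less_iff[of s'] assms by linarith
  next
    case 3
    have "(s - a) * ((d - b) / (d - a)) < (s' - a) * ((d - b) / (d - a))"
      using assms ab by (intro mult_strict_right_mono) simp_all
    then show ?thesis using 3 assms by (simp add: cell_map_def)
  qed
qed

lemma cell_map_range:
  assumes "c \<le> s" "s < d"
  shows "c \<le> cell_map c d a b s" "cell_map c d a b s < d"
proof -
  have "(s - a) * ((d - b) / (d - a)) < d - b"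
    using mult_strict_right_mono[of "s - a" "d - a" "(d - b) / (d - a)"] assms ab by simp
  then show "cell_map c d a b s < d"
    using cell_map_less_iff[OF assms] ab by (cases "s < a") (auto simp: cell_map_def)
  have "0 \<le> (s - c) * ((b - c) / (a - c))" using assms ab by simp
  then show "c \<le> cell_map c d a b s"
    using cell_map_less_iff[OF assms] ab by (cases "s < a") (auto simp: cell_map_def)
qed

lemma cell_map_inverse:
  assumes "c \<le> s" "s < d"
  shows "cell_map c d b a (cell_map c d a b s) = s"
proof (cases "s < a")
  case True
  then have "cell_map c d a b s < b" using cell_map_less_iff[OF assms] by simp
  then show ?thesis using True ab by (simp add: cell_map_def)
next
  case False
  then have "\<not> cell_map c d a b s < b" using cell_map_less_iff[OF assms] by simp
  then show ?thesis using False ab by (simp add: cell_map_def)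
qed

end

definition grid_map :: "nat \<Rightarrow> nat \<Rightarrow> (nat \<Rightarrow> real) \<Rightarrow> (nat \<Rightarrow> real) \<Rightarrow> real \<Rightarrow> real" where
  "grid_map m N u v s = (let i = cell_idx m s in
     if i < N then cell_map (cell_lo m i) (cell_lo m (Suc i)) (u i) (v i) s else s)"

text \<open>Each cell is mapped onto itself, and the inverse is obtained by exchanging the two lists of switching times.\<close>

lemma grid_map_cell:
  assumes m: "0 < m"
    and u: "\<And>i. i < N \<Longrightarrow> cell_lo m i < u i \<and> u i < cell_lo m (Suc i)"
    and v: "\<And>i. i < N \<Longrightarrow> cell_lo m i < v i \<and> v i < cell_lo m (Suc i)"
    and s: "0 \<le> s"
  shows "0 \<le> grid_map m N u v s" "cell_idx m (grid_map m N u v s) = cell_idx m s"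
    "grid_map m N v u (grid_map m N u v s) = s"
proof -
  define i where "i = cell_idx m s"
  have i: "cell_lo m i \<le> s" "s < cell_lo m (Suc i)"
    using cell_idx_iff[OF m s, of i] by (simp_all add: i_def)
  have r: "cell_lo m i \<le> grid_map m N u v s \<and> grid_map m N u v s < cell_lo m (Suc i)"
  proof (cases "i < N")
    case True
    then show ?thesis
      using cell_map_range[of "cell_lo m i" "u i" "cell_lo m (Suc i)" "v i" s] u[OF True] v[OF True] i
      by (simp add: grid_map_def Let_def i_def)
  next
    case False
    then show ?thesis using i by (simp add: grid_map_def Let_def i_def)
  qed
  then show nn: "0 \<le> grid_map m N u v s" using cell_lo_nonneg[of m i] by linarith
  show idx: "cell_idx m (grid_map m N u v s) = cell_idx m s"
    using cell_idx_iff[OF m nn, of i] r by (simp add: i_def)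
  show "grid_map m N v u (grid_map m N u v s) = s"
  proof (cases "i < N")
    case True
    have "grid_map m N v u (grid_map m N u v s) =
        cell_map (cell_lo m i) (cell_lo m (Suc i)) (v i) (u i) (grid_map m N u v s)"
      using True idx by (simp add: grid_map_def[of m N v u] Let_def i_def)
    moreover have "grid_map m N u v s = cell_map (cell_lo m i) (cell_lo m (Suc i)) (u i) (v i) s"
      using True by (simp add: grid_map_def Let_def i_def)
    ultimately show ?thesis
      using cell_map_inverse[of "cell_lo m i" "u i" "cell_lo m (Suc i)" "v i" s] u[OF True] v[OF True] i
      by simp
  next
    case False
    then show ?thesis by (simp add: grid_map_def Let_def i_def)
  qed
qed

lemma grid_map_time_change:
  assumes m: "0 < m"
    and u: "\<And>i. i < N \<Longrightarrow> cell_lo m i < u i \<and> u i < cell_lo m (Suc i)"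
    and v: "\<And>i. i < N \<Longrightarrow> cell_lo m i < v i \<and> v i < cell_lo m (Suc i)"
  shows "grid_map m N u v \<in> time_changes"
  unfolding time_changes_def
proof (intro CollectI conjI)
  have G: "0 \<le> grid_map m N u v s" "cell_idx m (grid_map m N u v s) = cell_idx m s" if "0 \<le> s" for s
    by (rule grid_map_cell[OF m u v that]; assumption)+
  have G': "0 \<le> grid_map m N v u s" "grid_map m N u v (grid_map m N v u s) = s" if "0 \<le> s" for s
    by (rule grid_map_cell[OF m v u that]; assumption)+
  show "strict_mono_on {0..} (grid_map m N u v)"
  proof (rule strict_mono_onI)
    fix r s :: real assume rs: "r \<in> {0..}" "s \<in> {0..}" "r < s"
    define i j where "i = cell_idx m r" and "j = cell_idx m s"
    have i: "cell_lo m i \<le> r" "r < cell_lo m (Suc i)" and j: "cell_lo m j \<le> s" "s < cell_lo m (Suc j)"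
      using cell_idx_iff[OF m, where s = r and i = i] cell_idx_iff[OF m, where s = s and i = j] rs by (simp_all add: i_def j_def)
    have gi: "grid_map m N u v r < cell_lo m (Suc i)" and gj: "cell_lo m j \<le> grid_map m N u v s"
      using cell_idx_iff[OF m, where s = "grid_map m N u v r" and i = i] cell_idx_iff[OF m, where s = "grid_map m N u v s" and i = j]
        G[of r] G[of s] rs by (simp_all add: i_def j_def)
    consider "i = j" | "Suc i \<le> j" | "Suc j \<le> i" by linarith
    then show "grid_map m N u v r < grid_map m N u v s"
    proof cases
      case 1
      show ?thesis
      proof (cases "i < N")
        case True
        then show ?thesis
          using cell_map_mono[of "cell_lo m i" "u i" "cell_lo m (Suc i)" "v i" r s] u[OF True] v[OF True] i j rs 1
          by (simp add: grid_map_def Let_def i_def j_def)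
      next
        case False
        then show ?thesis using 1 rs by (simp add: grid_map_def Let_def i_def j_def)
      qed
    next
      case 2
      then show ?thesis using cell_lo_mono[OF 2, of m] gi gj by linarith
    next
      case 3
      then show ?thesis using cell_lo_mono[OF 3, of m] i j rs by linarith
    qed
  qed
  show "grid_map m N u v ` {0..} = {0..}"
  proof
    show "grid_map m N u v ` {0..} \<subseteq> {0..}" using G(1) by auto
    show "{0..} \<subseteq> grid_map m N u v ` {0..}"
    proof
      fix s :: real assume "s \<in> {0..}"
      then have "s = grid_map m N u v (grid_map m N v u s)" "grid_map m N v u s \<in> {0..}"
        using G' by auto
      then show "s \<in> grid_map m N u v ` {0..}" by (rule image_eqI)
    qed
  qed
qed

definition grid_set :: "(nat \<Rightarrow> 'e::polish_space) \<Rightarrow> nat \<Rightarrow> nat \<Rightarrow> (nat \<times> nat) list \<Rightarrow> 'e path set" where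
  "grid_set dd n m ws = {x \<in> paths. grid_cond dd n m ws x}"

lemma path_coord_measurable:
  assumes "0 \<le> t"
  shows "(\<lambda>x. x t) \<in> measurable path_space (borel :: 'e::polish_space measure)"
  unfolding path_space_def
  by (intro measurable_restrict_space1 measurable_component_singleton) (use assms in simp)

lemma grid_cond_measurable:
  fixes X :: "'a \<Rightarrow> real \<Rightarrow> 'e::polish_space"
  assumes X: "\<And>s. s \<in> \<rat> \<Longrightarrow> 0 \<le> s \<Longrightarrow> (\<lambda>a. X a s) \<in> borel_measurable M"
  shows "Measurable.pred M (\<lambda>a. grid_cond dd n m ws (X a))"
proof -
  have "Measurable.pred M (\<lambda>a. i < n * m \<longrightarrow>
     rat_two_level (1 / real n) (X a) (cell_lo m i) (cell_lo m (Suc i)) (dd (fst (ws ! i))) (dd (snd (ws ! i))))" for i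
    using rat_two_level_measurable[OF X cell_lo_nonneg] by (cases "i < n * m") simp_all
  then show ?thesis unfolding grid_cond_def by (rule pred_intros_countable)
qed

lemma grid_set_measurable: "grid_set dd n m ws \<in> sets path_space"
proof -
  have "Measurable.pred path_space (\<lambda>x. grid_cond dd n m ws x)"
    by (rule grid_cond_measurable) (rule path_coord_measurable)
  then show ?thesis by (simp add: pred_def grid_set_def space_path_space)
qed

text \<open>The time change that moves the switching times of \<open>y\<close> to those of \<open>x\<close> inside each cell displaces
times by at most one cell length, and afterwards both paths are within \<open>1/n\<close> of the same level.\<close>

lemma grid_set_subset_nbhd:
  assumes m: "n \<le> m" "0 < n" and x: "x \<in> grid_set dd n m ws" and y: "y \<in> grid_set dd n m ws"
    and T: "T < real n" and e: "2 / real n < e"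
  shows "y \<in> skorokhod_nbhd x T e"
proof -
  have m0: "0 < m" using m by simp
  define switch where "switch z i = two_level (1 / real n) z (cell_lo m i) (cell_lo m (Suc i))
      (dd (fst (ws ! i))) (dd (snd (ws ! i)))" for z i
  have ex: "\<forall>i\<in>{..<n * m}. \<exists>t. switch z i t" if "z \<in> grid_set dd n m ws" for z
  proof
    fix i assume "i \<in> {..<n * m}"
    then show "\<exists>t. switch z i t"
      unfolding switch_def using that by (intro rat_two_level_imp_two_level cell_lo_nonneg) (simp_all add: grid_set_def grid_cond_def)
  qed
  from bchoice[OF ex[OF x]] obtain v where v: "\<forall>i\<in>{..<n * m}. switch x i (v i)" ..
  from bchoice[OF ex[OF y]] obtain u where u: "\<forall>i\<in>{..<n * m}. switch y i (u i)" ..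
  have u': "cell_lo m i < u i \<and> u i < cell_lo m (Suc i)" if "i < n * m" for i
    using u that by (simp add: switch_def two_level_def)
  have v': "cell_lo m i < v i \<and> v i < cell_lo m (Suc i)" if "i < n * m" for i
    using v that by (simp add: switch_def two_level_def)
  define l where "l = grid_map m (n * m) u v"
  have l: "l \<in> time_changes" unfolding l_def by (rule grid_map_time_change[OF m0 u' v'])
  have "\<bar>l t - t\<bar> < e \<and> dist (y t) (x (l t)) < e" if t: "t \<in> {0..T}" for t
  proof -
    define i where "i = cell_idx m t"
    have t0: "0 \<le> t" using t by simp
    have i: "cell_lo m i \<le> t" "t < cell_lo m (Suc i)"
      using cell_idx_iff[OF m0 t0, of i] by (simp_all add: i_def)
    have "real i < real n * real m"
    proof -
      have "cell_lo m i < real n" using i t T by simp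
      then show ?thesis using m0 by (simp add: cell_lo_def field_simps)
    qed
    then have iN: "i < n * m" by (metis of_nat_less_iff of_nat_mult)
    have lt: "l t = cell_map (cell_lo m i) (cell_lo m (Suc i)) (u i) (v i) t"
      using iN by (simp add: l_def grid_map_def Let_def i_def)
    have lr: "cell_lo m i \<le> l t" "l t < cell_lo m (Suc i)" "l t < v i \<longleftrightarrow> t < u i"
      unfolding lt using u'[OF iN] v'[OF iN] i
      by (simp_all add: cell_map_range cell_map_less_iff)
    have nm: "1 / real m \<le> 1 / real n" using m by (simp add: frac_le)
    have half: "1 / real n + 1 / real n < e" using e by simp
    have "\<bar>l t - t\<bar> < 1 / real m"
      using lr i cell_lo_Suc[OF m0, of i] by linarith
    moreover have "0 < 1 / real n" using m by simp
    ultimately have "\<bar>l t - t\<bar> < e" using nm half by linarith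
    moreover have "dist (y t) (x (l t)) < e"
    proof (cases "t < u i")
      case True
      have "dist (y t) (dd (fst (ws ! i))) \<le> 1 / real n" "dist (x (l t)) (dd (fst (ws ! i))) \<le> 1 / real n"
        using u v iN True lr i by (simp_all add: switch_def two_level_def)
      then show ?thesis using half dist_triangle2[of "y t" "x (l t)" "dd (fst (ws ! i))"] by linarith
    next
      case False
      have "dist (y t) (dd (snd (ws ! i))) \<le> 1 / real n" "dist (x (l t)) (dd (snd (ws ! i))) \<le> 1 / real n"
        using u v iN False lr i by (simp_all add: switch_def two_level_def)
      then show ?thesis using half dist_triangle2[of "y t" "x (l t)" "dd (snd (ws ! i))"] by linarith
    qed
    ultimately show ?thesis by simp
  qed
  then show ?thesis
    unfolding skorokhod_nbhd_def using y l
    by (intro CollectI conjI bexI[of _ l] ballI) (simp_all add: grid_set_def)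
qed

text \<open>A network rather than a base: the members need not be open. This is enough to write every
open set as a countable union of members.\<close>

lemma skorokhod_measurable_network:
  "\<exists>\<N> :: 'e::polish_space path set set. countable \<N> \<and> \<N> \<subseteq> sets path_space \<and>
     (\<forall>U x. skorokhod_open U \<longrightarrow> x \<in> U \<longrightarrow> (\<exists>A\<in>\<N>. x \<in> A \<and> A \<subseteq> U))"
proof -
  obtain dd :: "nat \<Rightarrow> 'e" where dd: "\<forall>x e. 0 < e \<longrightarrow> (\<exists>n. dist x (dd n) < e)"
    using dense_sequence_exists by metis
  define \<N> where "\<N> = range (\<lambda>(n, m, ws). grid_set dd n m ws)"
  have "countable \<N>" unfolding \<N>_def by simp
  moreover have "\<N> \<subseteq> sets path_space" unfolding \<N>_def using grid_set_measurable by auto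
  moreover have "\<exists>A\<in>\<N>. x \<in> A \<and> A \<subseteq> U" if U: "skorokhod_open U" and x: "x \<in> U" for U x
  proof -
    obtain T e where Te: "T > 0" "e > 0" "skorokhod_nbhd x T e \<subseteq> U"
      using U x unfolding skorokhod_open_def by metis
    \<comment> \<open>Two paths with the same pattern are within twice the error \<open>1/n\<close> of each other.\<close>
    obtain n :: nat where n: "max T (2 / e) < real n" using reals_Archimedean2 by blast
    have n0: "0 < n" "T < real n" "2 / real n < e"
    proof -
      have "0 < real n" using n Te by linarith
      then show "0 < n" "T < real n" using n by simp_all
      show "2 / real n < e" using n Te \<open>0 < real n\<close> by (simp add: field_simps)
    qed
    have xp: "x \<in> paths" using U x by (auto simp: skorokhod_open_def)
    have "\<exists>m\<ge>n. \<exists>ws. grid_cond dd n m ws x"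
      by (rule path_grid_cond[OF xp _ n0(1)]) (use dd in simp)
    then obtain m ws where m: "n \<le> m" "grid_cond dd n m ws x" by metis
    have xg: "x \<in> grid_set dd n m ws" using xp m by (simp add: grid_set_def)
    have "grid_set dd n m ws \<subseteq> U"
      using grid_set_subset_nbhd[OF m(1) n0(1) xg _ n0(2,3)] Te(3) by auto
    moreover have "grid_set dd n m ws \<in> \<N>" unfolding \<N>_def by (rule image_eqI[of _ _ "(n, m, ws)"]) auto
    ultimately show ?thesis using xg by blast
  qed
  ultimately show ?thesis by (intro exI[of _ \<N>]) simp
qed

section \<open>The path space as a retract of a sequence space\<close>

text \<open>A rational number strictly above \<open>t\<close>, at distance at most \<open>1/(k+1)\<close>, that takes only countably many values for
each \<open>k\<close>.\<close>

definition rat_above :: "nat \<Rightarrow> real \<Rightarrow> real" where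
  "rat_above k t = (of_int \<lfloor>real (Suc k) * t\<rfloor> + 1) / real (Suc k)"

lemma rat_above: "t < rat_above k t" "rat_above k t \<le> t + 1 / real (Suc k)" "rat_above k t \<in> \<rat>"
proof -
  have f: "real (Suc k) * t < of_int \<lfloor>real (Suc k) * t\<rfloor> + 1" "of_int \<lfloor>real (Suc k) * t\<rfloor> \<le> real (Suc k) * t"
    by linarith+
  show "t < rat_above k t" using f(1) by (simp add: rat_above_def pos_less_divide_eq mult.commute)
  have "rat_above k t \<le> (real (Suc k) * t + 1) / real (Suc k)"
    unfolding rat_above_def using f(2) by (intro divide_right_mono) simp_all
  also have "\<dots> = t + 1 / real (Suc k)" by (simp add: add_divide_distrib)
  finally show "rat_above k t \<le> t + 1 / real (Suc k)" .
  show "rat_above k t \<in> \<rat>" unfolding rat_above_def by simp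
qed

lemma rat_above_nonneg: "0 \<le> t \<Longrightarrow> 0 \<le> rat_above k t"
  using rat_above(1)[of t k] by simp

lemma rat_above_eventually:
  assumes "t < b"
  shows "\<forall>\<^sub>F k in sequentially. t < rat_above k t \<and> rat_above k t < b"
proof -
  have "(\<lambda>k. t + 1 / real (Suc k)) \<longlonglongrightarrow> t + 0"
    using LIMSEQ_inverse_real_of_nat by (intro tendsto_add tendsto_const) (simp add: inverse_eq_divide)
  then have "\<forall>\<^sub>F k in sequentially. t + 1 / real (Suc k) < b"
    using assms by (intro order_tendstoD(2)) simp_all
  then show ?thesis
  proof eventually_elim
    case (elim k)
    then show ?case using rat_above(1)[of t k] rat_above(2)[of k t] by simp
  qed
qed

lemma rat_above_filterlim: "filterlim (\<lambda>k. rat_above k t) (at_right t) sequentially"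
  unfolding filterlim_at_right_to_0 [abs_def] filterlim_iff
proof (intro allI impI)
  fix P :: "real \<Rightarrow> bool" assume "eventually P (at_right t)"
  then obtain b where "t < b" "\<And>s. t < s \<Longrightarrow> s < b \<Longrightarrow> P s"
    unfolding eventually_at_right_field by metis
  then show "\<forall>\<^sub>F k in sequentially. P (rat_above k t)"
    using rat_above_eventually[of t b] by (auto elim: eventually_mono)
qed

lemma path_limit_rat_above:
  assumes "x \<in> paths" "0 \<le> t"
  shows "(\<lambda>k. x (rat_above k t)) \<longlonglongrightarrow> x t"
proof -
  have "(x \<longlongrightarrow> x t) (at_right t)" using assms by (simp add: paths_def)
  then show ?thesis by (rule filterlim_compose) (rule rat_above_filterlim)
qed

text \<open>The Cauchy criterion for one-sided limits along the rational numbers.\<close>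

definition rat_regular :: "(real \<Rightarrow> 'e::metric_space) \<Rightarrow> bool" where
  "rat_regular x \<longleftrightarrow>
     (\<forall>t\<ge>0. \<forall>e>0. \<exists>b>t. \<exists>p. \<forall>s\<in>\<rat>. t < s \<and> s < b \<longrightarrow> dist (x s) p \<le> e) \<and>
     (\<forall>t>0. \<forall>e>0. \<exists>a\<ge>0. a < t \<and> (\<exists>p. \<forall>s\<in>\<rat>. a < s \<and> s < t \<longrightarrow> dist (x s) p \<le> e))"

lemma rat_two_level_cong:
  assumes "\<And>s. s \<in> \<rat> \<Longrightarrow> c \<le> s \<Longrightarrow> x s = y s"
  shows "rat_two_level e x c d p q \<longleftrightarrow> rat_two_level e y c d p q"
proof -
  have "rat_two_level e y c d p q"
    if "rat_two_level e x c d p q" "\<And>s. s \<in> \<rat> \<Longrightarrow> c \<le> s \<Longrightarrow> x s = y s" for x y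
    using that(1) unfolding rat_two_level_def
  proof (elim exE conjE, intro exI conjI)
    fix t assume "\<forall>s\<in>\<rat>. c \<le> s \<and> s < t \<longrightarrow> dist (x s) p \<le> e"
    then show "\<forall>s\<in>\<rat>. c \<le> s \<and> s < t \<longrightarrow> dist (y s) p \<le> e" using that(2) by simp
  next
    fix t assume "c < t" "\<forall>s\<in>\<rat>. t < s \<and> s < d \<longrightarrow> dist (x s) q \<le> e"
    then show "\<forall>s\<in>\<rat>. t < s \<and> s < d \<longrightarrow> dist (y s) q \<le> e" using that(2) by simp
  qed assumption
  from this[of x y] this[of y x] assms show ?thesis by metis
qed

text \<open>Whatever the position of \<open>t\<close> relative to the switching time, only one level is relevant immediately after \<open>t\<close>.\<close>

lemma rat_two_level_right:
  assumes "rat_two_level e x c d p q" "c \<le> t" "t < d"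
  shows "\<exists>b>t. \<exists>z. \<forall>s\<in>\<rat>. t < s \<and> s < b \<longrightarrow> dist (x s) z \<le> e"
proof -
  obtain r where r: "c < r" "r < d"
    and p: "\<And>s. s \<in> \<rat> \<Longrightarrow> c \<le> s \<Longrightarrow> s < r \<Longrightarrow> dist (x s) p \<le> e"
    and q: "\<And>s. s \<in> \<rat> \<Longrightarrow> r < s \<Longrightarrow> s < d \<Longrightarrow> dist (x s) q \<le> e"
    using assms(1) unfolding rat_two_level_def by metis
  show ?thesis
  proof (cases "t < r")
    case True
    then show ?thesis using p assms by (intro exI[of _ r] conjI exI[of _ p]) auto
  next
    case False
    then show ?thesis using q assms by (intro exI[of _ d] conjI exI[of _ q]) auto
  qed
qed

lemma rat_two_level_left:
  assumes "rat_two_level e x c d p q" "c < t" "t \<le> d" "0 \<le> c"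
  shows "\<exists>a\<ge>0. a < t \<and> (\<exists>z. \<forall>s\<in>\<rat>. a < s \<and> s < t \<longrightarrow> dist (x s) z \<le> e)"
proof -
  obtain r where r: "c < r" "r < d"
    and p: "\<And>s. s \<in> \<rat> \<Longrightarrow> c \<le> s \<Longrightarrow> s < r \<Longrightarrow> dist (x s) p \<le> e"
    and q: "\<And>s. s \<in> \<rat> \<Longrightarrow> r < s \<Longrightarrow> s < d \<Longrightarrow> dist (x s) q \<le> e"
    using assms(1) unfolding rat_two_level_def by metis
  show ?thesis
  proof (cases "r < t")
    case True
    then show ?thesis using q assms r by (intro exI[of _ r] conjI exI[of _ q]) auto
  next
    case False
    then show ?thesis using p assms by (intro exI[of _ c] conjI exI[of _ p]) auto
  qed
qed

lemma grid_cond_regular: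
  assumes g: "\<And>n. 0 < n \<Longrightarrow> \<exists>m\<ge>n. \<exists>ws. grid_cond dd n m ws x"
  shows "rat_regular x"
proof -
  have cell: "\<exists>m>0. \<forall>i. cell_lo m i \<le> t \<longrightarrow> (\<exists>p q. rat_two_level e x (cell_lo m i) (cell_lo m (Suc i)) p q)"
    if t: "0 \<le> t" and e: "0 < e" for t e
  proof -
    obtain n :: nat where n: "max t (1 / e) < real n" using reals_Archimedean2 by blast
    have n0: "0 < n" "t < real n" using n t by auto
    have ne: "1 / real n \<le> e" using n e n0 by (simp add: field_simps)
    obtain m ws where m: "n \<le> m" "grid_cond dd n m ws x" using g[OF n0(1)] by metis
    have m0: "0 < m" using m n0 by simp
    have "\<exists>p q. rat_two_level e x (cell_lo m i) (cell_lo m (Suc i)) p q" if i: "cell_lo m i \<le> t" for i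
    proof -
      have "cell_lo m i < real n" using i n0 by simp
      then have "real i < real n * real m" using m0 by (simp add: cell_lo_def field_simps)
      then have "i < n * m" by (metis of_nat_less_iff of_nat_mult)
      then have "rat_two_level (1 / real n) x (cell_lo m i) (cell_lo m (Suc i)) (dd (fst (ws ! i))) (dd (snd (ws ! i)))"
        using m(2) by (simp add: grid_cond_def)
      then have "rat_two_level e x (cell_lo m i) (cell_lo m (Suc i)) (dd (fst (ws ! i))) (dd (snd (ws ! i)))"
        unfolding rat_two_level_def using ne by (meson order_trans)
      then show ?thesis by metis
    qed
    then show ?thesis using m0 by metis
  qed
  show ?thesis
    unfolding rat_regular_def
  proof (intro conjI allI impI)
    fix t e :: real assume t: "0 \<le> t" and e: "0 < e"
    obtain m where m: "0 < m"
      "\<forall>i. cell_lo m i \<le> t \<longrightarrow> (\<exists>p q. rat_two_level e x (cell_lo m i) (cell_lo m (Suc i)) p q)"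
      using cell[OF t e] by metis
    define i where "i = cell_idx m t"
    have i: "cell_lo m i \<le> t" "t < cell_lo m (Suc i)"
      using cell_idx_iff[OF m(1) t, of i] by (simp_all add: i_def)
    then obtain p q where "rat_two_level e x (cell_lo m i) (cell_lo m (Suc i)) p q" using m(2) by metis
    then show "\<exists>b>t. \<exists>p. \<forall>s\<in>\<rat>. t < s \<and> s < b \<longrightarrow> dist (x s) p \<le> e"
      using i by (rule rat_two_level_right)
  next
    fix t e :: real assume t: "0 < t" and e: "0 < e"
    obtain m where m: "0 < m"
      "\<forall>i. cell_lo m i \<le> t \<longrightarrow> (\<exists>p q. rat_two_level e x (cell_lo m i) (cell_lo m (Suc i)) p q)"
      using cell[OF less_imp_le[OF t] e] by metis
    define i where "i = nat (\<lceil>t * real m\<rceil> - 1)"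
    have tm: "0 < t * real m" using t m by simp
    then have ri: "real i = of_int \<lceil>t * real m\<rceil> - 1" by (simp add: i_def of_nat_nat)
    have "real i < t * real m" "t * real m \<le> real i + 1" unfolding ri by linarith+
    then have i: "cell_lo m i < t" "t \<le> cell_lo m (Suc i)"
      using m(1) by (simp_all add: cell_lo_def field_simps)
    then obtain p q where "rat_two_level e x (cell_lo m i) (cell_lo m (Suc i)) p q"
      using m(2) by (metis less_imp_le)
    then show "\<exists>a\<ge>0. a < t \<and> (\<exists>p. \<forall>s\<in>\<rat>. a < s \<and> s < t \<longrightarrow> dist (x s) p \<le> e)"
      using i cell_lo_nonneg by (rule rat_two_level_left)
  qed
qed

text \<open>The function of right limits along rational times; it restores a path from its
values at rational times.\<close>

definition right_extension :: "'e \<Rightarrow> (real \<Rightarrow> 'e::polish_space) \<Rightarrow> 'e path" where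
  "right_extension z x = (\<lambda>t\<in>{0..}. if Cauchy (\<lambda>k. x (rat_above k t)) then lim (\<lambda>k. x (rat_above k t)) else z)"

lemma right_extension_limit:
  assumes x: "rat_regular x" and t: "0 \<le> t"
  shows "(\<lambda>k. x (rat_above k t)) \<longlonglongrightarrow> right_extension z x t"
proof -
  have "Cauchy (\<lambda>k. x (rat_above k t))"
  proof (rule metric_CauchyI)
    fix e :: real assume "0 < e"
    then have "0 < e / 3" by simp
    then obtain b p where b: "t < b" "\<And>s. s \<in> \<rat> \<Longrightarrow> t < s \<Longrightarrow> s < b \<Longrightarrow> dist (x s) p \<le> e / 3"
      using x t unfolding rat_regular_def by metis
    obtain N where N: "\<And>k. N \<le> k \<Longrightarrow> t < rat_above k t \<and> rat_above k t < b"
      using rat_above_eventually[OF b(1)] unfolding eventually_sequentially by metis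
    have near: "dist (x (rat_above k t)) p \<le> e / 3" if "N \<le> k" for k
      using N[OF that] b(2) rat_above(3) by metis
    have "dist (x (rat_above k t)) (x (rat_above j t)) < e" if "N \<le> k" "N \<le> j" for k j
      using near[OF that(1)] near[OF that(2)]
        dist_triangle2[of "x (rat_above k t)" "x (rat_above j t)" p] \<open>0 < e\<close> by linarith
    then show "\<exists>M. \<forall>m\<ge>M. \<forall>n\<ge>M. dist (x (rat_above m t)) (x (rat_above n t)) < e" by blast
  qed
  then show ?thesis
    using t by (simp add: right_extension_def Cauchy_convergent_iff convergent_LIMSEQ_iff)
qed

lemma right_extension_bound:
  assumes x: "rat_regular x" and s: "0 \<le> s" "s < b"
    and le: "\<And>r. r \<in> \<rat> \<Longrightarrow> s < r \<Longrightarrow> r < b \<Longrightarrow> dist (x r) p \<le> e"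
  shows "dist (right_extension z x s) p \<le> e"
proof (rule dist_le_limit[OF right_extension_limit[OF x s(1)]])
  show "\<forall>\<^sub>F k in sequentially. dist (x (rat_above k s)) p \<le> e"
    using rat_above_eventually[OF s(2)] by eventually_elim (auto intro: le rat_above)
qed simp

lemma right_extension_path:
  assumes x: "rat_regular x"
  shows "right_extension z x \<in> paths"
proof -
  let ?y = "right_extension z x"
  have "(?y \<longlongrightarrow> ?y t) (at_right t)" if t: "0 \<le> t" for t
  proof (rule tendstoI)
    fix e :: real assume "0 < e"
    then have "0 < e / 3" by simp
    then obtain b p where b: "t < b" "\<And>s. s \<in> \<rat> \<Longrightarrow> t < s \<Longrightarrow> s < b \<Longrightarrow> dist (x s) p \<le> e / 3"
      using x t unfolding rat_regular_def by metis
    have bound: "dist (?y s) p \<le> e / 3" if "t \<le> s" "s < b" for s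
      by (rule right_extension_bound[OF x, of s b]) (use that t b(2) in auto)
    have "dist (?y s) (?y t) < e" if "t < s" "s < b" for s
    proof -
      have "dist (?y s) p \<le> e / 3" "dist (?y t) p \<le> e / 3" by (rule bound; use that b(1) in simp)+
      then show ?thesis using dist_triangle2[of "?y s" "?y t" p] \<open>0 < e\<close> by linarith
    qed
    then show "\<forall>\<^sub>F s in at_right t. dist (?y s) (?y t) < e"
      unfolding eventually_at_right_field using b(1) by metis
  qed
  moreover have "\<exists>l. (?y \<longlongrightarrow> l) (at_left t)" if t: "0 < t" for t
  proof -
    have "cauchy_filter (filtermap ?y (at_left t))"
      unfolding cauchy_filter_metric_filtermap
    proof (intro allI impI)
      fix e :: real assume "0 < e"
      then have "0 < e / 3" by simp
      then obtain a p where a: "0 \<le> a" "a < t" "\<And>s. s \<in> \<rat> \<Longrightarrow> a < s \<Longrightarrow> s < t \<Longrightarrow> dist (x s) p \<le> e / 3"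
        using x t unfolding rat_regular_def by metis
      have bound: "dist (?y s) p \<le> e / 3" if "a < s" "s < t" for s
        by (rule right_extension_bound[OF x, of s t]) (use that a in auto)
      have "dist (?y s) (?y r) < e" if "a < s" "s < t" "a < r" "r < t" for s r
      proof -
        have "dist (?y s) p \<le> e / 3" "dist (?y r) p \<le> e / 3" by (rule bound; use that in simp)+
        then show ?thesis using dist_triangle2[of "?y s" "?y r" p] \<open>0 < e\<close> by linarith
      qed
      moreover have "\<forall>\<^sub>F s in at_left t. a < s \<and> s < t"
        unfolding eventually_at_left_field using a(2) by (intro exI[of _ a]) simp
      ultimately show "\<exists>P. eventually P (at_left t) \<and> (\<forall>s r. P s \<and> P r \<longrightarrow> dist (?y s) (?y r) < e)"
        by (intro exI[of _ "\<lambda>s. a < s \<and> s < t"]) simp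
    qed
    moreover have "filtermap ?y (at_left t) \<noteq> bot" by (simp add: filtermap_bot_iff)
    ultimately obtain l where "filtermap ?y (at_left t) \<le> nhds l"
      using complete_UNIV[where 'a = 'a] unfolding complete_uniform by auto
    then show ?thesis by (auto simp: filterlim_def)
  qed
  ultimately show ?thesis by (simp add: paths_def right_extension_def)
qed

text \<open>The code of a path is its restriction to the rational times. A function on the rational times is decoded if it
has grid patterns at all scales, which is a Borel condition that all paths satisfy; otherwise a constant path is returned.\<close>

lemma path_space_retract:
  "\<exists>enc\<in>measurable (path_space :: 'e::polish_space path measure) (borel :: (nat \<Rightarrow> 'e) measure).
     \<exists>dec\<in>measurable borel path_space.
     \<forall>x\<in>paths. dec (enc x) = x"
proof -
  obtain dd :: "nat \<Rightarrow> 'e" where dd: "\<forall>x e. 0 < e \<longrightarrow> (\<exists>n. dist x (dd n) < e)"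
    using dense_sequence_exists by metis
  define z where "z = dd 0"
  define \<rho> where "\<rho> = from_nat_into (\<rat> :: real set)"
  define \<kappa> where "\<kappa> = to_nat_on (\<rat> :: real set)"
  have \<rho>\<kappa>: "\<rho> (\<kappa> s) = s" if "s \<in> \<rat>" for s
    unfolding \<rho>_def \<kappa>_def using that by (simp add: countable_rat)
  define enc where "enc x n = (if 0 \<le> \<rho> n then x (\<rho> n) else z)" for x :: "'e path" and n
  define good where "good y \<longleftrightarrow> (\<forall>n. 0 < n \<longrightarrow> (\<exists>m. n \<le> m \<and> (\<exists>ws. grid_cond dd n m ws (\<lambda>s. y (\<kappa> s)))))"
    for y :: "nat \<Rightarrow> 'e"
  define dec where "dec y = (if good y then right_extension z (\<lambda>s. y (\<kappa> s)) else const_path z)" for y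
  have coord [measurable]: "(\<lambda>y :: nat \<Rightarrow> 'e. y n) \<in> borel_measurable borel" for n
    by (intro borel_measurable_continuous_onI continuous_on_product_coordinates)
  have encm: "enc \<in> measurable path_space borel"
  proof -
    have "(\<lambda>x. enc x n) \<in> measurable path_space borel" for n
      unfolding enc_def using path_coord_measurable by (cases "0 \<le> \<rho> n") simp_all
    then have "enc \<in> measurable path_space (\<Pi>\<^sub>M i\<in>UNIV. borel)"
      by (intro measurable_PiM_single') auto
    then show ?thesis by (simp add: sets_PiM_equal_borel cong: measurable_cong_sets)
  qed
  have decm: "dec \<in> measurable borel path_space"
  proof -
    have good_meas [measurable]: "Measurable.pred borel good"
    proof -
      have [measurable]: "Measurable.pred borel (\<lambda>y :: nat \<Rightarrow> 'e. grid_cond dd n m ws (\<lambda>s. y (\<kappa> s)))" for n m ws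
        by (rule grid_cond_measurable) simp
      show ?thesis unfolding good_def by measurable
    qed
    have "(\<lambda>y. dec y t) \<in> borel_measurable borel" if "t \<in> {0..}" for t
    proof -
      have [measurable]: "(\<lambda>y. right_extension z (\<lambda>s. y (\<kappa> s)) t) \<in> borel_measurable borel"
        using borel_measurable_lim_complete[of "\<lambda>k y. y (\<kappa> (rat_above k t))" borel z] that
        by (simp add: right_extension_def)
      have "(\<lambda>y. dec y t) = (\<lambda>y. if good y then right_extension z (\<lambda>s. y (\<kappa> s)) t else const_path z t)"
        by (simp add: dec_def fun_eq_iff)
      then show ?thesis by simp
    qed
    moreover have "dec y \<in> paths" for y
    proof (cases "good y")
      case True
      have "rat_regular (\<lambda>s. y (\<kappa> s))"
        by (rule grid_cond_regular[of dd]) (use True in \<open>simp add: good_def\<close>)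
      then show ?thesis using True right_extension_path by (simp add: dec_def)
    next
      case False
      then show ?thesis by (simp add: dec_def const_path_in_paths)
    qed
    ultimately show ?thesis
      unfolding path_space_def
      by (intro measurable_restrict_space2 measurable_PiM_single')
        (auto simp: paths_def extensional_def PiE_def)
  qed
  have inv: "dec (enc x) = x" if x: "x \<in> paths" for x
  proof -
    have enc_eq: "enc x (\<kappa> s) = x s" if "s \<in> \<rat>" "0 \<le> s" for s
      using \<rho>\<kappa> that by (simp add: enc_def)
    have "grid_cond dd n m ws (\<lambda>s. enc x (\<kappa> s)) \<longleftrightarrow> grid_cond dd n m ws x" for n m ws
    proof -
      have "rat_two_level e (\<lambda>s. enc x (\<kappa> s)) (cell_lo m i) d p q \<longleftrightarrow> rat_two_level e x (cell_lo m i) d p q" for e i d p q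
      proof -
        have "enc x (\<kappa> s) = x s" if "s \<in> \<rat>" "cell_lo m i \<le> s" for s
          using enc_eq[OF that(1)] that(2) cell_lo_nonneg[of m i] by linarith
        then show ?thesis by (rule rat_two_level_cong)
      qed
      then show ?thesis by (simp add: grid_cond_def)
    qed
    then have "good (enc x)"
      unfolding good_def using path_grid_cond[OF x, of dd] dd by simp
    moreover have "right_extension z (\<lambda>s. enc x (\<kappa> s)) = x"
    proof
      fix t
      show "right_extension z (\<lambda>s. enc x (\<kappa> s)) t = x t"
      proof (cases "0 \<le> t")
        case True
        have "(\<lambda>k. enc x (\<kappa> (rat_above k t))) \<longlonglongrightarrow> x t"
          using path_limit_rat_above[OF x True] enc_eq rat_above(3) rat_above_nonneg[OF True] by simp
        then have "Cauchy (\<lambda>k. enc x (\<kappa> (rat_above k t)))" "lim (\<lambda>k. enc x (\<kappa> (rat_above k t))) = x t"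
          by (rule LIMSEQ_imp_Cauchy, rule limI)
        then show ?thesis using True by (simp add: right_extension_def)
      next
        case False
        then show ?thesis using x by (simp add: right_extension_def paths_def extensional_def)
      qed
    qed
    ultimately show ?thesis by (simp add: dec_def)
  qed
  show ?thesis
    by (rule bexI[where x = enc], rule bexI[where x = dec]) (simp_all add: inv encm decm)
qed

section \<open>Weakly open sets of laws are measurable\<close>

text \<open>Including \<open>0\<close> in the maximum makes the empty list stand for the zero function.\<close>

definition step_fun :: "(rat \<times> 'a set) list \<Rightarrow> 'a \<Rightarrow> ennreal" where
  "step_fun xs \<omega> = Max (insert 0 ((\<lambda>(q, A). ennreal (real_of_rat q) * indicator A \<omega>) ` set xs))"

lemma step_fun_measurable:
  assumes "snd ` set xs \<subseteq> sets M"
  shows "step_fun xs \<in> borel_measurable M"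
proof -
  have *: "step_fun (x # xs) \<omega> = max (ennreal (real_of_rat (fst x)) * indicator (snd x) \<omega>) (step_fun xs \<omega>)" for x xs \<omega>
  proof -
    have "step_fun (x # xs) \<omega> = Max (insert (ennreal (real_of_rat (fst x)) * indicator (snd x) \<omega>)
        (insert 0 ((\<lambda>(q, A). ennreal (real_of_rat q) * indicator A \<omega>) ` set xs)))"
      unfolding step_fun_def by (simp add: case_prod_beta insert_commute)
    also have "\<dots> = max (ennreal (real_of_rat (fst x)) * indicator (snd x) \<omega>) (step_fun xs \<omega>)"
      unfolding step_fun_def by (rule Max_insert) simp_all
    finally show ?thesis .
  qed
  show ?thesis
    using assms
  proof (induction xs)
    case Nil
    show ?case by (simp add: step_fun_def[abs_def])
  next
    case (Cons x xs)
    then have [measurable]: "step_fun xs \<in> borel_measurable M" "snd x \<in> sets M" by auto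
    show ?case unfolding * [abs_def] by measurable
  qed
qed

lemma step_fun_le:
  assumes "\<And>q A. (q, A) \<in> set xs \<Longrightarrow> \<omega> \<in> A \<Longrightarrow> ennreal (real_of_rat q) \<le> c"
  shows "step_fun xs \<omega> \<le> c"
  unfolding step_fun_def using assms by (auto simp: indicator_def)

lemma step_fun_ge:
  assumes "(q, A) \<in> set xs" "\<omega> \<in> A"
  shows "ennreal (real_of_rat q) \<le> step_fun xs \<omega>"
proof -
  have "ennreal (real_of_rat q) = (\<lambda>(q, A). ennreal (real_of_rat q) * indicator A \<omega>) (q, A)"
    using assms(2) by simp
  then have "ennreal (real_of_rat q) \<in> insert 0 ((\<lambda>(q, A). ennreal (real_of_rat q) * indicator A \<omega>) ` set xs)"
    using assms(1) by (intro insertI2 image_eqI)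
  then show ?thesis unfolding step_fun_def by (intro Max_ge) simp_all
qed

text \<open>If the strict superlevel sets of \<open>f\<close> are unions of members of a countable network, then \<open>f\<close> is the supremum of the
functions \<open>q\<close> times the indicator of \<open>A\<close> that lie below it, and monotone convergence applies to the
maxima of finitely many of them.\<close>

lemma step_fun_approximation:
  fixes f :: "'a \<Rightarrow> real"
  assumes \<N>: "countable \<N>" "\<N> \<subseteq> sets M"
    and net: "\<And>c x. x \<in> space M \<Longrightarrow> c < f x \<Longrightarrow> \<exists>A\<in>\<N>. x \<in> A \<and> A \<subseteq> {x \<in> space M. c < f x}"
    and nn: "\<And>x. 0 \<le> f x"
    and sets: "sets \<mu> = sets M" and a: "a < (\<integral>\<^sup>+x. ennreal (f x) \<partial>\<mu>)"
  shows "\<exists>xs. snd ` set xs \<subseteq> \<N> \<and> (\<forall>x\<in>space M. step_fun xs x \<le> ennreal (f x)) \<and> a < (\<integral>\<^sup>+x. step_fun xs x \<partial>\<mu>)"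
proof -
  define I where "I = {(q, A). A \<in> \<N> \<and> A \<subseteq> {x \<in> space M. real_of_rat q < f x}}"
  have "I \<subseteq> UNIV \<times> \<N>" by (auto simp: I_def)
  then have cI: "countable I"
    by (rule countable_subset) (intro countable_SIGMA \<N>(1) countableI_type)
  define xs where "xs n = filter (\<lambda>p. p \<in> I) (map (from_nat_into I) [0..<n])" for n
  have xs_I: "set (xs n) \<subseteq> I" for n by (auto simp: xs_def)
  have xsN: "snd ` set (xs n) \<subseteq> \<N>" for n using xs_I[of n] by (auto simp: I_def)
  have meas: "step_fun (xs n) \<in> borel_measurable \<mu>" for n
    using step_fun_measurable[of "xs n" M] xsN[of n] \<N>(2) sets by (auto cong: measurable_cong_sets)
  have mono: "set (xs m) \<subseteq> set (xs n)" if "m \<le> n" for m n using that by (auto simp: xs_def)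
  have le: "step_fun (xs n) x \<le> ennreal (f x)" if "x \<in> space M" for n x
  proof (rule step_fun_le)
    fix q A assume "(q, A) \<in> set (xs n)" "x \<in> A"
    then have "real_of_rat q < f x" using xs_I[of n] by (auto simp: I_def)
    then show "ennreal (real_of_rat q) \<le> ennreal (f x)" by (intro ennreal_leI) simp
  qed
  have inc: "incseq (\<lambda>n. step_fun (xs n))"
  proof (rule monoI, rule le_funI)
    fix m n :: nat and x assume "m \<le> n"
    then show "step_fun (xs m) x \<le> step_fun (xs n) x"
      using mono[of m n] by (intro step_fun_le step_fun_ge) auto
  qed
  have sup: "(SUP n. step_fun (xs n) x) = ennreal (f x)" if x: "x \<in> space M" for x
  proof (rule antisym)
    show "(SUP n. step_fun (xs n) x) \<le> ennreal (f x)" using le[OF x] by (rule SUP_least)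
    show "ennreal (f x) \<le> (SUP n. step_fun (xs n) x)"
    proof (rule dense_le)
      fix c assume c: "c < ennreal (f x)"
      then have "c \<noteq> \<top>" by (metis ennreal_less_top less_asym top.not_eq_extremum)
      then have "c = ennreal (enn2real c)" by (simp add: less_top)
      then have "enn2real c < f x" using c nn[of x] by (metis ennreal_less_iff enn2real_nonneg)
      then obtain q where q: "enn2real c < real_of_rat q" "real_of_rat q < f x" using of_rat_dense by metis
      obtain A where A: "A \<in> \<N>" "x \<in> A" "A \<subseteq> {x \<in> space M. real_of_rat q < f x}"
        using net[OF x q(2)] by metis
      have "(q, A) \<in> I" using A by (simp add: I_def)
      then obtain n where n: "from_nat_into I n = (q, A)" using from_nat_into_surj[OF cI] by metis
      have "(q, A) \<in> set (xs (Suc n))"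
        using n \<open>(q, A) \<in> I\<close> by (auto simp: xs_def image_iff intro!: bexI[of _ n])
      then have "ennreal (real_of_rat q) \<le> step_fun (xs (Suc n)) x" using A(2) by (rule step_fun_ge)
      moreover have "c \<le> ennreal (real_of_rat q)"
        using q(1) \<open>c = ennreal (enn2real c)\<close> by (metis ennreal_leI less_imp_le)
      ultimately show "c \<le> (SUP n. step_fun (xs n) x)"
        by (meson SUP_upper2 UNIV_I order_trans)
    qed
  qed
  have "(\<integral>\<^sup>+x. ennreal (f x) \<partial>\<mu>) = (\<integral>\<^sup>+x. (SUP n. step_fun (xs n) x) \<partial>\<mu>)"
    using sup sets_eq_imp_space_eq[OF sets] by (intro nn_integral_cong) simp
  also have "\<dots> = (SUP n. \<integral>\<^sup>+x. step_fun (xs n) x \<partial>\<mu>)"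
    by (rule nn_integral_monotone_convergence_SUP[OF inc meas])
  finally obtain n where "a < (\<integral>\<^sup>+x. step_fun (xs n) x \<partial>\<mu>)" using a by (auto simp: less_SUP_iff)
  then show ?thesis using xsN le by (intro exI[of _ "xs n"]) simp
qed

definition network_on :: "'a topology \<Rightarrow> 'a set set \<Rightarrow> bool" where
  "network_on T \<W> \<longleftrightarrow> (\<forall>U x. openin T U \<longrightarrow> x \<in> U \<longrightarrow> (\<exists>W\<in>\<W>. x \<in> W \<and> W \<subseteq> U))"

lemma network_on_generated:
  assumes int: "\<And>V W. V \<in> \<W> \<Longrightarrow> W \<in> \<W> \<Longrightarrow> V \<inter> W \<in> \<W>"
    and base: "\<And>U x. U \<in> S \<Longrightarrow> x \<in> U \<Longrightarrow> \<exists>W\<in>\<W>. x \<in> W \<and> W \<subseteq> U"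
  shows "network_on (topology_generated_by S) \<W>"
  unfolding network_on_def
proof (intro allI impI)
  fix U x assume "openin (topology_generated_by S) U" "x \<in> U"
  then have "generate_topology_on S U" "x \<in> U" by (simp_all add: openin_topology_generated_by_iff)
  then show "\<exists>W\<in>\<W>. x \<in> W \<and> W \<subseteq> U"
  proof (induction arbitrary: x)
    case (Int a b)
    obtain V where V: "V \<in> \<W>" "x \<in> V" "V \<subseteq> a" using Int.IH(1)[of x] Int.prems by auto
    obtain W where W: "W \<in> \<W>" "x \<in> W" "W \<subseteq> b" using Int.IH(2)[of x] Int.prems by auto
    show ?case using int[OF V(1) W(1)] V W by (intro bexI[of _ "V \<inter> W"]) auto
  next
    case (UN K)
    then obtain k where k: "k \<in> K" "x \<in> k" by auto
    then obtain W where "W \<in> \<W>" "x \<in> W" "W \<subseteq> k" using UN.IH[OF k] by auto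
    then show ?case using k(1) by (intro bexI[of _ W]) auto
  next
    case (Basis s)
    then show ?case by (rule base)
  qed simp
qed

text \<open>Finitely many strict lower bounds on integrals of step functions; these sets are measurable
but in general not weakly open.\<close>

definition law_nbhd :: "'a measure \<Rightarrow> (rat \<times> (rat \<times> 'a set) list) list \<Rightarrow> 'a measure set" where
  "law_nbhd M cs = {\<mu> \<in> space (prob_algebra M).
     \<forall>(a, xs)\<in>set cs. ennreal (real_of_rat a) < (\<integral>\<^sup>+x. step_fun xs x \<partial>\<mu>)}"

lemma law_nbhd_Int: "law_nbhd M cs \<inter> law_nbhd M ds = law_nbhd M (cs @ ds)"
  by (auto simp: law_nbhd_def)

lemma measurable_prob_algebra_nn_integral:
  assumes "f \<in> borel_measurable M"
  shows "(\<lambda>\<mu>. \<integral>\<^sup>+x. f x \<partial>\<mu>) \<in> borel_measurable (prob_algebra M)"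
  unfolding prob_algebra_def
  by (rule measurable_restrict_space1[OF nn_integral_measurable_subprob_algebra[OF assms]])

lemma law_nbhd_measurable:
  assumes "\<And>a xs. (a, xs) \<in> set cs \<Longrightarrow> snd ` set xs \<subseteq> sets M"
  shows "law_nbhd M cs \<in> sets (prob_algebra M)"
  using assms
proof (induction cs)
  case Nil
  have "law_nbhd M [] = space (prob_algebra M)" by (simp add: law_nbhd_def)
  then show ?case by simp
next
  case (Cons c cs)
  obtain a xs where c: "c = (a, xs)" by (cases c)
  have [measurable]: "(\<lambda>\<mu>. \<integral>\<^sup>+x. step_fun xs x \<partial>\<mu>) \<in> borel_measurable (prob_algebra M)"
    by (intro measurable_prob_algebra_nn_integral step_fun_measurable) (use Cons.prems c in auto)
  have "law_nbhd M (c # cs) =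
      {\<mu> \<in> space (prob_algebra M). ennreal (real_of_rat a) < (\<integral>\<^sup>+x. step_fun xs x \<partial>\<mu>)} \<inter> law_nbhd M cs"
    by (auto simp: law_nbhd_def c)
  moreover have "law_nbhd M cs \<in> sets (prob_algebra M)" using Cons by auto
  ultimately show ?case by simp
qed

lemma continuous_superlevel_network:
  fixes f :: "'e::polish_space path \<Rightarrow> real"
  assumes f: "continuous_map skorokhod_topology euclideanreal f"
    and net: "\<forall>U x. skorokhod_open U \<longrightarrow> x \<in> U \<longrightarrow> (\<exists>A\<in>\<N>. x \<in> A \<and> A \<subseteq> U)"
    and x: "x \<in> paths" "c < f x"
  shows "\<exists>A\<in>\<N>. x \<in> A \<and> A \<subseteq> {x \<in> paths. c < f x}"
proof -
  have "openin skorokhod_topology {x \<in> topspace skorokhod_topology. f x \<in> {c<..}}"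
    using f by (rule openin_continuous_map_preimage) simp
  then have "skorokhod_open {x \<in> paths. c < f x}"
    by (simp add: openin_skorokhod topspace_skorokhod)
  then show ?thesis using net x by blast
qed

lemma measurable_of_superlevel_network:
  fixes f :: "'a \<Rightarrow> real"
  assumes \<N>: "countable \<N>" "\<N> \<subseteq> sets M"
    and net: "\<And>c x. x \<in> space M \<Longrightarrow> c < f x \<Longrightarrow> \<exists>A\<in>\<N>. x \<in> A \<and> A \<subseteq> {x \<in> space M. c < f x}"
  shows "f \<in> borel_measurable M"
  unfolding borel_measurable_iff_greater
proof
  fix c
  have "{x \<in> space M. c < f x} = \<Union> {A \<in> \<N>. A \<subseteq> {x \<in> space M. c < f x}}"
    using net by blast
  also have "\<dots> \<in> sets M"
    using \<N> by (intro sets.countable_Union) (auto intro: countable_subset[OF _ \<N>(1)])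
  finally show "{w \<in> space M. c < f w} \<in> sets M" .
qed

text \<open>The function is shifted by a bound \<open>B\<close> to become nonnegative. A step function below
it then has an integral above \<open>c + B\<close>, and this remains true for all laws in a suitable \<open>law_nbhd\<close>.\<close>

lemma integral_superlevel_nbhd:
  fixes f :: "'e::polish_space path \<Rightarrow> real"
  assumes \<N>: "countable \<N>" "\<N> \<subseteq> sets path_space"
    and net: "\<forall>U x. skorokhod_open U \<longrightarrow> x \<in> U \<longrightarrow> (\<exists>A\<in>\<N>. x \<in> A \<and> A \<subseteq> U)"
    and f: "continuous_map skorokhod_topology euclideanreal f" and bdd: "bounded (f ` paths)"
    and mu: "\<mu> \<in> path_laws" and c: "c < (\<integral>x. f x \<partial>\<mu>)"
  shows "\<exists>cs. (\<forall>(a, xs)\<in>set cs. snd ` set xs \<subseteq> \<N>) \<and> \<mu> \<in> law_nbhd path_space cs \<and>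
    (\<forall>\<mu>'\<in>law_nbhd path_space cs. c < (\<integral>x. f x \<partial>\<mu>'))"
proof -
  obtain B where B: "\<forall>x\<in>paths. \<bar>f x\<bar> \<le> B" using bdd by (auto simp: bounded_iff)
  \<comment> \<open>The maximum makes \<open>h\<close> nonnegative also outside the path space.\<close>
  define h where "h x = max 0 (f x + B)" for x
  have h_eq: "h x = f x + B" if "x \<in> paths" for x using B that by (fastforce simp: h_def)
  have fm: "f \<in> borel_measurable path_space"
    using \<N> by (rule measurable_of_superlevel_network)
      (simp add: space_path_space continuous_superlevel_network[OF f net])
  have nn: "(\<integral>\<^sup>+x. ennreal (h x) \<partial>\<nu>) = ennreal ((\<integral>x. f x \<partial>\<nu>) + B) \<and> 0 \<le> (\<integral>x. f x \<partial>\<nu>) + B"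
    if nu: "\<nu> \<in> path_laws" for \<nu>
  proof -
    interpret prob_space \<nu> using prob_algebraD(3)[OF nu] .
    have sp: "space \<nu> = paths" using prob_algebraD(2)[OF nu] by (simp add: space_path_space)
    have fm': "f \<in> borel_measurable \<nu>" using fm prob_algebraD(1)[OF nu] by (simp cong: measurable_cong_sets)
    have fi: "integrable \<nu> f"
      by (rule integrable_const_bound[of _ B]) (use B fm' sp in auto)
    have hi: "integrable \<nu> (\<lambda>x. f x + B)" using fi by simp
    have "(\<integral>\<^sup>+x. ennreal (h x) \<partial>\<nu>) = (\<integral>\<^sup>+x. ennreal (f x + B) \<partial>\<nu>)"
      by (rule nn_integral_cong) (simp add: h_eq sp)
    also have "\<dots> = ennreal (\<integral>x. f x + B \<partial>\<nu>)"
      by (rule nn_integral_eq_integral[OF hi]) (use B sp in \<open>auto simp: abs_le_iff intro!: AE_I2, fastforce\<close>)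
    also have "(\<integral>x. f x + B \<partial>\<nu>) = (\<integral>x. f x \<partial>\<nu>) + B" using fi by (simp add: prob_space)
    finally have "(\<integral>\<^sup>+x. ennreal (h x) \<partial>\<nu>) = ennreal ((\<integral>x. f x \<partial>\<nu>) + B)" .
    moreover have "0 \<le> (\<integral>x. f x + B \<partial>\<nu>)"
      by (rule integral_nonneg_AE) (use h_eq sp in \<open>auto simp: h_def intro!: AE_I2, fastforce\<close>)
    ultimately show ?thesis using fi by (simp add: prob_space)
  qed
  show ?thesis
  proof (cases "c + B < 0")
    case True
    have "c < (\<integral>x. f x \<partial>\<nu>)" if "\<nu> \<in> path_laws" for \<nu> using nn[OF that] True by linarith
    then show ?thesis using mu by (intro exI[of _ "[]"]) (simp add: law_nbhd_def)
  next
    case False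
    have less: "ennreal (c + B) < (\<integral>\<^sup>+x. ennreal (h x) \<partial>\<mu>)"
      using nn[OF mu] c False by (simp add: ennreal_less_iff)
    have hnet: "\<exists>A\<in>\<N>. x \<in> A \<and> A \<subseteq> {x \<in> space path_space. b < h x}"
      if "x \<in> space path_space" "b < h x" for b x
    proof -
      have x: "x \<in> paths" using that(1) by (simp add: space_path_space)
      have "{x \<in> space path_space. b < h x} = {x \<in> paths. b - B < f x}"
        using h_eq by (auto simp: space_path_space)
      moreover have "b - B < f x" using that(2) h_eq[OF x] by simp
      ultimately show ?thesis using continuous_superlevel_network[OF f net x] by simp
    qed
    have "\<exists>xs. snd ` set xs \<subseteq> \<N> \<and> (\<forall>x\<in>space path_space. step_fun xs x \<le> ennreal (h x)) \<and>
        ennreal (c + B) < (\<integral>\<^sup>+x. step_fun xs x \<partial>\<mu>)"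
      by (rule step_fun_approximation[OF \<N> hnet _ prob_algebraD(1)[OF mu] less]) (simp_all add: h_def)
    then obtain xs where xs: "snd ` set xs \<subseteq> \<N>" "\<forall>x\<in>paths. step_fun xs x \<le> ennreal (h x)"
      "ennreal (c + B) < (\<integral>\<^sup>+x. step_fun xs x \<partial>\<mu>)"
      unfolding space_path_space by (elim exE conjE)
    obtain y where y: "ennreal (c + B) < y" "y < (\<integral>\<^sup>+x. step_fun xs x \<partial>\<mu>)" using dense[OF xs(3)] by metis
    then have ytop: "y < \<top>" by (metis less_le_trans top_greatest)
    then have yr: "y = ennreal (enn2real y)" by simp
    then have "c + B < enn2real y" using y(1) False by (metis ennreal_less_iff not_less)
    then obtain q where q: "c + B < real_of_rat q" "real_of_rat q < enn2real y" using of_rat_dense by metis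
    show ?thesis
    proof (intro exI[of _ "[(q, xs)]"] conjI ballI)
      have "ennreal (real_of_rat q) \<le> y" using q(2) yr by (metis ennreal_leI less_imp_le)
      then have "ennreal (real_of_rat q) < (\<integral>\<^sup>+x. step_fun xs x \<partial>\<mu>)" using y(2) by (rule le_less_trans)
      then show "\<mu> \<in> law_nbhd path_space [(q, xs)]" using mu by (simp add: law_nbhd_def)
    next
      fix \<nu> assume "\<nu> \<in> law_nbhd path_space [(q, xs)]"
      then have nu: "\<nu> \<in> path_laws" "ennreal (real_of_rat q) < (\<integral>\<^sup>+x. step_fun xs x \<partial>\<nu>)"
        by (simp_all add: law_nbhd_def)
      note nu(2)
      also have "(\<integral>\<^sup>+x. step_fun xs x \<partial>\<nu>) \<le> (\<integral>\<^sup>+x. ennreal (h x) \<partial>\<nu>)"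
        using xs(2) prob_algebraD(2)[OF nu(1)] by (intro nn_integral_mono) (simp add: space_path_space)
      also have "\<dots> = ennreal ((\<integral>x. f x \<partial>\<nu>) + B)" using nn[OF nu(1)] by simp
      finally have "ennreal (real_of_rat q) < ennreal ((\<integral>x. f x \<partial>\<nu>) + B)" .
      moreover have "0 \<le> real_of_rat q" using q(1) False by linarith
      ultimately have "real_of_rat q < (\<integral>x. f x \<partial>\<nu>) + B" by (simp only: ennreal_less_iff)
      then show "c < (\<integral>x. f x \<partial>\<nu>)" using q(1) by simp
    qed (use xs(1) in simp)
  qed
qed



text \<open>The topology is generated by conditions \<open>\<integral>f d\<mu> \<in> U\<close>. Lower bounds for the integrals of
\<open>f\<close> and of \<open>-f\<close> confine the integral of \<open>f\<close> to a small interval.\<close>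

lemma weak_measurable_network:
  "\<exists>\<W> :: 'e::polish_space path measure set set. countable \<W> \<and> \<W> \<subseteq> sets (prob_algebra path_space) \<and>
     network_on weak_topology \<W>"
proof -
  from skorokhod_measurable_network obtain \<N> :: "'e path set set" where \<N>:
    "countable \<N> \<and> \<N> \<subseteq> sets path_space \<and>
     (\<forall>U x. skorokhod_open U \<longrightarrow> x \<in> U \<longrightarrow> (\<exists>A\<in>\<N>. x \<in> A \<and> A \<subseteq> U))" ..
  then have N: "countable \<N>" "\<N> \<subseteq> sets path_space"
    and net: "\<forall>U x. skorokhod_open U \<longrightarrow> x \<in> U \<longrightarrow> (\<exists>A\<in>\<N>. x \<in> A \<and> A \<subseteq> U)" by simp_all
  define J where "J = lists (UNIV \<times> lists (UNIV \<times> \<N>)) \<inter> (UNIV :: (rat \<times> (rat \<times> 'e path set) list) list set)"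
  have J: "cs \<in> J \<longleftrightarrow> (\<forall>(a, xs)\<in>set cs. snd ` set xs \<subseteq> \<N>)" for cs
    by (simp add: J_def in_lists_conv_set mem_Times_iff image_subset_iff case_prod_beta)
  define \<W> where "\<W> = law_nbhd path_space ` J"
  have "countable J"
    unfolding J_def Int_UNIV_right
    by (intro countable_lists countable_SIGMA N(1) countableI_type)
  then have "countable \<W>" unfolding \<W>_def by simp
  moreover have "\<W> \<subseteq> sets (prob_algebra path_space)"
    unfolding \<W>_def
  proof (rule image_subsetI, rule law_nbhd_measurable)
    fix cs a and xs :: "(rat \<times> 'e path set) list" assume "cs \<in> J" "(a, xs) \<in> set cs"
    then have "snd ` set xs \<subseteq> \<N>" unfolding J by (metis case_prodD)
    then show "snd ` set xs \<subseteq> sets path_space" using N(2) by (rule order_trans)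
  qed
  moreover have "network_on weak_topology \<W>"
    unfolding weak_topology_def
  proof (rule network_on_generated)
    fix V W assume "V \<in> \<W>" "W \<in> \<W>"
    then obtain cs ds where cd: "cs \<in> J" "ds \<in> J" "V = law_nbhd path_space cs" "W = law_nbhd path_space ds"
      by (auto simp: \<W>_def)
    have "cs @ ds \<in> J" using cd(1,2) unfolding J set_append by (intro ball_Un[THEN iffD2] conjI)
    then show "V \<inter> W \<in> \<W>" unfolding \<W>_def cd law_nbhd_Int by (rule imageI)
  next
    fix S and \<mu> :: "'e path measure"
    assume "S \<in> {{\<mu> \<in> path_laws. (\<integral>\<omega>. f \<omega> \<partial>\<mu>) \<in> U} | f U.
        continuous_map skorokhod_topology euclideanreal f \<and> bounded (f ` paths) \<and> open U}" and "\<mu> \<in> S"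
    then obtain f U where S: "S = {\<mu> \<in> path_laws. (\<integral>\<omega>. f \<omega> \<partial>\<mu>) \<in> U}"
      and f: "continuous_map skorokhod_topology euclideanreal f" "bounded (f ` paths)" and U: "open U"
      by (elim CollectE exE conjE)
    have mu: "\<mu> \<in> path_laws" "(\<integral>\<omega>. f \<omega> \<partial>\<mu>) \<in> U" using \<open>\<mu> \<in> S\<close> by (simp_all add: S)
    obtain e where e0: "e > 0" "ball (\<integral>\<omega>. f \<omega> \<partial>\<mu>) e \<subseteq> U" using U mu(2) by (rule openE)
    have e: "r \<in> U" if "\<bar>r - (\<integral>\<omega>. f \<omega> \<partial>\<mu>)\<bar> < e" for r
      using that e0(2) by (auto simp: dist_real_def abs_minus_commute)
    obtain b where b: "\<forall>x\<in>paths. \<bar>f x\<bar> \<le> b" using f(2) unfolding bounded_iff by auto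
    have f': "continuous_map skorokhod_topology euclideanreal (\<lambda>x. - f x)" "bounded ((\<lambda>x. - f x) ` paths)"
    proof -
      show "continuous_map skorokhod_topology euclideanreal (\<lambda>x. - f x)"
        using f(1) by (rule continuous_map_minus)
      show "bounded ((\<lambda>x. - f x) ` paths)" by (rule boundedI[of _ b]) (use b in auto)
    qed
    have "\<exists>cs. cs \<in> J \<and> \<mu> \<in> law_nbhd path_space cs \<and>
        (\<forall>\<nu>\<in>law_nbhd path_space cs. (\<integral>\<omega>. f \<omega> \<partial>\<mu>) - e < (\<integral>x. f x \<partial>\<nu>))"
      unfolding J by (rule integral_superlevel_nbhd[OF N net f mu(1)]) (use e0(1) in simp)
    then obtain cs where cs: "cs \<in> J" "\<mu> \<in> law_nbhd path_space cs"
      "\<forall>\<nu>\<in>law_nbhd path_space cs. (\<integral>\<omega>. f \<omega> \<partial>\<mu>) - e < (\<integral>x. f x \<partial>\<nu>)"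
      by (elim exE conjE)
    have "\<exists>ds. ds \<in> J \<and> \<mu> \<in> law_nbhd path_space ds \<and>
        (\<forall>\<nu>\<in>law_nbhd path_space ds. - (\<integral>\<omega>. f \<omega> \<partial>\<mu>) - e < (\<integral>x. - f x \<partial>\<nu>))"
      unfolding J by (rule integral_superlevel_nbhd[OF N net f' mu(1)]) (use e0(1) in simp)
    then obtain ds where ds: "ds \<in> J" "\<mu> \<in> law_nbhd path_space ds"
      "\<forall>\<nu>\<in>law_nbhd path_space ds. - (\<integral>\<omega>. f \<omega> \<partial>\<mu>) - e < (\<integral>x. - f x \<partial>\<nu>)"
      by (elim exE conjE)
    have "cs @ ds \<in> J" using cs(1) ds(1) unfolding J set_append by (intro ball_Un[THEN iffD2] conjI)
    then have "law_nbhd path_space (cs @ ds) \<in> \<W>" unfolding \<W>_def by (rule imageI)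
    moreover have "\<mu> \<in> law_nbhd path_space (cs @ ds)"
      unfolding law_nbhd_Int[symmetric] using cs(2) ds(2) by (rule IntI)
    moreover have "law_nbhd path_space (cs @ ds) \<subseteq> S"
    proof
      fix \<nu> assume "\<nu> \<in> law_nbhd path_space (cs @ ds)"
      then have nu: "\<nu> \<in> law_nbhd path_space cs" "\<nu> \<in> law_nbhd path_space ds"
        unfolding law_nbhd_Int[symmetric] by simp_all
      have "(\<integral>\<omega>. f \<omega> \<partial>\<mu>) - e < (\<integral>x. f x \<partial>\<nu>)" "- (\<integral>\<omega>. f \<omega> \<partial>\<mu>) - e < - (\<integral>x. f x \<partial>\<nu>)"
        using bspec[OF cs(3) nu(1)] bspec[OF ds(3) nu(2)] by simp_all
      then have "(\<integral>x. f x \<partial>\<nu>) \<in> U" by (intro e) linarith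
      then show "\<nu> \<in> S" using nu(1) by (simp add: S law_nbhd_def)
    qed
    ultimately show "\<exists>W\<in>\<W>. \<mu> \<in> W \<and> W \<subseteq> S"
      by (intro bexI[of _ "law_nbhd path_space (cs @ ds)"] conjI)
  qed
  ultimately show ?thesis by (intro exI[of _ \<W>] conjI)
qed


text \<open>Each open set is a countable union of products of members of networks of the three
factors, all of which are measurable.\<close>

lemma borel_law_product_measurable:
  fixes B :: "(('e::polish_space \<times> 'e path measure) \<times> real) set"
  assumes "B \<in> borel_sets (prod_topology (prod_topology euclidean weak_topology) euclideanreal)"
  shows "B \<in> sets ((borel \<Otimes>\<^sub>M prob_algebra path_space) \<Otimes>\<^sub>M borel)"
proof -
  let ?T = "prod_topology (prod_topology (euclidean :: 'e topology) (weak_topology :: 'e path measure topology)) euclideanreal"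
  let ?M = "((borel :: 'e measure) \<Otimes>\<^sub>M prob_algebra (path_space :: 'e path measure)) \<Otimes>\<^sub>M (borel :: real measure)"
  obtain \<W> :: "'e path measure set set" where \<W>: "countable \<W>" "\<W> \<subseteq> sets (prob_algebra path_space)"
     "network_on weak_topology \<W>"
    using weak_measurable_network by metis
  obtain \<A> :: "'e set set" where A: "countable \<A>" "topological_basis \<A>" using ex_countable_basis by metis
  obtain \<R> :: "real set set" where R: "countable \<R>" "topological_basis \<R>" using ex_countable_basis by metis
  have sp: "topspace ?T = space ?M"
    by (simp add: topspace_weak_topology space_pair_measure)
  define \<K> where "\<K> = (\<lambda>(A, W, R). (A \<times> W) \<times> R) ` (\<A> \<times> \<W> \<times> \<R>)"
  have cK: "countable \<K>" unfolding \<K>_def using A R \<W> by (intro countable_image countable_SIGMA)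
  have KM: "K \<in> sets ?M" if "K \<in> \<K>" for K
    using that A R \<W> by (auto simp: \<K>_def topological_basis_open intro!: pair_measureI)
  have "U \<in> sets ?M" if U: "openin ?T U" for U
  proof -
    have "\<exists>K\<in>\<K>. p \<in> K \<and> K \<subseteq> U" if p: "p \<in> U" for p
    proof -
      obtain x \<mu> r where pe: "p = ((x, \<mu>), r)" by (metis prod.exhaust)
      obtain V X where V: "openin (prod_topology euclidean weak_topology) V" "open X" "(x, \<mu>) \<in> V" "r \<in> X" "V \<times> X \<subseteq> U"
        using U p unfolding openin_prod_topology_alt pe by (metis open_openin)
      obtain Y O' where Y: "open Y" "openin weak_topology O'" "x \<in> Y" "\<mu> \<in> O'" "Y \<times> O' \<subseteq> V"
        using V(1,3) unfolding openin_prod_topology_alt by (metis open_openin)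
      obtain a where a: "a \<in> \<A>" "x \<in> a" "a \<subseteq> Y" using topological_basisE[OF A(2) Y(1,3)] by metis
      obtain b where b: "b \<in> \<R>" "r \<in> b" "b \<subseteq> X" using topological_basisE[OF R(2) V(2,4)] by metis
      obtain w where w: "w \<in> \<W>" "\<mu> \<in> w" "w \<subseteq> O'" using \<W>(3) Y(2,4) unfolding network_on_def by metis
      have "(a \<times> w) \<times> b \<in> \<K>" unfolding \<K>_def using a b w by (intro image_eqI[of _ _ "(a, w, b)"]) auto
      moreover have "(a \<times> w) \<times> b \<subseteq> U"
      proof -
        have "a \<times> w \<subseteq> V" using Sigma_mono[OF a(3) w(3)] Y(5) by (rule order_trans)
        then have "(a \<times> w) \<times> b \<subseteq> V \<times> X" using b(3) by (rule Sigma_mono)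
        then show ?thesis using V(5) by (rule order_trans)
      qed
      moreover have "p \<in> (a \<times> w) \<times> b" using a(2) b(2) w(2) by (simp add: pe)
      ultimately show ?thesis by (intro bexI[of _ "(a \<times> w) \<times> b"] conjI)
    qed
    then have "U = \<Union> {K \<in> \<K>. K \<subseteq> U}" by (intro equalityI subsetI) (simp_all, blast+)
    moreover have "\<Union> {K \<in> \<K>. K \<subseteq> U} \<in> sets ?M"
      using KM cK by (intro sets.countable_Union) (auto intro: countable_subset[OF _ cK])
    ultimately show ?thesis by simp
  qed
  then have "sigma_sets (space ?M) {U. openin ?T U} \<subseteq> sets ?M"
    by (intro sets.sigma_sets_subset) auto
  then show ?thesis using assms unfolding borel_sets_def sp by blast
qed

section \<open>Parametrizing laws by Baire space\<close>

definition unit_law :: "real measure" where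
  "unit_law = uniform_measure lborel {0<..<1}"

lemma unit_law: "prob_space unit_law" "sets unit_law = sets borel" "unit_law \<in> space (prob_algebra borel)"
proof -
  show p: "prob_space unit_law"
    unfolding unit_law_def by (rule prob_space_uniform_measure) simp_all
  show s: "sets unit_law = sets borel" by (simp add: unit_law_def)
  show "unit_law \<in> space (prob_algebra borel)" using p s by (simp add: space_prob_algebra)
qed

text \<open>The generalized inverse of a distribution function, which enters only through its values \<open>y\<close> on an
enumeration of the rational numbers. It is defined for arbitrary \<open>y\<close>, so that all sequences parametrize laws.\<close>

definition quantile :: "(nat \<Rightarrow> real) \<Rightarrow> real \<Rightarrow> real" where
  "quantile y u = real_of_ereal (SUP n. if y n < u then ereal (real_of_rat (from_nat n)) else -\<infinity>)"

lemma fun_coord_measurable: "(\<lambda>y :: nat \<Rightarrow> 'e::polish_space. y n) \<in> borel_measurable borel"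
  by (intro borel_measurable_continuous_onI continuous_on_product_coordinates)

lemma quantile_measurable: "(\<lambda>(y, u). quantile y u) \<in> measurable (borel \<Otimes>\<^sub>M borel) borel"
proof -
  have [measurable]: "(\<lambda>p :: (nat \<Rightarrow> real) \<times> real. fst p n) \<in> borel_measurable (borel \<Otimes>\<^sub>M borel)" for n
    by (rule measurable_compose[OF measurable_fst fun_coord_measurable])
  show ?thesis
    unfolding quantile_def case_prod_beta by measurable
qed

lemma quantile_section_measurable: "quantile y \<in> borel_measurable borel"
  unfolding quantile_def[abs_def] by measurable

lemma quantile_le_iff:
  assumes M: "real_distribution M" and u: "0 < u" "u < 1"
  shows "quantile (\<lambda>n. cdf M (real_of_rat (from_nat n))) u \<le> t \<longleftrightarrow> u \<le> cdf M t"
proof -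
  interpret real_distribution M by fact
  define s where "s n = (if cdf M (real_of_rat (from_nat n)) < u then ereal (real_of_rat (from_nat n)) else -\<infinity>)" for n
  have sq: "s (to_nat q) = (if cdf M (real_of_rat q) < u then ereal (real_of_rat q) else -\<infinity>)" for q :: rat
    by (simp add: s_def)
  have "\<forall>\<^sub>F x in at_bot. cdf M x < u"
    using order_tendstoD(2)[OF cdf_lim_at_bot, of u] u by simp
  then obtain x0 where x0: "\<And>x. x \<le> x0 \<Longrightarrow> cdf M x < u" unfolding eventually_at_bot_linorder by metis
  obtain q0 where q0: "real_of_rat q0 < x0" using of_rat_dense[of "x0 - 1" x0] by auto
  have "\<forall>\<^sub>F x in at_top. u < cdf M x"
    using order_tendstoD(1)[OF cdf_lim_at_top_prob, of u] u by simp
  then obtain x1 where x1: "\<And>x. x1 \<le> x \<Longrightarrow> u < cdf M x" unfolding eventually_at_top_linorder by metis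
  have "s n \<le> ereal x1" for n
    using x1[of "real_of_rat (from_nat n)"] by (auto simp: s_def) (meson less_asym not_le_imp_less less_imp_le)
  then have "(SUP n. s n) \<le> ereal x1" by (rule SUP_least)
  moreover have "ereal (real_of_rat q0) \<le> (SUP n. s n)"
    using SUP_upper[of "to_nat q0" UNIV s] x0[of "real_of_rat q0"] q0 by (simp add: sq)
  ultimately obtain r where r: "(SUP n. s n) = ereal r" by (cases "SUP n. s n") auto
  have q: "quantile (\<lambda>n. cdf M (real_of_rat (from_nat n))) u = r"
    unfolding quantile_def s_def[symmetric] r by simp
  show ?thesis
    unfolding q
  proof
    assume "r \<le> t"
    show "u \<le> cdf M t"
    proof (rule ccontr)
      assume "\<not> u \<le> cdf M t"
      moreover have "(cdf M \<longlongrightarrow> cdf M t) (at_right t)"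
        using cdf_is_right_cont[of t] by (simp add: continuous_within)
      ultimately have "\<forall>\<^sub>F x in at_right t. cdf M x < u" by (intro order_tendstoD(2)) (simp_all add: not_le)
      then obtain b where b: "t < b" "\<And>x. t < x \<Longrightarrow> x < b \<Longrightarrow> cdf M x < u"
        unfolding eventually_at_right_field by metis
      obtain p where p: "t < real_of_rat p" "real_of_rat p < b" using of_rat_dense[OF b(1)] by metis
      have "ereal (real_of_rat p) \<le> (SUP n. s n)"
        using SUP_upper[of "to_nat p" UNIV s] b(2)[OF p] by (simp add: sq)
      then show False using p \<open>r \<le> t\<close> by (simp add: r)
    qed
  next
    assume ut: "u \<le> cdf M t"
    have "s n \<le> ereal t" for n
    proof (cases "cdf M (real_of_rat (from_nat n)) < u")
      case True
      then have "real_of_rat (from_nat n) \<le> t"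
        using ut cdf_nondecreasing[of t "real_of_rat (from_nat n)"] by linarith
      then show ?thesis by (simp add: s_def)
    qed (simp add: s_def)
    then have "(SUP n. s n) \<le> ereal t" by (rule SUP_least)
    then show "r \<le> t" by (simp add: r)
  qed
qed

text \<open>By \<open>quantile_le_iff\<close>, the quantile function of a uniform random variable is at most \<open>t\<close> with
probability \<open>cdf \<mu> t\<close>.\<close>

lemma quantile_law:
  assumes mu: "\<mu> \<in> space (prob_algebra borel)"
  shows "distr unit_law borel (quantile (\<lambda>n. cdf \<mu> (real_of_rat (from_nat n)))) = \<mu>"
proof (rule cdf_unique)
  let ?y = "\<lambda>n. cdf \<mu> (real_of_rat (from_nat n))"
  interpret U: prob_space unit_law by (rule unit_law)
  note qm = quantile_section_measurable[of ?y]
  have qm': "quantile ?y \<in> borel_measurable unit_law"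
    unfolding measurable_cong_sets[OF unit_law(2) refl] by (rule qm)
  then show "real_distribution (distr unit_law borel (quantile ?y))" by (rule U.real_distribution_distr)
  show M: "real_distribution \<mu>"
    using prob_algebraD(1,3)[OF mu] by (simp add: real_distribution_def real_distribution_axioms_def)
  interpret M: real_distribution \<mu> by fact
  show "cdf (distr unit_law borel (quantile ?y)) = cdf \<mu>"
  proof
    fix t
    have F: "0 \<le> cdf \<mu> t" "cdf \<mu> t \<le> 1" by (rule M.cdf_nonneg, rule M.cdf_bounded_prob)
    have "emeasure (distr unit_law borel (quantile ?y)) {..t} = emeasure unit_law (quantile ?y -` {..t})"
    proof -
      have "space unit_law = UNIV" using sets_eq_imp_space_eq[OF unit_law(2)] by (simp only: space_borel)
      then show ?thesis by (simp only: emeasure_distr[OF qm' borel_closed[OF closed_atMost]] Int_UNIV_right)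
    qed
    also have "\<dots> = emeasure lborel ({0<..<1} \<inter> quantile ?y -` {..t}) / emeasure lborel {0<..<1::real}"
    proof -
      have "quantile ?y -` {..t} \<in> sets lborel"
        using measurable_sets[OF qm borel_closed[OF closed_atMost]] by (simp only: space_borel Int_UNIV_right sets_lborel)
      then show ?thesis unfolding unit_law_def by (intro emeasure_uniform_measure) simp_all
    qed
    also have "{0<..<1} \<inter> quantile ?y -` {..t} = {0<..<1} \<inter> {..cdf \<mu> t}"
    proof (intro set_eqI)
      fix u
      show "u \<in> {0<..<1} \<inter> quantile ?y -` {..t} \<longleftrightarrow> u \<in> {0<..<1} \<inter> {..cdf \<mu> t}"
        using quantile_le_iff[OF M, of u t] by (simp only: Int_iff vimage_eq atMost_iff greaterThanLessThan_iff) metis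
    qed
    also have "emeasure lborel ({0<..<1} \<inter> {..cdf \<mu> t}) = ennreal (cdf \<mu> t)"
    proof (cases "cdf \<mu> t = 1")
      case True
      then have "{0<..<1} \<inter> {..cdf \<mu> t} = {0<..<1}" by auto
      then show ?thesis by (simp add: True)
    next
      case False
      then have "{0<..<1} \<inter> {..cdf \<mu> t} = {0<..cdf \<mu> t}" using F by auto
      then show ?thesis using F by simp
    qed
    finally have "emeasure (distr unit_law borel (quantile ?y)) {..t} = ennreal (cdf \<mu> t)"
      using divide_ennreal[OF F(1), of 1] by simp
    then show "cdf (distr unit_law borel (quantile ?y)) t = cdf \<mu> t"
      unfolding cdf_def2[of "distr unit_law borel (quantile ?y)"] measure_def using F by simp
  qed
qed

lemma path_real_retract:
  "\<exists>R\<in>measurable (path_space :: 'e::polish_space path measure) (borel :: real measure).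
     \<exists>D\<in>measurable borel path_space. \<forall>x\<in>paths. D (R x) = x"
proof -
  obtain enc dec where ed: "enc \<in> measurable (path_space :: 'e path measure) (borel :: (nat \<Rightarrow> 'e) measure)"
    "dec \<in> measurable borel path_space" "\<forall>x\<in>paths. dec (enc x) = x"
    using path_space_retract by (elim bexE)
  obtain r g where rg: "r \<in> measurable (borel :: (nat \<Rightarrow> 'e) measure) baire" "g \<in> measurable baire borel" "\<forall>x. g (r x) = x"
    using polish_baire_retract by (elim bexE)
  obtain e c where ec: "e \<in> measurable baire (borel :: real measure)" "c \<in> measurable borel baire" "\<forall>w. c (e w) = w"
    using baire_real_retract by (elim bexE)
  have Rm: "(\<lambda>x. e (r (enc x))) \<in> measurable path_space borel"
    by (intro measurable_compose[OF _ ec(1)] measurable_compose[OF _ rg(1)] ed(1))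
  have Dm: "(\<lambda>u. dec (g (c u))) \<in> measurable borel path_space"
    by (intro measurable_compose[OF _ ed(2)] measurable_compose[OF _ rg(2)] ec(2))
  have "dec (g (c (e (r (enc x))))) = x" if "x \<in> paths" for x
    unfolding ec(3)[rule_format] rg(3)[rule_format] by (rule ed(3)[rule_format, OF that])
  then show ?thesis by (intro bexI[OF _ Rm] bexI[OF _ Dm] ballI)
qed

text \<open>Encode the path as a real number, represent the law of the code by its quantile function, and decode.\<close>

lemma path_law_parametrization:
  "\<exists>h\<in>measurable (borel :: (nat \<Rightarrow> real) measure) (prob_algebra (path_space :: 'e::polish_space path measure)).
     \<forall>\<mu>\<in>path_laws. \<exists>y. h y = \<mu>"
proof -
  obtain R D where RD: "R \<in> measurable (path_space :: 'e path measure) (borel :: real measure)"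
    "D \<in> measurable borel path_space" "\<forall>x\<in>paths. D (R x) = x"
    using path_real_retract by (elim bexE)
  define h where "h y = distr unit_law path_space (\<lambda>u. D (quantile y u))" for y
  have "h \<in> measurable borel (prob_algebra path_space)"
    unfolding h_def
  proof (rule measurable_distr_prob_space2)
    show "(\<lambda>y. unit_law) \<in> measurable borel (prob_algebra borel)"
      using unit_law(3) by (rule measurable_const)
    show "(\<lambda>(y, u). D (quantile y u)) \<in> measurable (borel \<Otimes>\<^sub>M borel) path_space"
      using measurable_compose[OF quantile_measurable RD(2)] by (simp add: case_prod_beta)
  qed
  moreover have "\<exists>y. h y = \<mu>" if mu: "\<mu> \<in> path_laws" for \<mu>
  proof -
    note sets_mu = prob_algebraD(1)[OF mu]
    have Rm: "R \<in> measurable \<mu> borel"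
      unfolding measurable_cong_sets[OF sets_mu refl] by (rule RD(1))
    define y where "y n = cdf (distr \<mu> borel R) (real_of_rat (from_nat n))" for n
    have "distr \<mu> borel R \<in> space (prob_algebra borel)"
      using prob_space.prob_space_distr[OF prob_algebraD(3)[OF mu] Rm] by (simp add: space_prob_algebra)
    then have q: "distr unit_law borel (quantile y) = distr \<mu> borel R"
      unfolding y_def by (rule quantile_law)
    have qm: "quantile y \<in> borel_measurable unit_law"
      unfolding measurable_cong_sets[OF unit_law(2) refl] by (rule quantile_section_measurable)
    have "h y = distr (distr unit_law borel (quantile y)) path_space D"
      unfolding h_def using distr_distr[OF RD(2) qm] by (simp add: comp_def)
    also have "\<dots> = distr \<mu> path_space (\<lambda>x. D (R x))"
      unfolding q using distr_distr[OF RD(2) Rm] by (simp add: comp_def)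
    also have "\<dots> = distr \<mu> \<mu> (\<lambda>x. x)"
      using sets_mu RD(3) prob_algebraD(2)[OF mu] by (intro distr_cong) (simp_all add: space_path_space)
    also have "\<dots> = \<mu>" by (rule distr_id)
    finally show ?thesis by metis
  qed
  ultimately show ?thesis by (intro bexI[where x = h] ballI)
qed

instance prod :: (polish_space, polish_space) polish_space ..

lemma law_real_parametrization:
  "\<exists>h\<in>measurable baire (prob_algebra (path_space :: 'e::polish_space path measure)). \<exists>k\<in>measurable baire (borel :: real measure).
     \<forall>\<mu>\<in>path_laws. \<forall>r. \<exists>w. h w = \<mu> \<and> k w = r"
proof -
  obtain h where h: "h \<in> measurable (borel :: (nat \<Rightarrow> real) measure) (prob_algebra (path_space :: 'e path measure))"
     "\<forall>\<mu>\<in>path_laws. \<exists>y. h y = \<mu>"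
    using path_law_parametrization[where 'e = 'e] by (elim bexE)
  obtain r g where rg: "r \<in> measurable (borel :: ((nat \<Rightarrow> real) \<times> real) measure) baire" "g \<in> measurable baire borel" "\<forall>x. g (r x) = x"
    using polish_baire_retract[where 'e = "(nat \<Rightarrow> real) \<times> real"] by (elim bexE)
  have g': "g \<in> measurable baire (borel \<Otimes>\<^sub>M borel)" unfolding borel_prod by (rule rg(2))
  have hm: "(\<lambda>w. h (fst (g w))) \<in> measurable baire (prob_algebra path_space)"
    by (intro measurable_compose[OF _ h(1)] measurable_compose[OF g' measurable_fst])
  have km: "(\<lambda>w. snd (g w)) \<in> measurable baire borel"
    by (rule measurable_compose[OF g' measurable_snd])
  have "\<exists>w. h (fst (g w)) = \<mu> \<and> snd (g w) = s" if mu: "\<mu> \<in> path_laws" for \<mu> s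
  proof -
    obtain y where "h y = \<mu>" using bspec[OF h(2) mu] ..
    then show ?thesis by (intro exI[of _ "r (y, s)"]) (simp add: rg(3)[rule_format])
  qed
  then show ?thesis by (intro bexI[OF _ hm] bexI[OF _ km] ballI allI)
qed

lemma borel_sets_real_product:
  "borel_sets (prod_topology (euclidean :: 'e::polish_space topology) euclideanreal) = sets borel"
  unfolding borel_sets_def euclidean_product_topology by (simp add: sets_borel)

text \<open>Replacing laws and real numbers by their codes in Baire space turns projections along \<open>B\<close> into
projections along Baire space, to which \<open>jankov_von_neumann\<close> applies. Replacing Baire space by
the real line in turn gives the analytic representation of the domain.\<close>

lemma analytic_law_selection:
  fixes B :: "(('e::polish_space \<times> 'e path measure) \<times> real) set"
  assumes B: "B \<in> sets ((borel \<Otimes>\<^sub>M prob_algebra path_space) \<Otimes>\<^sub>M borel)"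
  defines "D \<equiv> {x. \<exists>\<mu>. (x, \<mu>) \<in> fst ` B}"
  shows "analytic_in euclidean D" "D \<in> universal_sets borel"
    "\<exists>\<nu>\<in>measurable (univ_space borel) (prob_algebra path_space). \<forall>x\<in>D. (x, \<nu> x) \<in> fst ` B"
proof -
  obtain h k where hk: "h \<in> measurable baire (prob_algebra (path_space :: 'e path measure))"
    "k \<in> measurable baire (borel :: real measure)" "\<forall>\<mu>\<in>path_laws. \<forall>r. \<exists>w. h w = \<mu> \<and> k w = r"
    using law_real_parametrization[where 'e = 'e] by (elim bexE)
  obtain e c where ec: "e \<in> measurable baire (borel :: real measure)" "c \<in> measurable borel baire" "\<forall>w. c (e w) = w"
    using baire_real_retract by (elim bexE)
  define B' where "B' = {(x, w). ((x, h w), k w) \<in> B}"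
  have "(\<lambda>p. ((fst p, h (snd p)), k (snd p))) \<in>
      measurable ((borel :: 'e measure) \<Otimes>\<^sub>M baire) ((borel \<Otimes>\<^sub>M prob_algebra path_space) \<Otimes>\<^sub>M borel)"
    by (intro measurable_Pair measurable_fst measurable_compose[OF measurable_snd hk(1)] measurable_compose[OF measurable_snd hk(2)])
  from measurable_sets[OF this B] have B': "B' \<in> sets (borel \<Otimes>\<^sub>M baire)"
    unfolding B'_def vimage_def space_pair_measure case_prod_beta space_borel space_baire by simp
  have "B \<subseteq> (UNIV \<times> path_laws) \<times> UNIV"
    using sets.sets_into_space[OF B] by (simp add: space_pair_measure)
  then have D_eq: "D = {x \<in> space borel. \<exists>w. (x, w) \<in> B'}"
  proof -
    have "(\<exists>\<mu>. (x, \<mu>) \<in> fst ` B) \<longleftrightarrow> (\<exists>w. ((x, h w), k w) \<in> B)" for x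
    proof
      assume "\<exists>\<mu>. (x, \<mu>) \<in> fst ` B"
      then obtain \<mu> r where b: "((x, \<mu>), r) \<in> B" by auto
      then have "\<mu> \<in> path_laws" using \<open>B \<subseteq> (UNIV \<times> path_laws) \<times> UNIV\<close> by auto
      then obtain w where "h w = \<mu>" "k w = r" using hk(3) by metis
      with b show "\<exists>w. ((x, h w), k w) \<in> B" by (intro exI[of _ w]) simp
    next
      assume "\<exists>w. ((x, h w), k w) \<in> B"
      then obtain w where "((x, h w), k w) \<in> B" ..
      then show "\<exists>\<mu>. (x, \<mu>) \<in> fst ` B" by (intro exI[of _ "h w"] image_eqI[of _ _ "((x, h w), k w)"]) simp_all
    qed
    then show ?thesis by (simp add: D_def B'_def)
  qed
  show "D \<in> universal_sets borel" unfolding D_eq by (rule jankov_von_neumann(1)[OF B'])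
  have "(\<lambda>p. (fst p, c (snd p))) \<in> measurable ((borel :: 'e measure) \<Otimes>\<^sub>M borel) (borel \<Otimes>\<^sub>M baire)"
    by (intro measurable_Pair measurable_fst measurable_compose[OF measurable_snd ec(2)])
  from measurable_sets[OF this B'] have "{(x, r). (x, c r) \<in> B'} \<in> sets (borel \<Otimes>\<^sub>M borel)"
    unfolding vimage_def space_pair_measure case_prod_beta space_borel by simp
  then have "{(x, r). (x, c r) \<in> B'} \<in> borel_sets (prod_topology euclidean euclideanreal)"
    unfolding borel_sets_real_product borel_prod .
  moreover have "D = fst ` {(x, r). (x, c r) \<in> B'}"
  proof -
    have "(\<exists>w. (x, w) \<in> B') \<longleftrightarrow> (\<exists>r. (x, c r) \<in> B')" for x
      using ec(3) by metis
    then show ?thesis unfolding D_eq by (auto simp: image_iff)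
  qed
  ultimately show "analytic_in euclidean D" unfolding analytic_in_def by metis
  obtain s where s: "s \<in> measurable (univ_space borel) baire"
    "\<forall>x\<in>space borel. (\<exists>w. (x, w) \<in> B') \<longrightarrow> (x, s x) \<in> B'"
    using jankov_von_neumann(2)[OF B'] by (elim bexE)
  have "(x, h (s x)) \<in> fst ` B" if "x \<in> D" for x
  proof -
    have "((x, h (s x)), k (s x)) \<in> B" using s(2) that by (simp add: D_eq B'_def)
    then show ?thesis by (rule image_eqI[rotated]) simp
  qed
  moreover have "(\<lambda>x. h (s x)) \<in> measurable (univ_space borel) (prob_algebra path_space)"
    by (rule measurable_compose[OF s(1) hk(1)])
  ultimately show "\<exists>\<nu>\<in>measurable (univ_space borel) (prob_algebra path_space). \<forall>x\<in>D. (x, \<nu> x) \<in> fst ` B"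
    by (intro bexI[where x = "\<lambda>x. h (s x)"] ballI)
qed

section \<open>Expectations with values in the extended reals\<close>

text \<open>Completion does not change nonnegative integrals, so expectations can be studied as functions of the
law itself, a point of the Giry monad.\<close>

lemma expect_eq:
  "expect \<mu> Y = (if (\<integral>\<^sup>+\<omega>. e2ennreal (max 0 (Y \<omega>)) \<partial>\<mu>) = \<infinity> then \<infinity>
     else enn2ereal (\<integral>\<^sup>+\<omega>. e2ennreal (max 0 (Y \<omega>)) \<partial>\<mu>) - enn2ereal (\<integral>\<^sup>+\<omega>. e2ennreal (max 0 (- Y \<omega>)) \<partial>\<mu>))"
  by (simp add: expect_def nn_integral_completion Let_def)

lemma expect_measurable:
  assumes [measurable]: "G \<in> borel_measurable M"
  shows "(\<lambda>\<mu>. expect \<mu> G) \<in> borel_measurable (prob_algebra M)"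
proof -
  have [measurable]: "(\<lambda>\<mu>. \<integral>\<^sup>+\<omega>. e2ennreal (max 0 (G \<omega>)) \<partial>\<mu>) \<in> borel_measurable (prob_algebra M)"
    by (rule measurable_prob_algebra_nn_integral) measurable
  have [measurable]: "(\<lambda>\<mu>. \<integral>\<^sup>+\<omega>. e2ennreal (max 0 (- G \<omega>)) \<partial>\<mu>) \<in> borel_measurable (prob_algebra M)"
    by (rule measurable_prob_algebra_nn_integral) measurable
  show ?thesis unfolding expect_eq by measurable
qed

lemma expect_mono:
  assumes "\<And>\<omega>. Y \<omega> \<le> Z \<omega>"
  shows "expect \<mu> Y \<le> expect \<mu> Z"
proof -
  have p: "(\<integral>\<^sup>+\<omega>. e2ennreal (max 0 (Y \<omega>)) \<partial>\<mu>) \<le> (\<integral>\<^sup>+\<omega>. e2ennreal (max 0 (Z \<omega>)) \<partial>\<mu>)"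
    using assms by (intro nn_integral_mono e2ennreal_mono max.mono) simp_all
  have n: "(\<integral>\<^sup>+\<omega>. e2ennreal (max 0 (- Z \<omega>)) \<partial>\<mu>) \<le> (\<integral>\<^sup>+\<omega>. e2ennreal (max 0 (- Y \<omega>)) \<partial>\<mu>)"
    using assms by (intro nn_integral_mono e2ennreal_mono max.mono) simp_all
  show ?thesis
  proof (cases "(\<integral>\<^sup>+\<omega>. e2ennreal (max 0 (Z \<omega>)) \<partial>\<mu>) = \<infinity>")
    case True
    then show ?thesis by (simp add: expect_eq[of \<mu> Z])
  next
    case False
    then have "(\<integral>\<^sup>+\<omega>. e2ennreal (max 0 (Y \<omega>)) \<partial>\<mu>) \<noteq> \<infinity>" using p by (auto simp: top_unique)
    then show ?thesis
      using False p n unfolding expect_eq by (auto intro!: ereal_minus_mono simp: less_eq_ennreal.rep_eq)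
  qed
qed

text \<open>The bound that \<open>1/(k+1)\<close>-optimality puts on the cost when the value is \<open>y\<close>, with the convention
\<open>-\<infinity> + \<epsilon> = -1/\<epsilon>\<close>.\<close>

definition relaxed :: "nat \<Rightarrow> ereal \<Rightarrow> ereal" where
  "relaxed k y = (if y = -\<infinity> then ereal (- real (Suc k)) else y + ereal (1 / real (Suc k)))"

lemma relaxed_measurable [measurable]: "relaxed k \<in> borel_measurable borel"
  unfolding relaxed_def[abs_def] by measurable

lemma e2ennreal_max_0_ereal: "e2ennreal (max 0 (ereal r)) = ennreal r"
proof (cases "0 \<le> r")
  case True
  then have "max 0 (ereal r) = ereal r" by (simp add: max_def)
  then show ?thesis by simp
next
  case False
  then have "max 0 (ereal r) = 0" by (simp add: max_def)
  then show ?thesis using False by (simp add: ennreal_neg)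
qed

lemma relaxed_pos:
  assumes "y \<noteq> \<infinity>"
  shows "e2ennreal (max 0 (relaxed k y)) \<le> e2ennreal (max 0 y) + ennreal (1 / real (Suc k))"
proof (cases y)
  case (real r)
  have "relaxed k y = ereal (r + 1 / real (Suc k))" by (simp add: relaxed_def real)
  then have "e2ennreal (max 0 (relaxed k y)) = ennreal (r + 1 / real (Suc k))"
    by (simp only: e2ennreal_max_0_ereal)
  also have "\<dots> \<le> ennreal (max 0 r + 1 / real (Suc k))" by (intro ennreal_leI) simp
  also have "\<dots> = ennreal (max 0 r) + ennreal (1 / real (Suc k))" by (rule ennreal_plus) simp_all
  also have "ennreal (max 0 r) = e2ennreal (max 0 y)"
    unfolding real e2ennreal_max_0_ereal by (cases "0 \<le> r") (simp_all add: max_def ennreal_neg)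
  finally show ?thesis .
next
  case MInf
  have "max 0 (relaxed k y) = 0" by (simp add: relaxed_def MInf max_def)
  then show ?thesis by simp
qed (use assms in simp)

lemma relaxed_neg_finite: "e2ennreal (max 0 (- relaxed k (ereal r))) = ennreal (- r - 1 / real (Suc k))"
proof -
  have "- relaxed k (ereal r) = ereal (- r - 1 / real (Suc k))" by (simp add: relaxed_def)
  then show ?thesis by (simp only: e2ennreal_max_0_ereal)
qed

lemma relaxed_neg_incseq: "incseq (\<lambda>k. e2ennreal (max 0 (- relaxed k y)))"
proof (rule monoI)
  fix j k :: nat assume jk: "j \<le> k"
  show "e2ennreal (max 0 (- relaxed j y)) \<le> e2ennreal (max 0 (- relaxed k y))"
  proof (cases y)
    case (real r)
    have "1 / real (Suc k) \<le> 1 / real (Suc j)" using jk by (simp add: frac_le)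
    then show ?thesis unfolding real relaxed_neg_finite by (intro ennreal_leI) auto
  next
    case MInf
    then show ?thesis using jk by (intro e2ennreal_mono max.mono) (simp_all add: relaxed_def)
  qed (simp add: relaxed_def)
qed

text \<open>Together with monotonicity in \<open>k\<close>, this covers the value \<open>-\<infinity>\<close>, where the bound \<open>-(k+1)\<close> decreases to it.\<close>

lemma relaxed_neg_tendsto: "(\<lambda>k. e2ennreal (max 0 (- relaxed k y))) \<longlonglongrightarrow> e2ennreal (max 0 (- y))"
proof (cases y)
  case (real r)
  have "(\<lambda>k. - r - 1 / real (Suc k)) \<longlonglongrightarrow> - r - 0"
    using LIMSEQ_inverse_real_of_nat by (intro tendsto_diff tendsto_const) (simp add: inverse_eq_divide)
  then have "(\<lambda>k. e2ennreal (max 0 (- relaxed k y))) \<longlonglongrightarrow> ennreal (- r)"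
    unfolding real relaxed_neg_finite by (intro tendsto_ennrealI) simp
  moreover have "e2ennreal (max 0 (- y)) = ennreal (- r)" by (simp add: real e2ennreal_max_0_ereal)
  ultimately show ?thesis by simp
next
  case MInf
  have "(\<lambda>k. of_nat (Suc k) :: ennreal) \<longlonglongrightarrow> \<top>"
    using of_nat_tendsto_top_ennreal by (rule LIMSEQ_Suc)
  moreover have "e2ennreal (max 0 (- relaxed k y)) = of_nat (Suc k)" for k
  proof -
    have "- relaxed k y = ereal (real (Suc k))" by (simp add: relaxed_def MInf)
    then show ?thesis by (simp only: e2ennreal_max_0_ereal ennreal_of_nat_eq_real_of_nat)
  qed
  moreover have "e2ennreal (max 0 (- y)) = \<top>" by (simp add: MInf max_def)
  ultimately show ?thesis by simp
next
  case PInf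
  then show ?thesis by (simp add: relaxed_def max_def)
qed

text \<open>If the positive part of \<open>Y\<close> is integrable, then \<open>Y\<close> is almost surely less than \<open>\<infinity>\<close>, so that the bound on \<open>Z k\<close> holds
almost surely. The positive parts are then bounded by that of \<open>Y\<close> plus \<open>1/(k+1)\<close>. The negative parts are bounded below by those of
the relaxed variables, which increase to that of \<open>Y\<close>.\<close>

lemma le_expect_of_relaxed:
  assumes mu: "prob_space \<mu>" and Y: "Y \<in> borel_measurable (completion \<mu>)"
    and Z: "\<And>k \<omega>. Y \<omega> \<noteq> \<infinity> \<Longrightarrow> Z k \<omega> \<le> relaxed k (Y \<omega>)"
    and c: "\<And>k. c \<le> expect \<mu> (Z k)"
  shows "c \<le> expect \<mu> Y"
proof (cases "(\<integral>\<^sup>+\<omega>. e2ennreal (max 0 (Y \<omega>)) \<partial>completion \<mu>) = \<infinity>")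
  case True
  then show ?thesis by (simp add: expect_def)
next
  case False
  let ?N = "completion \<mu>"
  interpret prob_space ?N using mu by (rule prob_space.prob_space_completion)
  define p where "p = (\<integral>\<^sup>+\<omega>. e2ennreal (max 0 (Y \<omega>)) \<partial>?N)"
  define n where "n = (\<integral>\<^sup>+\<omega>. e2ennreal (max 0 (- Y \<omega>)) \<partial>?N)"
  define m where "m k = (\<integral>\<^sup>+\<omega>. e2ennreal (max 0 (- relaxed k (Y \<omega>))) \<partial>?N)" for k
  define e where "e k = 1 / real (Suc k)" for k
  have e0: "0 \<le> e k" for k by (simp add: e_def)
  note [measurable] = Y
  have "AE \<omega> in ?N. e2ennreal (max 0 (Y \<omega>)) \<noteq> \<infinity>"
    using False by (intro nn_integral_PInf_AE) measurable
  then have AE: "AE \<omega> in ?N. Y \<omega> \<noteq> \<infinity>" by eventually_elim (auto simp: max_def)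
  have pk: "(\<integral>\<^sup>+\<omega>. e2ennreal (max 0 (Z k \<omega>)) \<partial>?N) \<le> p + ennreal (e k)" for k
  proof -
    have "(\<integral>\<^sup>+\<omega>. e2ennreal (max 0 (Z k \<omega>)) \<partial>?N) \<le> (\<integral>\<^sup>+\<omega>. e2ennreal (max 0 (Y \<omega>)) + ennreal (e k) \<partial>?N)"
    proof (rule nn_integral_mono_AE)
      show "AE \<omega> in ?N. e2ennreal (max 0 (Z k \<omega>)) \<le> e2ennreal (max 0 (Y \<omega>)) + ennreal (e k)"
        using AE
      proof eventually_elim
        case (elim \<omega>)
        have "e2ennreal (max 0 (Z k \<omega>)) \<le> e2ennreal (max 0 (relaxed k (Y \<omega>)))"
          using Z[OF elim] by (intro e2ennreal_mono max.mono) simp_all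
        also have "\<dots> \<le> e2ennreal (max 0 (Y \<omega>)) + ennreal (e k)"
          unfolding e_def by (rule relaxed_pos[OF elim])
        finally show ?case .
      qed
    qed
    also have "\<dots> = p + ennreal (e k)"
      unfolding p_def by (subst nn_integral_add) (simp_all add: prob_space.emeasure_space_1[OF mu])
    finally show ?thesis .
  qed
  have nk: "m k \<le> (\<integral>\<^sup>+\<omega>. e2ennreal (max 0 (- Z k \<omega>)) \<partial>?N)" for k
    unfolding m_def
  proof (rule nn_integral_mono_AE)
    show "AE \<omega> in ?N. e2ennreal (max 0 (- relaxed k (Y \<omega>))) \<le> e2ennreal (max 0 (- Z k \<omega>))"
      using AE by eventually_elim (intro e2ennreal_mono max.mono order_refl, simp add: Z)
  qed
  have p_fin: "p + ennreal (e k) \<noteq> \<infinity>" for k using False by (simp add: p_def)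
  have ck: "c \<le> (enn2ereal p + ereal (e k)) - enn2ereal (m k)" for k
  proof -
    let ?p = "\<integral>\<^sup>+\<omega>. e2ennreal (max 0 (Z k \<omega>)) \<partial>?N" and ?n = "\<integral>\<^sup>+\<omega>. e2ennreal (max 0 (- Z k \<omega>)) \<partial>?N"
    have "?p \<noteq> \<infinity>" using pk[of k] p_fin[of k] by (metis infinity_ennreal_def top_unique)
    then have "expect \<mu> (Z k) = enn2ereal ?p - enn2ereal ?n" by (simp add: expect_def)
    also have "\<dots> \<le> enn2ereal (p + ennreal (e k)) - enn2ereal (m k)"
      using pk[of k] nk[of k] by (intro ereal_minus_mono) (simp_all add: less_eq_ennreal.rep_eq)
    also have "enn2ereal (p + ennreal (e k)) = enn2ereal p + ereal (e k)"
      using e0[of k] by (simp add: plus_ennreal.rep_eq enn2ereal_ennreal)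
    finally show ?thesis using c[of k] by (rule order_trans[rotated])
  qed
  have "m \<longlonglongrightarrow> n"
    unfolding m_def n_def
  proof (rule nn_integral_LIMSEQ)
    show "incseq (\<lambda>k \<omega>. e2ennreal (max 0 (- relaxed k (Y \<omega>))))"
      using relaxed_neg_incseq unfolding incseq_def le_fun_def by simp
    show "(\<lambda>k. e2ennreal (max 0 (- relaxed k (Y \<omega>)))) \<longlonglongrightarrow> e2ennreal (max 0 (- Y \<omega>))" for \<omega>
      by (rule relaxed_neg_tendsto)
  qed measurable
  then have mt: "(\<lambda>k. enn2ereal (m k)) \<longlonglongrightarrow> enn2ereal n" by (rule tendsto_enn2erealI)
  obtain r where r: "enn2ereal p = ereal r"
    using False enn2ereal_nonneg[of p] by (cases "enn2ereal p") (auto simp: p_def[symmetric] enn2ereal_eq_top_iff)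
  have "(\<lambda>k. ereal (r + e k)) \<longlonglongrightarrow> ereal (r + 0)"
    unfolding e_def using LIMSEQ_inverse_real_of_nat
    by (intro tendsto_ereal tendsto_add tendsto_const) (simp add: inverse_eq_divide)
  then have "(\<lambda>k. ereal (r + e k) - enn2ereal (m k)) \<longlonglongrightarrow> ereal (r + 0) - enn2ereal n"
    using mt by (rule tendsto_diff_ereal_general) simp
  then have "c \<le> ereal (r + 0) - enn2ereal n"
    by (rule LIMSEQ_le_const) (use ck r in auto)
  then show ?thesis using False r by (simp add: expect_def p_def[symmetric] n_def[symmetric])
qed

text \<open>By right-continuity the state at a random time is the limit of the states at random times with countably many
values.\<close>

lemma state_at_measurable:
  assumes "random_time \<tau>"
  shows "state_at \<iota> \<tau> \<in> measurable path_space (borel :: 'e::polish_space measure)"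
proof -
  have [measurable]: "\<tau> \<in> borel_measurable path_space" using assms by (simp add: random_time_def)
  define T where "T \<omega> = enn2real (\<tau> \<omega>)" for \<omega>
  have [measurable]: "T \<in> borel_measurable path_space" unfolding T_def by measurable
  have T0: "0 \<le> T \<omega>" for \<omega> by (simp add: T_def)
  have "(\<lambda>\<omega>. \<omega> (T \<omega>)) \<in> measurable path_space (borel :: 'e measure)"
  proof (rule borel_measurable_LIMSEQ_metric)
    show "(\<lambda>k. \<omega> (rat_above k (T \<omega>))) \<longlonglongrightarrow> \<omega> (T \<omega>)" if "\<omega> \<in> space path_space" for \<omega>
      using that T0 by (intro path_limit_rat_above) (simp_all add: space_path_space)
    fix k
    define f where "f i \<omega> = \<omega> (max 0 ((of_int i + 1) / real (Suc k)))" for i :: int and \<omega> :: "'e path"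
    have "(\<lambda>\<omega>. f \<lfloor>real (Suc k) * T \<omega>\<rfloor> \<omega>) \<in> measurable path_space borel"
    proof (rule measurable_compose_countable)
      show "f i \<in> measurable path_space borel" for i
        unfolding f_def[abs_def] by (rule path_coord_measurable) simp
    qed measurable
    moreover have "f \<lfloor>real (Suc k) * T \<omega>\<rfloor> \<omega> = \<omega> (rat_above k (T \<omega>))" for \<omega>
      using rat_above_nonneg[OF T0[of \<omega>], of k] by (simp add: f_def rat_above_def)
    ultimately show "(\<lambda>\<omega>. \<omega> (rat_above k (T \<omega>))) \<in> measurable path_space borel" by simp
  qed
  then have [measurable]: "(\<lambda>\<omega>. \<omega> (enn2real (\<tau> \<omega>))) \<in> measurable path_space (borel :: 'e measure)"
    by (simp add: T_def)
  show ?thesis unfolding state_at_def[abs_def] by measurable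
qed

text \<open>The preimage under \<open>f\<close> lies between two measurable sets with the same measure under the law of \<open>X\<close>.\<close>

lemma universally_measurable_compose:
  assumes f: "f \<in> measurable (univ_space N) L" and X: "X \<in> measurable M N" and mu: "\<mu> \<in> space (prob_algebra M)"
  shows "(\<lambda>\<omega>. f (X \<omega>)) \<in> measurable (completion \<mu>) L"
proof (rule measurableI)
  have X': "X \<in> measurable \<mu> N" using X prob_algebraD(1)[OF mu] by (simp cong: measurable_cong_sets)
  note sp = prob_algebraD(2)[OF mu]
  show "f (X \<omega>) \<in> space L" if "\<omega> \<in> space (completion \<mu>)" for \<omega>
    using that measurable_space[OF X'] measurable_space[OF f] by simp
  fix A assume "A \<in> sets L"
  then have "f -` A \<inter> space N \<in> universal_sets N"
    using measurable_sets[OF f] by (simp add: sets_univ_space)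
  moreover have "distr \<mu> N X \<in> space (prob_algebra N)"
    using prob_space.prob_space_distr[OF prob_algebraD(3)[OF mu] X'] by (simp add: space_prob_algebra)
  ultimately have "f -` A \<inter> space N \<in> sets (completion (distr \<mu> N X))" by (simp add: universal_sets_def)
  then obtain S K K' where K: "f -` A \<inter> space N = S \<union> K" "K \<subseteq> K'" "K' \<in> null_sets (distr \<mu> N X)" "S \<in> sets (distr \<mu> N X)"
    by (rule sets_completionE)
  have "(\<lambda>\<omega>. f (X \<omega>)) -` A \<inter> space \<mu> = X -` (f -` A \<inter> space N) \<inter> space \<mu>"
    using measurable_space[OF X'] by auto
  also have "\<dots> = (X -` S \<inter> space \<mu>) \<union> (X -` K \<inter> space \<mu>)" unfolding K(1) by auto
  finally have "(\<lambda>\<omega>. f (X \<omega>)) -` A \<inter> space \<mu> = (X -` S \<inter> space \<mu>) \<union> (X -` K \<inter> space \<mu>)" .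
  moreover have "X -` K' \<inter> space \<mu> \<in> null_sets \<mu>"
    using K(3) X' by (simp add: null_sets_distr_iff)
  moreover have "X -` S \<inter> space \<mu> \<in> sets \<mu>" using K(4) X' by (simp add: measurable_sets)
  ultimately have "(\<lambda>\<omega>. f (X \<omega>)) -` A \<inter> space \<mu> \<in> sets (completion \<mu>)"
    using K(2) by (intro sets_completionI[of _ "X -` S \<inter> space \<mu>" "X -` K \<inter> space \<mu>" "X -` K' \<inter> space \<mu>"]) auto
  then show "(\<lambda>\<omega>. f (X \<omega>)) -` A \<inter> space (completion \<mu>) \<in> sets (completion \<mu>)" by simp
qed

lemma borel_measurable_ereal_lessI:
  assumes "\<And>a::real. {x \<in> space M. f x < ereal a} \<in> sets M"
  shows "f \<in> borel_measurable M"
proof (rule borel_measurableI_less)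
  fix y :: ereal
  show "{x \<in> space M. f x < y} \<in> sets M"
  proof (cases y)
    case (real r)
    then show ?thesis using assms by simp
  next
    case PInf
    have "{x \<in> space M. f x < y} = (\<Union>n::nat. {x \<in> space M. f x < ereal (real n)})"
      unfolding PInf by (auto simp: less_PInf_Ex_of_nat)
    then show ?thesis using assms by auto
  next
    case MInf
    then show ?thesis by simp
  qed
qed

section \<open>The dynamic programming principle\<close>

theorem theorem2p4:
  fixes \<iota> :: "'e::{polish_space,plus,minus}"
    and P :: "'e \<Rightarrow> 'e path measure set"
    and \<T> :: "('e path \<Rightarrow> ennreal) set"
    and G :: "'e path \<Rightarrow> ereal"
    and v :: "'e \<Rightarrow> ereal"
  assumes isolated: "open {\<iota>}"
    and plus_continuous: "continuous_on UNIV (\<lambda>(x::'e, y). x + y)"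
    and minus_continuous: "continuous_on UNIV (\<lambda>(x::'e, y). x - y)"
    and iota_fixed: "\<iota> + \<iota> - \<iota> = \<iota>"
    and P_iota: "P \<iota> = {return path_space (const_path \<iota>)}"
    and problem: "markov_control_problem \<iota> P \<T> G"
    and disintegrable: "approximately_disintegrable \<iota> P \<T> G"
    and value_function: "v = val_fun P G"
  shows "(lower_semianalytic v \<and> universally_measurable borel v) \<and>
    (\<forall>\<epsilon>>0. \<exists>\<nu>\<in>selectors \<iota> P. \<forall>x. eps_optimal P G \<epsilon> x (\<nu> x)) \<and>
    (\<forall>x. \<forall>\<tau>\<in>\<T>. v x =
      (INF \<mu> \<in> P x. expect \<mu> (\<lambda>\<omega>. if \<tau> \<omega> < \<infinity> then v (state_at \<iota> \<tau> \<omega>) else G \<omega>)))"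
proof -
  have P_ne: "P x \<noteq> {}" and P_laws: "P x \<subseteq> path_laws" for x
    using problem by (simp_all add: markov_control_problem_def controlled_markov_family_def)
  have random: "random_time \<tau>" if "\<tau> \<in> \<T>" for \<tau>
    using problem that by (simp add: markov_control_problem_def controlled_markov_family_def)
  have concat: "concat_law \<iota> \<tau> \<mu> \<nu> \<in> P x" if "\<mu> \<in> P x" "\<tau> \<in> \<T>" "\<nu> \<in> selectors \<iota> P" for x \<mu> \<tau> \<nu>
    using problem that by (simp add: markov_control_problem_def controlled_markov_family_def)
  have tail: "tail_random_variable \<iota> P \<T> G" using disintegrable by (simp add: approximately_disintegrable_def)
  have G: "G \<in> borel_measurable path_space" using tail by (simp add: tail_random_variable_def)
  have tail_eq: "expect (concat_law \<iota> \<tau> \<mu> \<nu>) G =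
      expect \<mu> (\<lambda>\<omega>. if \<tau> \<omega> < \<infinity> then expect (\<nu> (state_at \<iota> \<tau> \<omega>)) G else G \<omega>)"
    if "\<mu> \<in> P x" "\<nu> \<in> selectors \<iota> P" "\<tau> \<in> \<T>" for x \<mu> \<nu> \<tau>
  proof -
    have "(x, \<mu>) \<in> graph P" using that(1) by (simp add: graph_def)
    then show ?thesis using tail that(2,3) unfolding tail_random_variable_def by fast
  qed
  have disint: "\<exists>\<nu>\<in>selectors \<iota> P. expect (concat_law \<iota> \<tau> \<mu> \<nu>) G \<le> expect \<mu> G + ereal \<epsilon>"
    if "\<mu> \<in> P x" "\<tau> \<in> \<T>" "0 < \<epsilon>" for x \<mu> \<tau> \<epsilon>
  proof -
    have "(x, \<mu>) \<in> graph P" using that(1) by (simp add: graph_def)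
    then show ?thesis using disintegrable that(2,3) unfolding approximately_disintegrable_def by fast
  qed
  have v_le: "v x \<le> expect \<mu> G" if "\<mu> \<in> P x" for x \<mu>
    unfolding value_function val_fun_def using that by (rule INF_lower)
  have v_less: "v x < c \<longleftrightarrow> (\<exists>\<mu>\<in>P x. expect \<mu> G < c)" for x c
    by (simp add: value_function val_fun_def INF_less_iff)

  have "analytic_in (prod_topology euclidean weak_topology) (graph P)"
    using problem by (simp add: markov_control_problem_def controlled_markov_family_def)
  then obtain B where B: "B \<in> borel_sets (prod_topology (prod_topology euclidean weak_topology) euclideanreal)"
    and graph_B: "graph P = fst ` B"
    unfolding analytic_in_def by (elim bexE)
  define M where "M = ((borel :: 'e measure) \<Otimes>\<^sub>M prob_algebra (path_space :: 'e path measure)) \<Otimes>\<^sub>M (borel :: real measure)"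
  have BM: "B \<in> sets M" unfolding M_def using B by (rule borel_law_product_measurable)
  \<comment> \<open>The graph restricted to laws with cost below \<open>c\<close>.\<close>
  define C where "C c = {p \<in> space M. expect (snd (fst p)) G < c} \<inter> B" for c
  have CM: "C c \<in> sets M" for c
  proof -
    note [measurable] = expect_measurable[OF G]
    have "{p \<in> space M. expect (snd (fst p)) G < c} \<in> sets M" unfolding M_def by measurable
    then show ?thesis unfolding C_def using BM by (rule sets.Int)
  qed
  have fst_C: "(x, \<mu>) \<in> fst ` C c \<longleftrightarrow> \<mu> \<in> P x \<and> expect \<mu> G < c" for x \<mu> c
  proof -
    have "(x, \<mu>) \<in> fst ` C c \<longleftrightarrow> (x, \<mu>) \<in> fst ` B \<and> expect \<mu> G < c"
      using sets.sets_into_space[OF BM] by (force simp: C_def image_iff)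
    then show ?thesis by (simp add: graph_B[symmetric] graph_def)
  qed
  have dom_C: "{x. \<exists>\<mu>. (x, \<mu>) \<in> fst ` C c} = {x. v x < c}" for c
    using v_less by (auto simp: fst_C)
  have C_sel: "\<exists>s. s \<in> measurable (univ_space borel) (prob_algebra path_space) \<and>
      (\<forall>x. v x < c \<longrightarrow> s x \<in> P x \<and> expect (s x) G < c)" for c
  proof -
    from analytic_law_selection(3)[OF CM[of c, unfolded M_def], unfolded dom_C]
    obtain s where "s \<in> measurable (univ_space borel) (prob_algebra path_space)"
      "\<forall>x\<in>{x. v x < c}. (x, s x) \<in> fst ` C c" by (elim bexE)
    then show ?thesis by (intro exI[of _ s]) (simp add: fst_C)
  qed

  have lsa: "lower_semianalytic v"
    unfolding lower_semianalytic_def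
  proof
    fix a :: real
    show "analytic_in euclidean {x. v x < ereal a}"
      using analytic_law_selection(1)[OF CM[of "ereal a", unfolded M_def]] unfolding dom_C .
  qed
  have v_meas: "v \<in> borel_measurable (univ_space borel)"
  proof (rule borel_measurable_ereal_lessI)
    fix a :: real
    show "{x \<in> space (univ_space borel). v x < ereal a} \<in> sets (univ_space borel)"
      using analytic_law_selection(2)[OF CM[of "ereal a", unfolded M_def]] unfolding dom_C
      by (simp add: sets_univ_space)
  qed
  note [measurable] = v_meas

  have selection: "\<exists>\<nu>\<in>selectors \<iota> P. \<forall>x. eps_optimal P G \<epsilon> x (\<nu> x)" if \<epsilon>: "0 < \<epsilon>" for \<epsilon>
  proof -
    \<comment> \<open>A selector of the whole graph serves the points of value \<open>\<infinity>\<close>.\<close>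
    obtain t where t: "t \<in> measurable (univ_space borel) (prob_algebra path_space)"
      "\<forall>x\<in>{x. \<exists>\<mu>. (x, \<mu>) \<in> fst ` B}. (x, t x) \<in> fst ` B"
      using analytic_law_selection(3)[OF BM[unfolded M_def]] by (elim bexE)
    have tP: "t x \<in> P x" for x
    proof -
      obtain \<mu> where "\<mu> \<in> P x" using P_ne[of x] by auto
      then have "(x, \<mu>) \<in> fst ` B" by (simp add: graph_B[symmetric] graph_def)
      then have "(x, t x) \<in> fst ` B" using t(2) by blast
      then show ?thesis by (simp add: graph_B[symmetric] graph_def)
    qed
    \<comment> \<open>Countably many levels, so that the selectors for all levels can be combined measurably.\<close>
    define a where "a n = ereal (real_of_rat (from_nat n))" for n
    have "\<forall>n. \<exists>s. s \<in> measurable (univ_space borel) (prob_algebra path_space) \<and>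
      (\<forall>x. v x < a n \<longrightarrow> s x \<in> P x \<and> expect (s x) G < a n)" using C_sel by simp
    from choice[OF this] obtain s where
      s: "\<forall>n. s n \<in> measurable (univ_space borel) (prob_algebra path_space) \<and>
      (\<forall>x. v x < a n \<longrightarrow> s n x \<in> P x \<and> expect (s n x) G < a n)" ..
    define ok where "ok n x \<longleftrightarrow> v x < a n \<and> (if v x = -\<infinity> then a n \<le> ereal (- 1 / \<epsilon>) else a n \<le> v x + ereal \<epsilon>)" for n x
    have ok_meas [measurable]: "Measurable.pred (univ_space borel) (ok n)" for n
      unfolding ok_def by measurable
    have ok_ex: "\<exists>n. ok n x" if fin: "v x \<noteq> \<infinity>" for x
    proof (cases "v x")
      case (real r)
      obtain q where "r < real_of_rat q" "real_of_rat q < r + \<epsilon>" using of_rat_dense[of r "r + \<epsilon>"] \<epsilon> by auto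
      then show ?thesis by (intro exI[of _ "to_nat q"]) (simp add: ok_def a_def real)
    next
      case MInf
      obtain q where "real_of_rat q < - 1 / \<epsilon>" using of_rat_dense[of "- 1 / \<epsilon> - 1" "- 1 / \<epsilon>"] by auto
      then show ?thesis by (intro exI[of _ "to_nat q"]) (simp add: ok_def a_def MInf)
    qed (use fin in simp)
    define k where "k x = (LEAST n. ok n x)" for x
    have k_meas: "k \<in> measurable (univ_space borel) (count_space UNIV)" unfolding k_def by measurable
    have ok_k: "ok (k x) x" if "v x \<noteq> \<infinity>" for x unfolding k_def using ok_ex[OF that] by (rule LeastI_ex)
    define \<nu> where "\<nu> x = (if v x = \<infinity> then t x else s (k x) x)" for x
    have s_meas: "(\<lambda>x. s (k x) x) \<in> measurable (univ_space borel) (prob_algebra path_space)"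
      by (rule measurable_compose_countable[OF _ k_meas]) (use s in simp)
    have \<nu>_meas: "\<nu> \<in> measurable (univ_space borel) (prob_algebra path_space)"
      unfolding \<nu>_def using t(1) s_meas by (rule measurable_If) measurable
    have opt: "eps_optimal P G \<epsilon> x (\<nu> x)" for x
    proof (cases "v x = \<infinity>")
      case True
      then show ?thesis using tP by (simp add: eps_optimal_def \<nu>_def flip: value_function)
    next
      case False
      have okx: "ok (k x) x" using ok_k[OF False] .
      have sx: "s (k x) x \<in> P x" "expect (s (k x) x) G < a (k x)"
        using s okx by (simp_all add: ok_def)
      have "a (k x) \<le> (if v x = -\<infinity> then ereal (- 1 / \<epsilon>) else v x + ereal \<epsilon>)"
        using okx by (simp add: ok_def split: if_splits)
      then have "expect (s (k x) x) G < (if v x = -\<infinity> then ereal (- 1 / \<epsilon>) else v x + ereal \<epsilon>)"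
        by (rule less_le_trans[OF sx(2)])
      then show ?thesis using sx(1) False unfolding eps_optimal_def value_function[symmetric] \<nu>_def by simp
    qed
    have \<nu>P: "\<nu> x \<in> P x" for x using opt[of x] by (simp add: eps_optimal_def)
    have "kernel \<iota> \<nu>"
      unfolding kernel_def
    proof (intro conjI allI ballI)
      show "\<nu> x \<in> path_laws" for x using \<nu>P P_laws by blast
      \<comment> \<open>The only law available at \<open>\<iota>\<close> is the required one.\<close>
      show "\<nu> \<iota> = return path_space (const_path \<iota>)" using \<nu>P[of \<iota>] by (simp add: P_iota)
      fix A :: "'e path set" assume A: "A \<in> sets path_space"
      have "(\<lambda>\<mu>. measure \<mu> A) \<in> borel_measurable (prob_algebra path_space)"
        unfolding prob_algebra_def by (rule measurable_restrict_space1[OF measurable_measure_subprob_algebra[OF A]])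
      from measurable_compose[OF \<nu>_meas this]
      show "universally_measurable borel (\<lambda>x. measure (\<nu> x) A)"        unfolding universally_measurable_iff .
    qed
    then have "\<nu> \<in> selectors \<iota> P" using \<nu>P by (simp add: selectors_def)
    then show ?thesis using opt by (intro bexI[of _ \<nu>] allI)
  qed

  have dpp: "v x = (INF \<mu> \<in> P x. expect \<mu> (\<lambda>\<omega>. if \<tau> \<omega> < \<infinity> then v (state_at \<iota> \<tau> \<omega>) else G \<omega>))"
    if \<tau>: "\<tau> \<in> \<T>" for x \<tau>
  proof (rule antisym)
    let ?Y = "\<lambda>\<omega>. if \<tau> \<omega> < \<infinity> then v (state_at \<iota> \<tau> \<omega>) else G \<omega>"
    let ?Z = "\<lambda>\<nu> \<omega>. if \<tau> \<omega> < \<infinity> then expect (\<nu> (state_at \<iota> \<tau> \<omega>)) G else G \<omega>"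
    have "\<forall>k. \<exists>\<nu>. \<nu> \<in> selectors \<iota> P \<and> (\<forall>x. eps_optimal P G (1 / real (Suc k)) x (\<nu> x))"
    proof
      fix k
      have "0 < 1 / real (Suc k)" by simp
      from selection[OF this] show "\<exists>\<nu>. \<nu> \<in> selectors \<iota> P \<and> (\<forall>x. eps_optimal P G (1 / real (Suc k)) x (\<nu> x))"
        by (elim bexE) (intro exI conjI)
    qed
    from choice[OF this] obtain \<nu> where
      \<nu>: "\<forall>k. \<nu> k \<in> selectors \<iota> P \<and> (\<forall>x. eps_optimal P G (1 / real (Suc k)) x (\<nu> k x))" ..
    show "v x \<le> (INF \<mu> \<in> P x. expect \<mu> ?Y)"
    proof (rule INF_greatest)
      fix \<mu> assume mu: "\<mu> \<in> P x"
      then have law: "\<mu> \<in> path_laws" using P_laws by blast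
      have \<tau>m: "\<tau> \<in> borel_measurable (completion \<mu>)"
      proof -
        have "\<tau> \<in> borel_measurable path_space" using random[OF \<tau>] by (simp add: random_time_def)
        then have "\<tau> \<in> borel_measurable \<mu>" unfolding measurable_cong_sets[OF prob_algebraD(1)[OF law] refl] .
        then show ?thesis by (rule measurable_completion)
      qed
      have Gm: "G \<in> borel_measurable (completion \<mu>)"
      proof -
        have "G \<in> borel_measurable \<mu>" unfolding measurable_cong_sets[OF prob_algebraD(1)[OF law] refl] by (rule G)
        then show ?thesis by (rule measurable_completion)
      qed
      have vm: "(\<lambda>\<omega>. v (state_at \<iota> \<tau> \<omega>)) \<in> borel_measurable (completion \<mu>)"
        by (rule universally_measurable_compose[OF v_meas state_at_measurable[OF random[OF \<tau>]] law])
      have Ym: "?Y \<in> borel_measurable (completion \<mu>)"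
      proof -
        note [measurable] = \<tau>m Gm vm
        show ?thesis by measurable
      qed
      show "v x \<le> expect \<mu> ?Y"
      proof (rule le_expect_of_relaxed[OF prob_algebraD(3)[OF law] Ym,
            where Z = "\<lambda>k. ?Z (\<nu> k)"])
        fix k
        have sel: "\<nu> k \<in> selectors \<iota> P" using \<nu> by simp
        have "v x \<le> expect (concat_law \<iota> \<tau> \<mu> (\<nu> k)) G"
          by (rule v_le[OF concat[OF mu \<tau> sel]])
        also have "\<dots> = expect \<mu> (?Z (\<nu> k))"
          by (rule tail_eq[OF mu sel \<tau>])
        finally show "v x \<le> expect \<mu> (?Z (\<nu> k))" .
      next
        fix k \<omega> assume Y: "?Y \<omega> \<noteq> \<infinity>"
        show "?Z (\<nu> k) \<omega> \<le> relaxed k (?Y \<omega>)"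
        proof (cases "\<tau> \<omega> < \<infinity>")
          case True
          define z where "z = state_at \<iota> \<tau> \<omega>"
          have vz: "v z \<noteq> \<infinity>" using Y True by (simp add: z_def)
          have "eps_optimal P G (1 / real (Suc k)) z (\<nu> k z)" using \<nu> by simp
          then have "expect (\<nu> k z) G < (if v z = -\<infinity> then ereal (- 1 / (1 / real (Suc k)))
              else v z + ereal (1 / real (Suc k)))"
            using vz unfolding eps_optimal_def value_function[symmetric] by blast
          moreover have "- 1 / (1 / real (Suc k)) = - real (Suc k)" by simp
          ultimately have "expect (\<nu> k z) G < relaxed k (v z)"
            unfolding relaxed_def by (simp only:)
          then show ?thesis using True by (simp add: z_def)
        next
          case False
          have "G \<omega> \<le> relaxed k (G \<omega>)"
            by (cases "G \<omega>") (simp_all add: relaxed_def)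
          then show ?thesis using False by simp
        qed
      qed
    qed
    show "(INF \<mu> \<in> P x. expect \<mu> ?Y) \<le> v x"
      unfolding value_function val_fun_def[of P G x]
    proof (rule INF_greatest)
      fix \<mu> assume mu: "\<mu> \<in> P x"
      show "(INF \<mu> \<in> P x. expect \<mu> (\<lambda>\<omega>. if \<tau> \<omega> < \<infinity> then val_fun P G (state_at \<iota> \<tau> \<omega>) else G \<omega>)) \<le> expect \<mu> G"
        unfolding value_function[symmetric]
      proof (rule ereal_le_epsilon2)
        fix e :: real assume "0 < e"
        from disint[OF mu \<tau> this] obtain \<nu> where \<nu>: "\<nu> \<in> selectors \<iota> P"
          "expect (concat_law \<iota> \<tau> \<mu> \<nu>) G \<le> expect \<mu> G + ereal e" ..
        have "(INF \<mu> \<in> P x. expect \<mu> ?Y) \<le> expect \<mu> ?Y" using mu by (rule INF_lower)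
        also have "\<dots> \<le> expect \<mu> (?Z \<nu>)"
        proof (rule expect_mono)
          fix \<omega>
          have "\<nu> z \<in> P z" for z using \<nu>(1) by (simp add: selectors_def)
          then show "?Y \<omega> \<le> ?Z \<nu> \<omega>"
            by (simp add: v_le)
        qed
        also have "\<dots> = expect (concat_law \<iota> \<tau> \<mu> \<nu>) G" by (rule tail_eq[OF mu \<nu>(1) \<tau>, symmetric])
        also note \<nu>(2)
        finally show "(INF \<mu> \<in> P x. expect \<mu> ?Y) \<le> expect \<mu> G + ereal e" .
      qed
    qed
  qed
  show ?thesis
    using lsa v_meas selection dpp by (simp add: universally_measurable_iff)
qed

end
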